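(* Let $(\alpha_1,\ldots,\alpha_r;\beta_1,\ldots,\beta_r)$ be an admissible pair of sequences of non-negative integers with respect to $P(t)=(n-r)t+d+(n-r)$. Write the multiplicity patterns of the two sequences as $$\alpha_1=\cdots=\alpha_{j_1}<\alpha_{j_1+1}=\cdots=\alpha_{j_2}<\cdots<\alpha_{j_s+1}=\cdots=\alpha_r,$$ $$\beta_1=\cdots=\beta_{j'_1}<\beta_{j'_1+1}=\cdots=\beta_{j'_2}<\cdots<\beta_{j'_{s'}+1}=\cdots=\beta_r,$$ let $\mathrm{Fl}_{j_1,\ldots,j_s,r}(\mathbb{C}^n)$ and $\mathrm{Fl}_{j'_1,\ldots,j'_{s'},r}(\mathbb{C}^n)$ be the corresponding flag manifolds, and let $$\mathrm{Fl}_{j_1,\ldots,j_s,r}(\mathbb{C}^n)\to \mathrm{Gr}_r(\mathbb{C}^n),\qquad \mathrm{Fl}_{j'_1,\ldots,j'_{s'},r}(\mathbb{C}^n)\to \mathrm{Gr}_r(\mathbb{C}^n)$$ be the natural projections (sending a flag to its $r$-dimensional member). Then the subset $F_{\alpha_1,\ldots,\alpha_r;\beta_1,\ldots,\beta_r}$ of the $S^1$-fixed-point locus of $\mathrm{Quot}_P(\mathcal{E}^n)$ associated to $(\alpha_1,\ldots,\alpha_r;\beta_1,\ldots,\beta_r)$ is connected and is given (topologically, through the correspondence sending a fixed subsheaf to its pair of flags) by the fiber product $$\mathrm{Fl}_{j_1,\ldots,j_s,r}(\mathbb{C}^n)\times_{\mathrm{Gr}_r(\mathbb{C}^n)}\m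athrm{Fl}_{j'_1,\ldots,j'_{s'},r}(\mathbb{C}^n).$$
   Context: Let $1\le r\le n$ and $d\ge 0$ be integers. $C=\mathbb{CP}^1=\mathbb{C}\cup\{\infty\}$ with affine charts $U_0=C-\{\infty\}=\mathrm{Spec}\,\mathbb{C}[z]$ and $U_\infty=C-\{0\}=\mathrm{Spec}\,\mathbb{C}[w]$, $w=1/z$. $\mathcal{E}^n=\mathcal{O}_C\otimes\mathbb{C}^n$ is the trivialized trivial bundle of rank $n$. $\mathrm{Quot}_P(\mathcal{E}^n)$ is the Quot-scheme of quotients $\mathcal{E}^n\to\mathcal{E}^n/\mathcal{V}$ with Hilbert polynomial $P(t)=(n-r)t+d+(n-r)$ with respect to $\mathcal{O}_C(1)$; a point is the same as a coherent subsheaf $\mathcal{V}\subset\mathcal{E}^n$ of rank $r$ with $\deg(\mathcal{E}^n/\mathcal{V})=d$. The group $S^1=U(1)\subset\mathbb{C}^\times$ acts on $C$ by $z\mapsto tz$, on $\mathcal{E}^n$ by $(z,v)\mapsto(tz,v)$, and on subsheaves by $(t\cdot s)(z)=s(t^{-1}z)$ on local sections; this gives the $S^1$-action on $\mathrm{Quot}_P(\mathcal{E}^n)$. A constant subsheaf of $\mathcal{E}^n$ is one of the form $\mathcal{O}_C\otimes W$ with $W\subset\mathbb{C}^n$ a linear subspace. Each $S^1$-invariant rank-$r$ subsheaf $\mathcal{V}$ is contained in a unique constant subsheaf $\widehat{\mathcal{V}}=\mathcal{O}_C\otimes W$ of rank $r$. There are a basis $u_1,\ldots,u_r$ of $W$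 and integers $0\le\alpha_1\le\cdots\le\alpha_r$ with $\mathcal{V}|_{U_0}$ associated to the module $\bigoplus_i\mathbb{C}[z]\,z^{\alpha_i}u_i$, and a (possibly different) basis $u'_1,\ldots,u'_r$ of $W$ and integers $0\le\beta_1\le\cdots\le\beta_r$ with $\mathcal{V}|_{U_\infty}$ associated to $\bigoplus_i\mathbb{C}[w]\,w^{\beta_i}u'_i$. The integers are determined by $\mathcal{V}$. $(\alpha_1,\ldots,\alpha_r;\beta_1,\ldots,\beta_r)$ is an admissible pair of sequences with respect to $P(t)$ if $0\le\alpha_1\le\cdots\le\alpha_r$, $0\le\beta_1\le\cdots\le\beta_r$, and $\sum_i\alpha_i+\sum_i\beta_i=d$. $F_{\alpha_1,\ldots,\alpha_r;\beta_1,\ldots,\beta_r}$ is the set of $S^1$-fixed points $\mathcal{V}$ whose associated integers are the given ones. The flags attached to $\mathcal{V}$ are $\mathrm{Span}\{u_1,\ldots,u_{j_1}\}\subset\mathrm{Span}\{u_1,\ldots,u_{j_2}\}\subset\cdots\subset\mathrm{Span}\{u_1,\ldots,u_{j_s}\}\subset W\subset\mathbb{C}^n$ and similarly the one built from $u'_i$ and $j'_1,\ldots,j'_{s'}$. $\mathrm{Fl}_{j_1,\ldots,j_s,r}(\mathbb{C}^n)$ is the manifold of flags of subspaces of $\mathbb{C}^n$ of dimensions $j_1<\cdots<j_s<r$ (equal to $\mathrm{Gr}_r(\mathbb{C}^n)$ if $s=0$). *)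

theory Defs
  imports
    "HOL-Analysis.Analysis"
    "HOL-Computational_Algebra.Polynomial"
    "HOL-Library.Poly_Mapping"
begin

section \<open>Laurent polynomial vectors\<close>

text \<open>
  The coordinate ring \<open>\<complex>[z, 1/z]\<close> of \<open>U\<^sub>0 \<inter> U\<^sub>\<infinity>\<close> is the group algebra of the integers, with the
  convolution product of \<open>Poly_Mapping\<close>. The rings \<open>\<complex>[z]\<close> and \<open>\<complex>[w]\<close>, \<open>w = 1/z\<close>, of the two
  charts are regarded as subrings of it, and the sections of \<open>\<O> \<otimes> \<complex>\<^sup>n\<close> over the three open sets
  as subsets of \<open>\<complex>[z, 1/z]\<^sup>n\<close>.
\<close>

type_synonym laurent = "int \<Rightarrow>\<^sub>0 complex"

definition zpow :: "int \<Rightarrow> laurent" where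
  "zpow k = Poly_Mapping.single k 1"

definition ring0 :: "laurent set" where
  "ring0 = {p. Poly_Mapping.keys p \<subseteq> {0..}}"

definition ring_inf :: "laurent set" where
  "ring_inf = {p. Poly_Mapping.keys p \<subseteq> {..0}}"

definition lscale :: "complex \<Rightarrow> laurent^'n \<Rightarrow> laurent^'n" where
  "lscale c f = Poly_Mapping.single 0 c *s f"

definition const_vec :: "complex^'n \<Rightarrow> laurent^'n" where
  "const_vec v = (\<chi> i. Poly_Mapping.single 0 (v $ i))"

definition coeff_vec :: "laurent^'n \<Rightarrow> int \<Rightarrow> complex^'n" where
  "coeff_vec f k = (\<chi> i. Poly_Mapping.lookup (f $ i) k)"

definition zshift :: "int \<Rightarrow> (laurent^'n) set \<Rightarrow> (laurent^'n) set" where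
  "zshift k M = (\<lambda>f. zpow k *s f) ` M"

lemma vector_space_lscale: "vector_space lscale"
  by unfold_locales
    (simp_all add: lscale_def vec_eq_iff distrib_left distrib_right single_add mult_single
      flip: mult.assoc single_one)

definition lscale2 :: "complex \<Rightarrow> (laurent^'n) \<times> (laurent^'n) \<Rightarrow> (laurent^'n) \<times> (laurent^'n)" where
  "lscale2 c = map_prod (lscale c) (lscale c)"

lemma vector_space_lscale2: "vector_space lscale2"
proof -
  interpret vector_space lscale by (rule vector_space_lscale)
  show ?thesis
    by unfold_locales
      (auto simp: lscale2_def scale_right_distrib scale_left_distrib)
qed


section \<open>Coherent subsheaves of the trivial bundle on the projective line\<close>

text \<open>
  A coherent subsheaf is given by a \<open>\<complex>[z]\<close>-submodule of \<open>\<complex>[z]\<^sup>n\<close> and a \<open>\<complex>[w]\<close>-submodule of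
  \<open>\<complex>[w]\<^sup>n\<close> that have the same localisation in \<open>\<complex>[z, 1/z]\<^sup>n\<close>. The same pairs, with submodules of
  \<open>\<complex>[z, 1/z]\<^sup>n\<close>, describe the twists.
\<close>

type_synonym 'n sheaf = "(laurent^'n) set \<times> (laurent^'n) set"

definition submodule_over :: "laurent set \<Rightarrow> (laurent^'n) set \<Rightarrow> bool" where
  "submodule_over R M \<longleftrightarrow>
     0 \<in> M \<and> (\<forall>f\<in>M. \<forall>g\<in>M. f + g \<in> M) \<and> (\<forall>p\<in>R. \<forall>f\<in>M. p *s f \<in> M)"

definition triv :: "('n::finite) sheaf" where
  "triv = ({f. \<forall>i. f $ i \<in> ring0}, {f. \<forall>i. f $ i \<in> ring_inf})"

definition localize0 :: "(laurent^'n) set \<Rightarrow> (laurent^'n) set" where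
  "localize0 M = (\<Union>k::nat. zshift (- int k) M)"

definition localize_inf :: "(laurent^'n) set \<Rightarrow> (laurent^'n) set" where
  "localize_inf M = (\<Union>k::nat. zshift (int k) M)"

definition subsheaf :: "('n::finite) sheaf \<Rightarrow> bool" where
  "subsheaf V \<longleftrightarrow>
     submodule_over ring0 (fst V) \<and> fst V \<subseteq> fst triv \<and>
     submodule_over ring_inf (snd V) \<and> snd V \<subseteq> snd triv \<and>
     localize0 (fst V) = localize_inf (snd V)"

text \<open>
  The twist by \<open>\<O>(m)\<close>: a section of \<open>\<O>(m)\<close> is a pair of \<open>a \<in> \<complex>[z]\<close> and \<open>b \<in> \<complex>[w]\<close> with
  \<open>a = z\<^sup>m b\<close>, so \<open>\<O>(m)\<close> is embedded in \<open>\<complex>[z, 1/z]\<close> via \<open>(a, b) \<mapsto> (a, z\<^sup>m b)\<close>.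
\<close>

definition twist :: "('n::finite) sheaf \<Rightarrow> int \<Rightarrow> 'n sheaf" where
  "twist V m = (fst V, zshift m (snd V))"

definition global_sections :: "('n::finite) sheaf \<Rightarrow> (laurent^'n) set" where
  "global_sections V = fst V \<inter> snd V"


section \<open>The Hilbert polynomial of the quotient\<close>

text \<open>\<open>quotient_dim s A B k\<close>: the residue classes of some \<open>k\<close> vectors form a basis of \<open>A / B\<close>.\<close>

definition quotient_dim ::
    "(complex \<Rightarrow> 'a \<Rightarrow> 'a::ab_group_add) \<Rightarrow> 'a set \<Rightarrow> 'a set \<Rightarrow> nat \<Rightarrow> bool" where
  "quotient_dim scl A B k \<longleftrightarrow>
     (\<exists>S\<subseteq>A. finite S \<and> card S = k \<and> \<not> module.dependent scl S \<and>
        module.span scl S \<inter> B = {0} \<and>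
        A = {x + y | x y. x \<in> module.span scl S \<and> y \<in> B})"

text \<open>
  Cohomology of \<open>(\<E>\<^sup>n/\<V>)(t)\<close> from the Cech complex of the cover \<open>U\<^sub>0, U\<^sub>\<infinity>\<close>: its terms are
  \<open>\<E>(t)(U\<^sub>0)/\<V>(t)(U\<^sub>0) \<oplus> \<E>(t)(U\<^sub>\<infinity>)/\<V>(t)(U\<^sub>\<infinity>)\<close> and \<open>\<complex>[z, 1/z]\<^sup>n / \<V>(U\<^sub>0 \<inter> U\<^sub>\<infinity>)\<close>, and the
  differential is the difference of the restrictions.
\<close>

definition quot_h0 :: "('n::finite) sheaf \<Rightarrow> int \<Rightarrow> nat \<Rightarrow> bool" where
  "quot_h0 V t = quotient_dim lscale2
     {(a, b). a \<in> fst (twist triv t) \<and> b \<in> snd (twist triv t) \<and> a - b \<in> localize0 (fst V)}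
     (fst (twist V t) \<times> snd (twist V t))"

definition quot_h1 :: "('n::finite) sheaf \<Rightarrow> int \<Rightarrow> nat \<Rightarrow> bool" where
  "quot_h1 V t = quotient_dim lscale UNIV
     {a - b + c | a b c. a \<in> fst (twist triv t) \<and> b \<in> snd (twist triv t) \<and> c \<in> localize0 (fst V)}"

definition has_hilbert_poly :: "('n::finite) sheaf \<Rightarrow> int poly \<Rightarrow> bool" where
  "has_hilbert_poly V P \<longleftrightarrow>
     (\<forall>t. \<exists>h0 h1. quot_h0 V t h0 \<and> quot_h1 V t h1 \<and> int h0 - int h1 = poly P t)"

text \<open>\<open>P(t) = (n - r) t + d + (n - r)\<close>\<close>

definition quot_poly :: "nat \<Rightarrow> nat \<Rightarrow> nat \<Rightarrow> int poly" where
  "quot_poly n r d = [:int d + (int n - int r), int n - int r:]"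

definition Quot :: "int poly \<Rightarrow> ('n::finite) sheaf set" where
  "Quot P = {V. subsheaf V \<and> has_hilbert_poly V P}"


section \<open>Grassmannians\<close>

text \<open>The quotient topology on the image of a map.\<close>

definition image_topology :: "'a topology \<Rightarrow> ('a \<Rightarrow> 'b) \<Rightarrow> 'b topology" where
  "image_topology X f =
     topology (\<lambda>U. U \<subseteq> f ` topspace X \<and> openin X {x \<in> topspace X. f x \<in> U})"

lemma openin_image_topology:
  "openin (image_topology X f) U \<longleftrightarrow>
     U \<subseteq> f ` topspace X \<and> openin X {x \<in> topspace X. f x \<in> U}"
proof -
  have "istopology (\<lambda>U. U \<subseteq> f ` topspace X \<and> openin X {x \<in> topspace X. f x \<in> U})"
    unfolding istopology_def
  proof (intro conjI allI impI)
    fix S T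
    assume "S \<subseteq> f ` topspace X \<and> openin X {x \<in> topspace X. f x \<in> S}"
      and "T \<subseteq> f ` topspace X \<and> openin X {x \<in> topspace X. f x \<in> T}"
    moreover have "{x \<in> topspace X. f x \<in> S \<inter> T} =
        {x \<in> topspace X. f x \<in> S} \<inter> {x \<in> topspace X. f x \<in> T}"
      by auto
    ultimately show "S \<inter> T \<subseteq> f ` topspace X" "openin X {x \<in> topspace X. f x \<in> S \<inter> T}"
      by auto
  next
    fix \<K>
    assume *: "\<forall>K\<in>\<K>. K \<subseteq> f ` topspace X \<and> openin X {x \<in> topspace X. f x \<in> K}"
    then show "\<Union> \<K> \<subseteq> f ` topspace X" by blast
    have "{x \<in> topspace X. f x \<in> \<Union> \<K>} = (\<Union>K\<in>\<K>. {x \<in> topspace X. f x \<in> K})"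
      by auto
    with * show "openin X {x \<in> topspace X. f x \<in> \<Union> \<K>}" by auto
  qed
  then show ?thesis
    unfolding image_topology_def by (simp add: topology_inverse')
qed

lemma quotient_map_image_topology: "quotient_map X (image_topology X f) f"
proof -
  have "openin (image_topology X f) (f ` topspace X)"
    by (simp add: openin_image_topology)
      (metis (no_types, lifting) Collect_cong Collect_mem_eq image_eqI openin_topspace)
  then have "topspace (image_topology X f) = f ` topspace X"
    by (metis openin_image_topology openin_subset openin_topspace subset_antisym)
  then show ?thesis
    by (auto simp: quotient_map_def openin_image_topology)
qed

text \<open>
  The Grassmannian of \<open>k\<close>-dimensional subspaces of the complex vector space carried by \<open>topspace X\<close>,
  with the quotient topology from the space of \<open>k\<close>-frames.
\<close>

definition frame_topology ::
    "(complex \<Rightarrow> 'a \<Rightarrow> 'a::ab_group_add) \<Rightarrow> 'a topology \<Rightarrow> nat \<Rightarrow> (nat \<Rightarrow> 'a) topology" where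
  "frame_topology scl X k =
     subtopology (product_topology (\<lambda>_. X) {1..k})
       {u. inj_on u {1..k} \<and> \<not> module.dependent scl (u ` {1..k})}"

definition Gr ::
    "(complex \<Rightarrow> 'a \<Rightarrow> 'a::ab_group_add) \<Rightarrow> 'a topology \<Rightarrow> nat \<Rightarrow> 'a set topology" where
  "Gr scl X k = image_topology (frame_topology scl X k) (\<lambda>u. module.span scl (u ` {1..k}))"


section \<open>The topology of the Quot scheme\<close>

text \<open>
  The vector space \<open>H\<^sup>0(\<E>\<^sup>n(m)) = \<complex>[z]\<^bsub>\<le> m\<^esub>\<^sup>n\<close> with the topology of the coefficients, which on this
  finite-dimensional space is the usual one.
\<close>

definition sections_topology :: "nat \<Rightarrow> (laurent^'n::finite) topology" where
  "sections_topology m =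
     pullback_topology (global_sections (twist triv (int m))) coeff_vec euclidean"

text \<open>
  The classical topology on the closed points of the Quot scheme, induced by Grothendieck's closed
  immersion \<open>\<V> \<mapsto> H\<^sup>0(\<V>(m))\<close> into the Grassmannian of subspaces of \<open>H\<^sup>0(\<E>\<^sup>n(m))\<close> of codimension
  \<open>P(m)\<close>. For \<open>P\<close> as in \<open>quot_poly n r d\<close> one can take \<open>m = d\<close>: every such \<open>\<V>\<close> is a sum of line bundles
  \<open>\<O>(- a\<^sub>i)\<close> with \<open>a\<^sub>i \<ge> 0\<close> and \<open>\<Sum> a\<^sub>i = d\<close>, so that \<open>\<V>\<close>, \<open>\<E>\<^sup>n\<close> and \<open>\<E>\<^sup>n/\<V>\<close> are all \<open>d\<close>-regular; in
  particular \<open>H\<^sup>0(\<V>(d))\<close> has codimension \<open>P(d)\<close> for all points \<open>\<V>\<close>, none is lost in the pullback.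
\<close>

definition quot_topology :: "int poly \<Rightarrow> nat \<Rightarrow> ('n::finite) sheaf topology" where
  "quot_topology P m =
     pullback_topology (Quot P) (\<lambda>V. global_sections (twist V (int m)))
       (Gr lscale (sections_topology m) (nat (int (CARD('n) * (m + 1)) - poly P (int m))))"

definition quot_space :: "nat \<Rightarrow> nat \<Rightarrow> ('n::finite) sheaf topology" where
  "quot_space r d = quot_topology (quot_poly CARD('n) r d) d"


section \<open>The circle action and its fixed points\<close>

text \<open>Both charts are invariant under rotation, so \<open>(t \<cdot> s)(z) = s(t\<^sup>-\<^sup>1 z)\<close> acts on each of them.\<close>

definition rotate_poly :: "complex \<Rightarrow> laurent \<Rightarrow> laurent" where
  "rotate_poly t p = Poly_Mapping.mapp (\<lambda>k c. c * inverse t powi k) p"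

definition rotate_section :: "complex \<Rightarrow> laurent^'n \<Rightarrow> laurent^'n" where
  "rotate_section t f = (\<chi> i. rotate_poly t (f $ i))"

definition rotate_sheaf :: "complex \<Rightarrow> ('n::finite) sheaf \<Rightarrow> 'n sheaf" where
  "rotate_sheaf t V = (rotate_section t ` fst V, rotate_section t ` snd V)"

definition fixed_points :: "nat \<Rightarrow> nat \<Rightarrow> ('n::finite) sheaf set" where
  "fixed_points r d =
     {V \<in> Quot (quot_poly CARD('n) r d). \<forall>t. cmod t = 1 \<longrightarrow> rotate_sheaf t V = V}"

text \<open>Sequences of length \<open>r\<close> are functions restricted to \<open>{1..r}\<close>.\<close>

definition admissible :: "nat \<Rightarrow> nat \<Rightarrow> (nat \<Rightarrow> nat) \<Rightarrow> (nat \<Rightarrow> nat) \<Rightarrow> bool" where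
  "admissible r d \<alpha> \<beta> \<longleftrightarrow>
     mono_on {1..r} \<alpha> \<and> mono_on {1..r} \<beta> \<and> (\<Sum>i=1..r. \<alpha> i) + (\<Sum>i=1..r. \<beta> i) = d"

definition basis_of :: "nat \<Rightarrow> (nat \<Rightarrow> complex^'n) \<Rightarrow> (complex^'n) set \<Rightarrow> bool" where
  "basis_of r u W \<longleftrightarrow>
     inj_on u {1..r} \<and> vec.independent (u ` {1..r}) \<and> vec.span (u ` {1..r}) = W"

text \<open>The modules \<open>\<Oplus> \<complex>[z] z\<^bsup>\<alpha>\<^sub>i\<^esup> u\<^sub>i\<close> and \<open>\<Oplus> \<complex>[w] w\<^bsup>\<beta>\<^sub>i\<^esup> u'\<^sub>i\<close>.\<close>

definition graded0 :: "nat \<Rightarrow> (nat \<Rightarrow> nat) \<Rightarrow> (nat \<Rightarrow> complex^'n) \<Rightarrow> (laurent^'n) set" where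
  "graded0 r \<alpha> u =
     {\<Sum>i=1..r. p i *s (zpow (int (\<alpha> i)) *s const_vec (u i)) | p. \<forall>i\<in>{1..r}. p i \<in> ring0}"

definition graded_inf :: "nat \<Rightarrow> (nat \<Rightarrow> nat) \<Rightarrow> (nat \<Rightarrow> complex^'n) \<Rightarrow> (laurent^'n) set" where
  "graded_inf r \<beta> u =
     {\<Sum>i=1..r. p i *s (zpow (- int (\<beta> i)) *s const_vec (u i)) | p. \<forall>i\<in>{1..r}. p i \<in> ring_inf}"

definition adapted_bases ::
    "nat \<Rightarrow> (nat \<Rightarrow> nat) \<Rightarrow> (nat \<Rightarrow> nat) \<Rightarrow> ('n::finite) sheaf \<Rightarrow>
     (nat \<Rightarrow> complex^'n) \<Rightarrow> (nat \<Rightarrow> complex^'n) \<Rightarrow> bool" where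
  "adapted_bases r \<alpha> \<beta> V u u' \<longleftrightarrow>
     (\<exists>W. basis_of r u W \<and> basis_of r u' W) \<and> V = (graded0 r \<alpha> u, graded_inf r \<beta> u')"

definition fixed_component ::
    "nat \<Rightarrow> nat \<Rightarrow> (nat \<Rightarrow> nat) \<Rightarrow> (nat \<Rightarrow> nat) \<Rightarrow> ('n::finite) sheaf set" where
  "fixed_component r d \<alpha> \<beta> = {V \<in> fixed_points r d. \<exists>u u'. adapted_bases r \<alpha> \<beta> V u u'}"


section \<open>Flag manifolds\<close>

text \<open>
  A flag with dimensions in a finite set \<open>D\<close> is a family of subspaces indexed by their dimension. The
  flag manifold is a subspace of a product of Grassmannians.
\<close>

definition Fl :: "nat set \<Rightarrow> (nat \<Rightarrow> (complex^'n::finite) set) topology" where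
  "Fl D = subtopology (product_topology (\<lambda>j. Gr (*s) euclidean j) D)
            {A. \<forall>i\<in>D. \<forall>j\<in>D. i \<le> j \<longrightarrow> A i \<subseteq> A j}"

text \<open>The dimensions \<open>{j\<^sub>1, \<dots>, j\<^sub>s, r}\<close> for the multiplicity pattern
  \<open>\<alpha>\<^sub>1 = \<dots> = \<alpha>\<^bsub>j\<^sub>1\<^esub> < \<dots> < \<alpha>\<^bsub>j\<^sub>s + 1\<^esub> = \<dots> = \<alpha>\<^sub>r\<close>.\<close>

definition flag_dims :: "nat \<Rightarrow> (nat \<Rightarrow> nat) \<Rightarrow> nat set" where
  "flag_dims r \<alpha> = insert r {j. 1 \<le> j \<and> j < r \<and> \<alpha> j < \<alpha> (j + 1)}"

definition flag_of :: "nat set \<Rightarrow> (nat \<Rightarrow> complex^'n) \<Rightarrow> nat \<Rightarrow> (complex^'n) set" where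
  "flag_of D u = (\<lambda>j\<in>D. vec.span (u ` {1..j}))"

definition fibre_product ::
    "'a topology \<Rightarrow> 'b topology \<Rightarrow> ('a \<Rightarrow> 'c) \<Rightarrow> ('b \<Rightarrow> 'c) \<Rightarrow> ('a \<times> 'b) topology" where
  "fibre_product X Y f g = subtopology (prod_topology X Y) {(x, y). f x = g y}"

end

theory Submission
  imports Defs
begin

text \<open>
  Let \<open>\<V>\<close> be the invariant subsheaf given by bases \<open>u\<close>, \<open>u'\<close> of \<open>W\<close> with exponents \<open>\<alpha>\<close>, \<open>\<beta>\<close>. Over the
  chart at \<open>0\<close> it consists of the Laurent polynomial vectors whose coefficient of \<open>z\<^sup>k\<close> lies in the step
  \<open>F\<^sub>k\<close>, spanned by the \<open>u\<^sub>i\<close> with \<open>\<alpha>\<^sub>i \<le> k\<close>, of a filtration of \<open>W\<close>; over the chart at \<open>\<infinity>\<close> the coefficient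
  of \<open>z\<^bsup>- k\<^esup>\<close> lies in the step \<open>G\<^sub>k\<close> of a second filtration of \<open>W\<close>. The exponents being given, the two
  filtrations amount to two flags in \<open>\<complex>\<^sup>n\<close> with the same largest member \<open>W\<close>. Every such pair of flags
  occurs, since a basis adapted to each flag yields a subsheaf with the right Hilbert polynomial
  (\<open>has_hilbert_poly_V\<close>). So the component is in bijection with the fibre product.

  The bijection is a homeomorphism because both topologies come from Grassmannians, and the topology
  of a Grassmannian is that of pointwise convergence of orthogonal projections
  (\<open>continuous_map_into_Gr_iff\<close>). The Quot scheme carries the topology of the subspace
  \<open>H\<^sup>0(\<V>(d)) = \<Oplus>\<^sub>k z\<^sup>k L\<^sub>k\<close> of \<open>H\<^sup>0(\<E>\<^sup>n(d))\<close>, where \<open>L\<^sub>k = F\<^sub>k \<inter> G\<^bsub>d - k\<^esub>\<close> and \<open>0 \<le> k \<le> d\<close>. As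
  \<open>\<alpha>\<^sub>r + \<beta>\<^sub>r \<le> d\<close>, one of the two steps in this intersection is always \<open>W\<close>, so \<open>L\<^sub>k\<close> is zero or a member of
  one of the flags, and each member of each flag occurs among the \<open>L\<^sub>k\<close>. For the Hermitian form in
  which monomials of different degree are orthogonal, the projection onto \<open>H\<^sup>0(\<V>(d))\<close> consists of the
  projections onto the \<open>L\<^sub>k\<close> (\<open>orth_proj_graded\<close>). Hence the former depends continuously on a
  parameter if and only if the projections onto the members of both flags do.

  The fibre product is connected because it is a continuous image of the space of pairs of
  invertible matrices \<open>M\<close>, \<open>N\<close> where \<open>N\<close> preserves the span of the first \<open>r\<close> coordinate vectors. The
  complex line through two such pairs leaves this space in only finitely many points, the zeros of
  the determinants, and so joins them (\<open>connected_invertible_pairs\<close>).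
\<close>

section \<open>Continuity of maps into a Grassmannian\<close>

definition orth_proj :: "('a \<Rightarrow> 'a \<Rightarrow> complex) \<Rightarrow> 'a::ab_group_add set \<Rightarrow> 'a \<Rightarrow> 'a" where
  "orth_proj ip L x = (THE p. p \<in> L \<and> (\<forall>y\<in>L. ip (x - p) y = 0))"

definition frame_for ::
    "(complex \<Rightarrow> 'a \<Rightarrow> 'a::ab_group_add) \<Rightarrow> nat \<Rightarrow> (nat \<Rightarrow> 'a) \<Rightarrow> bool" where
  "frame_for scl k u \<longleftrightarrow> inj_on u {1..k} \<and> \<not> module.dependent scl (u ` {1..k})"

locale complex_space = vector_space scl
  for scl :: "complex \<Rightarrow> 'a::ab_group_add \<Rightarrow> 'a"
begin

abbreviation "is_frame \<equiv> frame_for scl"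
lemmas is_frame_def = frame_for_def[of scl]

lemma is_frame_0 [simp]: "is_frame 0 u"
  by (simp add: is_frame_def independent_empty)

lemma is_frame_Suc: "is_frame (Suc k) u \<longleftrightarrow> is_frame k u \<and> u (Suc k) \<notin> span (u ` {1..k})"
proof -
  have *: "{1..Suc k} = insert (Suc k) {1..k}" by auto
  have ne: "{1..k} - {Suc k} = {1..k}" by auto
  show ?thesis
    unfolding is_frame_def * image_insert inj_on_insert independent_insert ne
    using span_base[of "u (Suc k)" "u ` {1..k}"] by auto
qed

lemma is_frame_mono: "is_frame k u \<Longrightarrow> j \<le> k \<Longrightarrow> is_frame j u"
  unfolding is_frame_def
  by (meson atLeastatMost_subset_iff image_mono independent_mono inj_on_subset order_refl)

lemma is_frame_cong: "(\<And>i. i \<in> {1..k} \<Longrightarrow> u i = v i) \<Longrightarrow> is_frame k u \<longleftrightarrow> is_frame k v"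
  using inj_on_cong[of "{1..k}" u v] image_cong[of "{1..k}" "{1..k}" u v]
  unfolding is_frame_def by simp

text \<open>
  Dimension count without a finite-dimensionality assumption on the ambient space: a vector outside
  the span of \<open>v\<close> could be adjoined to \<open>v\<close>, against the exchange lemma.
\<close>

lemma span_frame_eq:
  assumes "is_frame k u" "is_frame k v" "v ` {1..k} \<subseteq> span (u ` {1..k})"
  shows "span (v ` {1..k}) = span (u ` {1..k})"
proof (rule ccontr)
  assume "\<not> ?thesis"
  then obtain y where y: "y \<in> span (u ` {1..k})" "y \<notin> span (v ` {1..k})"
    using assms(3) span_minimal[OF assms(3)] by auto
  then have "independent (insert y (v ` {1..k}))"
    using assms(2) independent_insertI is_frame_def by blast
  then have "card (insert y (v ` {1..k})) \<le> card (u ` {1..k})"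
    using independent_span_bound[of "u ` {1..k}" "insert y (v ` {1..k})"] assms(3) y by auto
  moreover have "y \<notin> v ` {1..k}" using y span_base by blast
  moreover have "card (u ` {1..k}) = k" "card (v ` {1..k}) = k"
    using assms by (auto simp: is_frame_def card_image)
  ultimately show False by simp
qed

end

lemma continuous_map_complex_divide:
  fixes f g :: "'a \<Rightarrow> complex"
  assumes "continuous_map X euclidean f" "continuous_map X euclidean g"
    and "\<And>x. x \<in> topspace X \<Longrightarrow> g x \<noteq> 0"
  shows "continuous_map X euclidean (\<lambda>x. f x / g x)"
  using assms unfolding continuous_map_atin limitin_canonical_iff
  by (auto intro: tendsto_divide)

text \<open>
  The vector space is the subset \<open>topspace X\<close> of its type, because \<open>H\<^sup>0(\<E>\<^sup>n(d))\<close>, whose subspaces are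
  considered besides those of \<open>\<complex>\<^sup>n\<close>, is only a subset of \<open>\<complex>[z, 1/z]\<^sup>n\<close>. The form
  serves to replace subspaces by orthogonal projections.
\<close>

locale hermitian_space = complex_space scl
  for scl :: "complex \<Rightarrow> 'a::ab_group_add \<Rightarrow> 'a" +
  fixes X :: "'a topology" and ip :: "'a \<Rightarrow> 'a \<Rightarrow> complex"
  assumes subspace_topspace: "subspace (topspace X)"
    and continuous_add: "continuous_map (prod_topology X X) X (\<lambda>(x, y). x + y)"
    and continuous_scale: "continuous_map (prod_topology euclidean X) X (\<lambda>(c, x). scl c x)"
    and continuous_ip: "continuous_map (prod_topology X X) euclidean (\<lambda>(x, y). ip x y)"
    and ip_add: "ip (x + y) z = ip x z + ip y z"
    and ip_scale: "ip (scl c x) z = c * ip x z"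
    and ip_commute: "ip y x = cnj (ip x y)"
    and ip_definite: "x \<in> topspace X \<Longrightarrow> ip x x = 0 \<Longrightarrow> x = 0"
begin

lemma cont_add:
  "continuous_map Z X f \<Longrightarrow> continuous_map Z X g \<Longrightarrow> continuous_map Z X (\<lambda>z. f z + g z)"
  using continuous_map_compose[OF continuous_map_pairedI continuous_add, of Z f g]
  by (simp add: o_def)

lemma cont_scale:
  "continuous_map Z euclidean c \<Longrightarrow> continuous_map Z X g \<Longrightarrow> continuous_map Z X (\<lambda>z. scl (c z) (g z))"
  using continuous_map_compose[OF continuous_map_pairedI continuous_scale, of Z c g]
  by (simp add: o_def)

lemma cont_ip:
  "continuous_map Z X f \<Longrightarrow> continuous_map Z X g \<Longrightarrow> continuous_map Z euclidean (\<lambda>z. ip (f z) (g z))"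
  using continuous_map_compose[OF continuous_map_pairedI continuous_ip, of Z f g]
  by (simp add: o_def)

lemma cont_diff:
  assumes "continuous_map Z X f" "continuous_map Z X g"
  shows "continuous_map Z X (\<lambda>z. f z - g z)"
  using cont_add[OF assms(1) cont_scale[of Z "\<lambda>_. -1", OF _ assms(2)]]
  by simp

lemma ip_0 [simp]: "ip 0 z = 0" "ip z 0 = 0"
  using ip_add[of 0 0 z] ip_commute[of z 0] by auto

lemma ip_diff: "ip (x - y) z = ip x z - ip y z"
  using ip_add[of "x - y" y z] by simp

lemma ip_add_right: "ip z (x + y) = ip z x + ip z y"
  by (metis complex_cnj_add ip_add ip_commute)

lemma ip_scale_right: "ip z (scl c x) = cnj c * ip z x"
  by (metis complex_cnj_mult ip_scale ip_commute)

lemma ip_eq_0_commute: "ip x y = 0 \<longleftrightarrow> ip y x = 0"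
  by (metis complex_cnj_zero ip_commute)

text \<open>
  Two candidates differ by a vector of \<open>L\<close> that is orthogonal to \<open>L\<close>, hence to itself.
\<close>

lemma orth_proj_eqI:
  assumes "subspace L" "L \<subseteq> topspace X" "p \<in> L" "\<And>y. y \<in> L \<Longrightarrow> ip (x - p) y = 0"
  shows "orth_proj ip L x = p"
  unfolding orth_proj_def
proof (rule the_equality)
  show "p \<in> L \<and> (\<forall>y\<in>L. ip (x - p) y = 0)" using assms by auto
  fix q assume q: "q \<in> L \<and> (\<forall>y\<in>L. ip (x - q) y = 0)"
  then have "q - p \<in> L" using assms subspace_diff by blast
  moreover have "ip (x - p) (q - p) = 0" "ip (x - q) (q - p) = 0"
    using q assms(4) \<open>q - p \<in> L\<close> by blast+
  then have "ip (q - p) (q - p) = 0"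
    using ip_diff[of "x - p" "x - q" "q - p"] by simp
  ultimately show "q = p" using ip_definite assms(2) by fastforce
qed

text \<open>
  Gram-Schmidt: \<open>gs_proj k u x\<close> adds to the projection onto the span of the first \<open>k - 1\<close> vectors the
  component of \<open>x\<close> along the part \<open>g\<close> of \<open>u k\<close> that is orthogonal to them. Being a formula in \<open>u\<close> and
  \<open>x\<close>, it is visibly continuous wherever no \<open>g\<close> vanishes.
\<close>

fun gs_proj :: "nat \<Rightarrow> (nat \<Rightarrow> 'a) \<Rightarrow> 'a \<Rightarrow> 'a" where
  "gs_proj 0 u x = 0"
| "gs_proj (Suc k) u x =
    (let g = u (Suc k) - gs_proj k u (u (Suc k)) in gs_proj k u x + scl (ip x g / ip g g) g)"

lemma span_subset_topspace:
  assumes "\<And>i. i \<in> {1..k} \<Longrightarrow> u i \<in> topspace X"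
  shows "span (u ` {1..k}) \<subseteq> topspace X"
  using assms by (intro span_minimal subspace_topspace) auto

lemma gs_proj_orthogonal:
  assumes "is_frame k u" "\<And>i. i \<in> {1..k} \<Longrightarrow> u i \<in> topspace X"
  shows "gs_proj k u x \<in> span (u ` {1..k}) \<and> (\<forall>y\<in>span (u ` {1..k}). ip (x - gs_proj k u x) y = 0)"
  using assms
proof (induction k arbitrary: x)
  case 0
  then show ?case by simp
next
  case (Suc k)
  define S where "S = span (u ` {1..k})"
  define g where "g = u (Suc k) - gs_proj k u (u (Suc k))"
  have IH: "gs_proj k u x \<in> S" "\<And>y. y \<in> S \<Longrightarrow> ip (x - gs_proj k u x) y = 0" for x
    using Suc unfolding S_def by (auto simp: is_frame_Suc)
  have sub: "subspace S" by (simp add: S_def)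
  have S': "span (u ` {1..Suc k}) = span (insert (u (Suc k)) (u ` {1..k}))"
    by (metis atLeastAtMostSuc_conv image_insert le_add1 plus_1_eq_Suc)
  then have SS': "S \<subseteq> span (u ` {1..Suc k})" by (simp add: S_def span_mono subset_insertI)
  have g': "g \<in> span (u ` {1..Suc k})"
    unfolding g_def using SS' IH(1) by (intro span_diff[OF span_base]) auto
  have gS: "g \<notin> S"
    using Suc.prems(1) IH(1) sub by (metis S_def diff_add_cancel g_def is_frame_Suc subspace_add)
  have "span (u ` {1..Suc k}) \<subseteq> topspace X"
    using Suc.prems(2) by (rule span_subset_topspace)
  then have gg: "ip g g \<noteq> 0" using g' gS ip_definite sub subspace_0 by blast
  have gperp: "ip g y = 0" if "y \<in> S" for y using IH(2)[OF that] by (simp add: g_def)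
  define a where "a = ip x g / ip g g"
  have eq: "gs_proj (Suc k) u x = gs_proj k u x + scl a g"
    by (simp add: g_def a_def Let_def)
  have mem: "gs_proj (Suc k) u x \<in> span (u ` {1..Suc k})"
    unfolding eq using SS' IH(1) g' by (auto intro!: span_add span_scale)
  have diff: "x - gs_proj (Suc k) u x = (x - gs_proj k u x) - scl a g" unfolding eq by (rule diff_diff_eq[symmetric])
  have res: "ip (x - gs_proj (Suc k) u x) y = ip (x - gs_proj k u x) y - a * ip g y" for y
    by (simp only: diff ip_diff[of "x - gs_proj k u x"] ip_scale)
  have perpS: "ip (x - gs_proj (Suc k) u x) y = 0" if "y \<in> S" for y
    unfolding res IH(2)[OF that] gperp[OF that] by simp
  have "ip (gs_proj k u x) g = 0" using gperp IH(1) ip_eq_0_commute by blast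
  then have perpg: "ip (x - gs_proj (Suc k) u x) g = 0"
    using gg unfolding res unfolding ip_diff[of x] by (simp add: a_def)
  have "ip (x - gs_proj (Suc k) u x) y = 0" if y: "y \<in> span (u ` {1..Suc k})" for y
  proof -
    obtain b where b: "y - scl b (u (Suc k)) \<in> S"
      using y unfolding S' S_def by (auto simp: span_breakdown_eq)
    define s where "s = y - scl b (u (Suc k)) + scl b (gs_proj k u (u (Suc k)))"
    have s: "s \<in> S" using b IH(1) sub by (auto simp: s_def intro!: subspace_add subspace_scale)
    have "y = s + scl b g" by (simp add: s_def g_def scale_right_diff_distrib)
    then show ?thesis using perpS[OF s] perpg by (simp only: ip_add_right ip_scale_right) simp
  qed
  with mem show ?case by blast
qed

lemma orth_proj_span:
  assumes "is_frame k u" "\<And>i. i \<in> {1..k} \<Longrightarrow> u i \<in> topspace X"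
  shows "orth_proj ip (span (u ` {1..k})) x = gs_proj k u x"
  using gs_proj_orthogonal[OF assms] span_subset_topspace[of k u] assms(2)
  by (intro orth_proj_eqI) auto

text \<open>
  Openness of the frames and continuity of the projection are proved in one induction, because the
  next vector extends a frame exactly where \<open>ip g g \<noteq> 0\<close>, and \<open>g\<close> is continuous by the induction
  hypothesis. A family over an arbitrary space \<open>Z\<close> is used so that the lemma applies both to the
  space of frames itself and to frames obtained by projecting.
\<close>

lemma frame_open_and_gs_continuous:
  assumes "\<And>i. i \<in> {1..k} \<Longrightarrow> continuous_map Z X (\<lambda>z. u z i)"
  shows "openin Z {z \<in> topspace Z. is_frame k (u z)} \<and>
    (\<forall>f. continuous_map Z X f \<longrightarrow>
      continuous_map (subtopology Z {z \<in> topspace Z. is_frame k (u z)}) X (\<lambda>z. gs_proj k (u z) (f z)))"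
  using assms
proof (induction k)
  case 0
  then show ?case using subspace_topspace subspace_0 by auto
next
  case (Suc k)
  have IH: "openin Z {z \<in> topspace Z. is_frame k (u z)}"
    "continuous_map Z X f \<Longrightarrow>
      continuous_map (subtopology Z {z \<in> topspace Z. is_frame k (u z)}) X (\<lambda>z. gs_proj k (u z) (f z))"
    for f
    using Suc.IH Suc.prems by auto
  define O' where "O' = {z \<in> topspace Z. is_frame k (u z)}"
  define O'' where "O'' = {z \<in> topspace Z. is_frame (Suc k) (u z)}"
  have u: "continuous_map Z X (\<lambda>z. u z i)" if "i \<in> {1..Suc k}" for i
    using Suc.prems that by auto
  have opO': "openin Z O'" unfolding O'_def by (rule IH(1))
  have gs: "continuous_map (subtopology Z O') X (\<lambda>z. gs_proj k (u z) (f z))"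
    if "continuous_map Z X f" for f
    unfolding O'_def by (rule IH(2)[OF that])
  define g where "g z = u z (Suc k) - gs_proj k (u z) (u z (Suc k))" for z
  have cg: "continuous_map (subtopology Z O') X g"
    unfolding g_def using u by (intro cont_diff gs continuous_map_from_subtopology) auto
  have utop: "u z i \<in> topspace X" if "z \<in> topspace Z" "i \<in> {1..Suc k}" for z i
    using u[OF that(2)] that(1) by (auto simp: continuous_map_def)
  have O''_iff: "z \<in> O'' \<longleftrightarrow> z \<in> O' \<and> ip (g z) (g z) \<noteq> 0" for z
  proof (cases "z \<in> O'")
    case True
    then have fr: "is_frame k (u z)" and z: "z \<in> topspace Z" by (auto simp: O'_def)
    have topX: "\<And>i. i \<in> {1..k} \<Longrightarrow> u z i \<in> topspace X" using utop[OF z] by simp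
    note o = gs_proj_orthogonal[OF fr topX]
    have "g z \<in> topspace X" using cg True z by (auto simp: continuous_map_def)
    then have "ip (g z) (g z) = 0 \<longleftrightarrow> g z = 0" using ip_definite by auto
    also have "\<dots> \<longleftrightarrow> u z (Suc k) \<in> span (u z ` {1..k})"
    proof
      assume "g z = 0"
      then have "u z (Suc k) = gs_proj k (u z) (u z (Suc k))" by (simp add: g_def)
      with o show "u z (Suc k) \<in> span (u z ` {1..k})" by (metis (no_types))
    next
      assume *: "u z (Suc k) \<in> span (u z ` {1..k})"
      then have "orth_proj ip (span (u z ` {1..k})) (u z (Suc k)) = u z (Suc k)"
        by (intro orth_proj_eqI) (use span_subset_topspace[of k "u z", OF topX] in auto)
      then show "g z = 0" using orth_proj_span[OF fr topX] by (simp add: g_def)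
    qed
    finally show ?thesis using True z by (auto simp: O''_def O'_def is_frame_Suc)
  qed (auto simp: O'_def O''_def is_frame_Suc)
  have cgg: "continuous_map (subtopology Z O') euclidean (\<lambda>z. ip (g z) (g z))"
    by (intro cont_ip cg)
  have "openin (subtopology Z O') {z \<in> topspace (subtopology Z O'). ip (g z) (g z) \<in> - {0}}"
    by (intro openin_continuous_map_preimage[OF cgg]) auto
  moreover have "{z \<in> topspace (subtopology Z O'). ip (g z) (g z) \<in> - {0}} = O''"
    using O''_iff by (auto simp: O'_def)
  ultimately have opO'': "openin (subtopology Z O') O''" by simp
  have "continuous_map (subtopology Z O'') X (\<lambda>z. gs_proj (Suc k) (u z) (f z))"
    if f: "continuous_map Z X f" for f
  proof -
    have sub: "subtopology Z O'' = subtopology (subtopology Z O') O''"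
      by (metis opO'' openin_imp_subset inf.absorb2 subtopology_subtopology)
    have cg': "continuous_map (subtopology Z O'') X g"
      unfolding sub by (rule continuous_map_from_subtopology[OF cg])
    have cf': "continuous_map (subtopology Z O'') X f"
      by (rule continuous_map_from_subtopology[OF f])
    have "continuous_map (subtopology Z O'') euclidean (\<lambda>z. ip (f z) (g z) / ip (g z) (g z))"
      by (rule continuous_map_complex_divide[OF cont_ip[OF cf' cg'] cont_ip[OF cg' cg']])
        (simp add: O''_iff)
    then show ?thesis
      unfolding gs_proj.simps Let_def g_def[symmetric]
      by (intro cont_add cont_scale cg')
        (unfold sub, intro continuous_map_from_subtopology gs f)
  qed
  then show ?case
    unfolding O''_def[symmetric] using openin_trans_full[OF opO'' opO'] by blast
qed

lemma topspace_Gr: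
  "L \<in> topspace (Gr scl X k) \<longleftrightarrow>
     (\<exists>u. is_frame k u \<and> (\<forall>i\<in>{1..k}. u i \<in> topspace X) \<and> L = span (u ` {1..k}))"
  (is "?l \<longleftrightarrow> ?r")
proof -
  have *: "topspace (Gr scl X k) = (\<lambda>u. span (u ` {1..k})) ` topspace (frame_topology scl X k)"
    unfolding Gr_def by (rule quotient_imp_surjective_map[OF quotient_map_image_topology, symmetric])
  have frames: "topspace (frame_topology scl X k) = {u \<in> {1..k} \<rightarrow>\<^sub>E topspace X. is_frame k u}"
    by (auto simp: frame_topology_def is_frame_def)
  show ?thesis
  proof
    assume ?l
    then show ?r unfolding * frames by blast
  next
    assume ?r
    then obtain u where u: "is_frame k u" "\<forall>i\<in>{1..k}. u i \<in> topspace X" "L = span (u ` {1..k})"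
      by blast
    have "is_frame k (restrict u {1..k})"
      using u(1) is_frame_cong[of k "restrict u {1..k}" u] by simp
    then have "restrict u {1..k} \<in> {u \<in> {1..k} \<rightarrow>\<^sub>E topspace X. is_frame k u}"
      using u(2) by simp
    moreover have "L = span (restrict u {1..k} ` {1..k})" using u(3) by (simp add: image_restrict_eq)
    ultimately show ?l unfolding * frames by blast
  qed
qed

lemma continuous_map_frame_span:
  assumes "\<And>i. i \<in> {1..k} \<Longrightarrow> continuous_map Z X (\<lambda>z. u z i)"
    and "\<And>z. z \<in> topspace Z \<Longrightarrow> is_frame k (u z)"
  shows "continuous_map Z (Gr scl X k) (\<lambda>z. span (u z ` {1..k}))"
proof -
  have "is_frame k (restrict (u z) {1..k})" if "z \<in> topspace Z" for z
    using assms(2)[OF that] is_frame_cong[of k "restrict (u z) {1..k}" "u z"] by simp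
  then have "continuous_map Z (frame_topology scl X k) (\<lambda>z. restrict (u z) {1..k})"
    using assms(1)
    by (auto simp: frame_topology_def continuous_map_in_subtopology continuous_map_componentwise
        is_frame_def)
  from continuous_map_compose[OF this quotient_imp_continuous_map[OF quotient_map_image_topology]]
  have "continuous_map Z (Gr scl X k) ((\<lambda>u. span (u ` {1..k})) \<circ> (\<lambda>z. restrict (u z) {1..k}))"
    unfolding Gr_def .
  then show ?thesis by (simp only: o_def image_restrict_eq)
qed

text \<open>
  The projection depends only on the span of a frame, so it descends from the space of frames to its
  quotient.
\<close>

lemma continuous_map_orth_proj:
  assumes "x \<in> topspace X"
  shows "continuous_map (Gr scl X k) X (\<lambda>L. orth_proj ip L x)"
  unfolding Gr_def
proof (rule continuous_compose_quotient_map[OF quotient_map_image_topology])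
  define Z where "Z = frame_topology scl X k"
  have Z: "is_frame k u" "\<And>i. i \<in> {1..k} \<Longrightarrow> u i \<in> topspace X" if "u \<in> topspace Z" for u
    using that by (auto simp: Z_def frame_topology_def is_frame_def)
  have "continuous_map Z X (\<lambda>u. u i)" if "i \<in> {1..k}" for i
    unfolding Z_def frame_topology_def
    using continuous_map_product_projection[OF that, of "\<lambda>_. X"]
    by (simp add: continuous_map_from_subtopology)
  then have "continuous_map (subtopology Z {z \<in> topspace Z. is_frame k z}) X (\<lambda>u. gs_proj k u x)"
    using frame_open_and_gs_continuous[of k Z "\<lambda>u. u"] assms by simp
  moreover have "{z \<in> topspace Z. is_frame k z} = topspace Z" using Z by auto
  ultimately have "continuous_map Z X (\<lambda>u. gs_proj k u x)" by (simp add: subtopology_topspace)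
  then show "continuous_map (frame_topology scl X k) X
      ((\<lambda>L. orth_proj ip L x) \<circ> (\<lambda>u. span (u ` {1..k})))"
    unfolding Z_def[symmetric]
  proof (rule continuous_map_eq)
    fix u assume "u \<in> topspace Z"
    from orth_proj_span[OF Z(1)[OF this] Z(2)[OF this], of x]
    show "gs_proj k u x = ((\<lambda>L. orth_proj ip L x) \<circ> (\<lambda>u. span (u ` {1..k}))) u" by simp
  qed
qed

text \<open>
  The topology of the Grassmannian is the one of pointwise convergence of orthogonal projections. For
  the non-trivial direction, let \<open>u\<close> be a frame of \<open>\<phi> z\<^sub>0\<close>. The projections of its vectors to \<open>\<phi> z\<close>
  depend continuously on \<open>z\<close> and agree with \<open>u\<close> at \<open>z\<^sub>0\<close>; as frames form an open set, they are a frame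
  of \<open>\<phi> z\<close> for \<open>z\<close> near \<open>z\<^sub>0\<close>. So \<open>\<phi>\<close> lifts locally to the space of frames.
\<close>

theorem continuous_map_into_Gr_iff:
  "continuous_map Z (Gr scl X k) \<phi> \<longleftrightarrow>
     (\<forall>z\<in>topspace Z. \<phi> z \<in> topspace (Gr scl X k)) \<and>
     (\<forall>x\<in>topspace X. continuous_map Z X (\<lambda>z. orth_proj ip (\<phi> z) x))"
  (is "?l \<longleftrightarrow> ?r")
proof
  assume ?l
  then have "\<phi> z \<in> topspace (Gr scl X k)" if "z \<in> topspace Z" for z
    using that unfolding continuous_map_def by blast
  moreover have "continuous_map Z X (\<lambda>z. orth_proj ip (\<phi> z) x)" if "x \<in> topspace X" for x
    using continuous_map_compose[OF \<open>?l\<close> continuous_map_orth_proj[OF that]] by (simp add: o_def)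
  ultimately show ?r by blast
next
  assume r: ?r
  have loc: "\<exists>T. openin Z T \<and> z0 \<in> T \<and> continuous_map (subtopology Z T) (Gr scl X k) \<phi>"
    if z0: "z0 \<in> topspace Z" for z0
  proof -
    obtain u where u: "is_frame k u" "\<forall>i\<in>{1..k}. u i \<in> topspace X" "\<phi> z0 = span (u ` {1..k})"
      using r z0 unfolding topspace_Gr by blast
    define v where "v z i = orth_proj ip (\<phi> z) (u i)" for z i
    have cv: "continuous_map Z X (\<lambda>z. v z i)" if "i \<in> {1..k}" for i
      unfolding v_def using r u(2) that by blast
    define T where "T = {z \<in> topspace Z. is_frame k (v z)}"
    have T: "openin Z T" unfolding T_def using frame_open_and_gs_continuous[of k Z v, OF cv] by blast
    have "v z0 i = u i" if "i \<in> {1..k}" for i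
      unfolding v_def u(3)
      by (intro orth_proj_eqI) (use span_subset_topspace[of k u] u that in \<open>auto intro!: span_base\<close>)
    then have "z0 \<in> T" using u(1) z0 is_frame_cong[of k "v z0" u] by (simp add: T_def)
    have span_v: "\<phi> z = span (v z ` {1..k})" if z: "z \<in> T" for z
    proof -
      have "\<phi> z \<in> topspace (Gr scl X k)" using r z by (auto simp: T_def)
      then obtain w where w: "is_frame k w" "\<forall>i\<in>{1..k}. w i \<in> topspace X" "\<phi> z = span (w ` {1..k})"
        unfolding topspace_Gr by blast
      have wX: "\<And>i. i \<in> {1..k} \<Longrightarrow> w i \<in> topspace X" using w(2) by blast
      have "v z i \<in> span (w ` {1..k})" for i
        using gs_proj_orthogonal[of k w "u i"] orth_proj_span[of k w "u i"] w(1,3) wX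
        by (simp add: v_def)
      then show ?thesis
        unfolding w(3) using z by (intro span_frame_eq[OF w(1), symmetric]) (auto simp: T_def)
    qed
    have "continuous_map (subtopology Z T) (Gr scl X k) (\<lambda>z. span (v z ` {1..k}))"
      by (intro continuous_map_frame_span continuous_map_from_subtopology cv) (auto simp: T_def)
    then have "continuous_map (subtopology Z T) (Gr scl X k) \<phi>"
      by (rule continuous_map_eq) (use span_v in auto)
    with T \<open>z0 \<in> T\<close> show ?thesis by blast
  qed
  have "openin Z {z \<in> topspace Z. \<phi> z \<in> U}" if U: "openin (Gr scl X k) U" for U
  proof (subst openin_subopen, intro ballI)
    fix z0 assume "z0 \<in> {z \<in> topspace Z. \<phi> z \<in> U}"
    then have z0: "z0 \<in> topspace Z" "\<phi> z0 \<in> U" by auto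
    obtain T where T: "openin Z T" "z0 \<in> T" "continuous_map (subtopology Z T) (Gr scl X k) \<phi>"
      using loc[OF z0(1)] by blast
    have "openin (subtopology Z T) {z \<in> topspace (subtopology Z T). \<phi> z \<in> U}"
      by (rule openin_continuous_map_preimage[OF T(3) U])
    then have "openin Z {z \<in> topspace (subtopology Z T). \<phi> z \<in> U}"
      using T(1) by (rule openin_trans_full)
    moreover have "z0 \<in> {z \<in> topspace (subtopology Z T). \<phi> z \<in> U}"
      "{z \<in> topspace (subtopology Z T). \<phi> z \<in> U} \<subseteq> {z \<in> topspace Z. \<phi> z \<in> U}"
      using T(2) z0 by auto
    ultimately show "\<exists>T. openin Z T \<and> z0 \<in> T \<and> T \<subseteq> {z \<in> topspace Z. \<phi> z \<in> U}"
      by blast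
  qed
  then show ?l unfolding continuous_map_def using r by blast
qed

end


section \<open>Dual coordinates and dimensions of quotients\<close>

lemma complex_space_vec: "complex_space ((*s) :: complex \<Rightarrow> complex^'n \<Rightarrow> complex^'n)"
  unfolding complex_space_def by (rule vec.vector_space_axioms)

abbreviation vec_frame :: "nat \<Rightarrow> (nat \<Rightarrow> complex^'n) \<Rightarrow> bool" where
  "vec_frame \<equiv> frame_for (*s)"

lemma basis_of_iff: "basis_of r u W \<longleftrightarrow> vec_frame r u \<and> W = vec.span (u ` {1..r})"
  by (auto simp: basis_of_def frame_for_def)

text \<open>
  \<open>v 1, \<dots>, v n\<close> is a basis of \<open>\<complex>\<^sup>n\<close> and \<open>c 1, \<dots>, c n\<close> is the dual basis. Membership in the span of a
  part of the basis then becomes the vanishing of some of the coordinates.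
\<close>

definition dual_coords ::
    "(nat \<Rightarrow> complex^'n) \<Rightarrow> (nat \<Rightarrow> complex^'n \<Rightarrow> complex) \<Rightarrow> bool" where
  "dual_coords v c \<longleftrightarrow>
     (\<forall>i x y. c i (x + y) = c i x + c i y) \<and> (\<forall>i a x. c i (a *s x) = a * c i x) \<and>
     (\<forall>i\<in>{1..CARD('n)}. \<forall>j\<in>{1..CARD('n)}. c i (v j) = (if i = j then 1 else 0)) \<and>
     (\<forall>x. (\<Sum>i=1..CARD('n). c i x *s v i) = x)"

lemma dual_coordsD:
  fixes v :: "nat \<Rightarrow> complex^'n"
  assumes "dual_coords v c"
  shows "c i (x + y) = c i x + c i y" "c i (a *s x) = a * c i x" "c i 0 = 0" "c i (x - y) = c i x - c i y"
    "c i (sum f I) = (\<Sum>j\<in>I. c i (f j))"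
    "i \<in> {1..CARD('n)} \<Longrightarrow> j \<in> {1..CARD('n)} \<Longrightarrow> c i (v j) = (if i = j then 1 else 0)"
    "(\<Sum>i=1..CARD('n). c i x *s v i) = x"
proof -
  show add: "c i (x + y) = c i x + c i y" for x y using assms unfolding dual_coords_def by blast
  show scale: "c i (a *s x) = a * c i x" for a x using assms unfolding dual_coords_def by blast
  show zero: "c i 0 = 0" using scale[of 0 0] by simp
  show "c i (x - y) = c i x - c i y" using add[of "x - y" y] by simp
  show "c i (sum f I) = (\<Sum>j\<in>I. c i (f j))"
    by (induction I rule: infinite_finite_induct) (simp_all add: zero add)
  show "i \<in> {1..CARD('n)} \<Longrightarrow> j \<in> {1..CARD('n)} \<Longrightarrow> c i (v j) = (if i = j then 1 else 0)"
    using assms unfolding dual_coords_def by blast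
  show "(\<Sum>i=1..CARD('n). c i x *s v i) = x"
    using assms unfolding dual_coords_def by blast
qed

lemma dual_coords_exists:
  fixes u :: "nat \<Rightarrow> complex^'n"
  assumes "vec_frame r u"
  obtains v c where "dual_coords v c" "\<And>i. i \<in> {1..r} \<Longrightarrow> v i = u i" "r \<le> CARD('n)"
proof -
  let ?n = "CARD('n)"
  have ind: "vec.independent (u ` {1..r})" and inj: "inj_on u {1..r}"
    using assms by (auto simp: frame_for_def)
  obtain B where B: "u ` {1..r} \<subseteq> B" "B \<subseteq> UNIV" "vec.independent B" "UNIV \<subseteq> vec.span B"
    by (rule vec.maximal_independent_subset_extend[OF subset_UNIV ind])
  note B = B(1,3,4)
  have finB: "finite B" by (rule vec.finiteI_independent[OF B(2)])
  have cardB: "card B = ?n"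
    using vec.dim_eq_card_independent[OF B(2)] B(3)
    by (metis top.extremum_uniqueI vec.dim_UNIV vec.dim_span vec_dim_card)
  have r: "r \<le> ?n"
    using card_mono[OF finB B(1)] card_image[OF inj] cardB by simp
  have "card (B - u ` {1..r}) = card {r+1..?n}"
    using card_Diff_subset[of "u ` {1..r}" B] B(1) card_image[OF inj] cardB by simp
  then obtain w where w: "bij_betw w {r+1..?n} (B - u ` {1..r})"
    using finite_same_card_bij[of "{r+1..?n}" "B - u ` {1..r}"] finB by auto
  define v where "v i = (if i \<le> r then u i else w i)" for i
  have "bij_betw v ({1..r} \<union> {r+1..?n}) (u ` {1..r} \<union> (B - u ` {1..r}))"
  proof (rule bij_betw_combine)
    have "bij_betw v {1..r} (u ` {1..r}) \<longleftrightarrow> bij_betw u {1..r} (u ` {1..r})"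
      by (rule bij_betw_cong) (simp add: v_def)
    then show "bij_betw v {1..r} (u ` {1..r})" using inj by (simp add: bij_betw_def)
    have "bij_betw v {r+1..?n} (B - u ` {1..r}) \<longleftrightarrow> bij_betw w {r+1..?n} (B - u ` {1..r})"
      by (rule bij_betw_cong) (simp add: v_def)
    then show "bij_betw v {r+1..?n} (B - u ` {1..r})" using w by simp
  qed auto
  moreover have "{1..r} \<union> {r+1..?n} = {1..?n}" using r by auto
  moreover have "u ` {1..r} \<union> (B - u ` {1..r}) = B" using B(1) by auto
  ultimately have v: "bij_betw v {1..?n} B" by simp
  define c where "c i x = vec.representation B x (v i)" for i x
  have span: "x \<in> vec.span B" for x using B(3) by auto
  have "dual_coords v c"
    unfolding dual_coords_def
  proof (intro conjI allI ballI)
    fix i j assume ij: "i \<in> {1..?n}" "j \<in> {1..?n}"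
    have "v j \<in> B" using bij_betwE[OF v] ij(2) by blast
    moreover have "v i = v j \<longleftrightarrow> i = j" using inj_on_eq_iff[OF bij_betw_imp_inj_on[OF v]] ij by blast
    ultimately show "c i (v j) = (if i = j then 1 else 0)"
      by (simp add: c_def vec.representation_basis[OF B(2)])
  next
    fix x
    have rep: "(\<Sum>b\<in>B. vec.representation B x b *s b) = x"
      by (rule vec.sum_representation_eq[OF B(2) span finB order_refl])
    show "(\<Sum>i=1..?n. c i x *s v i) = x"
      unfolding c_def
      using sum.reindex_bij_betw[OF v, of "\<lambda>b. vec.representation B x b *s b"] rep by (rule trans)
  qed (simp_all add: c_def vec.representation_add[OF B(2) span span] vec.representation_scale[OF B(2) span])
  with that show thesis using r by (simp add: v_def)
qed

lemma span_dual_coords: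
  fixes v :: "nat \<Rightarrow> complex^'n"
  assumes c: "dual_coords v c" and J: "J \<subseteq> {1..CARD('n)}"
  shows "vec.span (v ` J) = {x. \<forall>i\<in>{1..CARD('n)} - J. c i x = 0}"
proof
  show "vec.span (v ` J) \<subseteq> {x. \<forall>i\<in>{1..CARD('n)} - J. c i x = 0}"
  proof (rule vec.span_minimal)
    show "v ` J \<subseteq> {x. \<forall>i\<in>{1..CARD('n)} - J. c i x = 0}"
      using J dual_coordsD(6)[OF c] by (auto simp: subset_iff)
    show "vec.subspace {x. \<forall>i\<in>{1..CARD('n)} - J. c i x = 0}"
      by (auto simp: vec.subspace_def dual_coordsD[OF c])
  qed
  show "{x. \<forall>i\<in>{1..CARD('n)} - J. c i x = 0} \<subseteq> vec.span (v ` J)"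
  proof
    fix x assume x: "x \<in> {x. \<forall>i\<in>{1..CARD('n)} - J. c i x = 0}"
    have "x = (\<Sum>i=1..CARD('n). c i x *s v i)" using dual_coordsD(7)[OF c] by metis
    also have "\<dots> = (\<Sum>i\<in>J. c i x *s v i)" using J x by (intro sum.mono_neutral_right) auto
    also have "\<dots> \<in> vec.span (v ` J)" by (intro vec.span_sum vec.span_scale vec.span_base) auto
    finally show "x \<in> vec.span (v ` J)" .
  qed
qed

lemma dual_coords_frame:
  fixes v :: "nat \<Rightarrow> complex^'n"
  assumes c: "dual_coords v c" and "r \<le> CARD('n)"
  shows "vec_frame r v"
  unfolding frame_for_def
proof
  have *: "i = j" if "i \<in> {1..CARD('n)}" "j \<in> {1..CARD('n)}" "v i = v j" for i j
    using that dual_coordsD(6)[OF c, of i i] dual_coordsD(6)[OF c, of i j] by (auto split: if_splits)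
  show inj: "inj_on v {1..r}" using * assms(2) by (auto intro!: inj_onI)
  show "vec.independent (v ` {1..r})"
  proof
    assume "vec.dependent (v ` {1..r})"
    then obtain i where i: "i \<in> {1..r}" "v i \<in> vec.span (v ` {1..r} - {v i})"
      unfolding vec.dependent_def by blast
    have "v ` {1..r} - {v i} = v ` ({1..r} - {i})"
      using inj_on_image_set_diff[OF inj, of "{1..r}" "{i}"] i(1) by simp
    with i have "v i \<in> vec.span (v ` ({1..r} - {i}))" by simp
    then have "c i (v i) = 0" using span_dual_coords[OF c, of "{1..r} - {i}"] i(1) assms(2) by force
    then show False using dual_coordsD(6)[OF c, of i i] i(1) assms(2) by simp
  qed
qed

text \<open>
  Two bases of the same space \<open>W\<close> have extensions to \<open>\<complex>\<^sup>n\<close> by the same complement, and with it the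
  same coordinates modulo \<open>W\<close>. This is what makes the local descriptions of a sheaf near \<open>0\<close> and near
  \<open>\<infinity>\<close> comparable: the new coordinates are those of the vector minus its complementary part \<open>q x\<close>.
\<close>

lemma dual_coords_exchange:
  fixes v :: "nat \<Rightarrow> complex^'n"
  assumes c: "dual_coords v c" and r: "r \<le> CARD('n)" and u': "vec_frame r u'"
    and span: "vec.span (u' ` {1..r}) = vec.span (v ` {1..r})"
  obtains v' c' where "dual_coords v' c'" "\<And>i. i \<in> {1..r} \<Longrightarrow> v' i = u' i"
    "\<And>i. i \<in> {r+1..CARD('n)} \<Longrightarrow> v' i = v i" "\<And>i. i \<in> {r+1..CARD('n)} \<Longrightarrow> c' i = c i"
proof -
  let ?n = "CARD('n)"
  obtain v0 c0 where c0: "dual_coords v0 c0" and v0: "\<And>i. i \<in> {1..r} \<Longrightarrow> v0 i = u' i"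
    using dual_coords_exists[OF u'] by metis
  define v' where "v' i = (if i \<le> r then u' i else v i)" for i
  define q where "q x = (\<Sum>j=r+1..?n. c j x *s v j)" for x
  define c' where "c' i x = (if i \<le> r then c0 i (x - q x) else c i x)" for i x
  have W: "vec.span (v0 ` {1..r}) = vec.span (v ` {1..r})"
    using v0 span by (metis (no_types, lifting) image_cong)
  have split: "(\<Sum>i=1..?n. f i) = (\<Sum>i=1..r. f i) + (\<Sum>i=r+1..?n. f i)" for f :: "nat \<Rightarrow> complex^'n"
    using sum.ub_add_nat[of 1 r f "?n - r"] r by simp
  have xq: "x - q x \<in> vec.span (v0 ` {1..r})" for x
  proof -
    have "x = (\<Sum>i=1..r. c i x *s v i) + q x"
      using dual_coordsD(7)[OF c, of x] split[of "\<lambda>i. c i x *s v i"] by (simp add: q_def)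
    then have "x - q x = (\<Sum>i=1..r. c i x *s v i)" by (simp add: algebra_simps)
    also have "\<dots> \<in> vec.span (v ` {1..r})" by (intro vec.span_sum vec.span_scale vec.span_base) auto
    finally show ?thesis using W by simp
  qed
  have c_u': "c i (u' j) = 0" if "i \<in> {r+1..?n}" "j \<in> {1..r}" for i j
  proof -
    have "u' j \<in> vec.span (v ` {1..r})" using span that(2) by (metis imageI vec.span_base)
    then show ?thesis using span_dual_coords[OF c, of "{1..r}"] that r by auto
  qed
  have q_u': "q (u' j) = 0" if "j \<in> {1..r}" for j
    unfolding q_def using c_u' that by (intro sum.neutral) auto
  have q_v: "q (v j) = v j" if "j \<in> {r+1..?n}" for j
  proof -
    have "q (v j) = (\<Sum>i=r+1..?n. if i = j then v j else 0)"
      unfolding q_def using that by (intro sum.cong) (auto simp: dual_coordsD(6)[OF c])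
    then show ?thesis using that by simp
  qed
  have "dual_coords v' c'"
    unfolding dual_coords_def
  proof (intro conjI allI ballI)
    fix i x y
    have "q (x + y) = q x + q y"
      by (simp add: q_def dual_coordsD(1)[OF c] vec.scale_left_distrib sum.distrib)
    then have *: "x + y - q (x + y) = (x - q x) + (y - q y)" by simp
    show "c' i (x + y) = c' i x + c' i y"
      unfolding c'_def * by (simp add: dual_coordsD(1)[OF c] dual_coordsD(1)[OF c0])
  next
    fix i a x
    have "q (a *s x) = a *s q x"
      by (simp add: q_def dual_coordsD(2)[OF c] vec.scale_sum_right)
    then have *: "a *s x - q (a *s x) = a *s (x - q x)" by (simp add: vec.scale_right_diff_distrib)
    show "c' i (a *s x) = a * c' i x"
      unfolding c'_def * dual_coordsD(2)[OF c] dual_coordsD(2)[OF c0] by simp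
  next
    fix i j assume ij: "i \<in> {1..?n}" "j \<in> {1..?n}"
    show "c' i (v' j) = (if i = j then 1 else 0)"
    proof (cases "j \<le> r")
      case True
      then have j: "j \<in> {1..r}" using ij by simp
      show ?thesis
        using True ij c_u'[OF _ j] q_u'[OF j] dual_coordsD(6)[OF c0, of i j] v0[OF j]
        by (auto simp: c'_def v'_def)
    next
      case False
      then have j: "j \<in> {r+1..?n}" using ij by simp
      show ?thesis
        using False ij q_v[OF j] dual_coordsD(6)[OF c, of i j] dual_coordsD(3)[OF c0]
        by (auto simp: c'_def v'_def)
    qed
  next
    fix x
    have zero: "c0 i (x - q x) = 0" if "i \<in> {r+1..?n}" for i
      using xq[of x] span_dual_coords[OF c0, of "{1..r}"] that r by auto
    have "x - q x = (\<Sum>i=1..r. c0 i (x - q x) *s v0 i) + (\<Sum>i=r+1..?n. c0 i (x - q x) *s v0 i)"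
      using dual_coordsD(7)[OF c0, of "x - q x"] split[of "\<lambda>i. c0 i (x - q x) *s v0 i"] by simp
    also have "(\<Sum>i=r+1..?n. c0 i (x - q x) *s v0 i) = 0" using zero by (intro sum.neutral) auto
    also have "(\<Sum>i=1..r. c0 i (x - q x) *s v0 i) = (\<Sum>i=1..r. c' i x *s v' i)"
      by (intro sum.cong) (auto simp: c'_def v'_def v0)
    finally have "x = (\<Sum>i=1..r. c' i x *s v' i) + q x" by (simp add: algebra_simps)
    also have "q x = (\<Sum>i=r+1..?n. c' i x *s v' i)"
      unfolding q_def by (intro sum.cong) (auto simp: c'_def v'_def)
    finally show "(\<Sum>i=1..?n. c' i x *s v' i) = x" unfolding split by (rule sym)
  qed
  then show thesis by (rule that) (auto simp: v'_def c'_def fun_eq_iff)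
qed

text \<open>
  Functionals \<open>\<phi> i\<close> dual to vectors \<open>e i\<close> of \<open>A\<close>, with common kernel \<open>B\<close> in \<open>A\<close>, identify \<open>A / B\<close>
  with the space of functions on \<open>I\<close>. All dimensions below are found in this way, by counting an
  explicit index set.
\<close>

lemma (in complex_space) quotient_dim_dual:
  assumes I: "finite I" "card I = k" and A: "subspace A" and B: "B \<subseteq> A" and e: "\<And>i. i \<in> I \<Longrightarrow> e i \<in> A"
    and add: "\<And>i x y. i \<in> I \<Longrightarrow> \<phi> i (x + y) = \<phi> i x + \<phi> i y"
    and scale: "\<And>i a x. i \<in> I \<Longrightarrow> \<phi> i (scl a x) = a * \<phi> i x"
    and dual: "\<And>i j. i \<in> I \<Longrightarrow> j \<in> I \<Longrightarrow> \<phi> i (e j) = (if i = j then 1 else 0)"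
    and B_iff: "\<And>x. x \<in> A \<Longrightarrow> x \<in> B \<longleftrightarrow> (\<forall>i\<in>I. \<phi> i x = 0)"
  shows "quotient_dim scl A B k"
proof -
  have zero: "\<phi> i 0 = 0" if "i \<in> I" for i using scale[OF that, of 0 0] by simp
  have sum: "\<phi> i (sum f J) = (\<Sum>j\<in>J. \<phi> i (f j))" if "i \<in> I" for i f and J :: "'c set"
    by (induction J rule: infinite_finite_induct) (simp_all add: zero[OF that] add[OF that])
  have diff: "\<phi> i (x - y) = \<phi> i x - \<phi> i y" if "i \<in> I" for i x y
    using add[OF that, of "x - y" y] by simp
  have inj: "inj_on e I"
  proof (rule inj_onI)
    fix i j assume "i \<in> I" "j \<in> I" "e i = e j"
    then show "i = j" using dual[of i i] dual[of i j] by (auto split: if_splits)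
  qed
  have kernel: "subspace {x. \<phi> i x = 0}" if "i \<in> I" for i
    by (auto simp: subspace_def zero[OF that] add[OF that] scale[OF that])
  have comb: "\<phi> i (\<Sum>j\<in>I. scl (a j) (e j)) = a i" if "i \<in> I" for i a
  proof -
    have "\<phi> i (\<Sum>j\<in>I. scl (a j) (e j)) = (\<Sum>j\<in>I. if j = i then a i else 0)"
      unfolding sum[OF that] by (intro sum.cong) (auto simp: scale[OF that] dual that)
    then show ?thesis using that I(1) by simp
  qed
  have indep: "independent (e ` I)"
  proof
    assume "dependent (e ` I)"
    then obtain i where i: "i \<in> I" "e i \<in> span (e ` I - {e i})" unfolding dependent_def by blast
    have "e ` I - {e i} \<subseteq> {x. \<phi> i x = 0}" using i(1) by (auto simp: dual)
    then have "span (e ` I - {e i}) \<subseteq> {x. \<phi> i x = 0}" using span_minimal kernel[OF i(1)] by blast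
    with i dual[of i i] show False by auto
  qed
  have spanA: "span (e ` I) \<subseteq> A" by (rule span_minimal) (use e A in auto)
  have span_comb: "(\<Sum>j\<in>I. scl (a j) (e j)) \<in> span (e ` I)" for a
    by (intro span_sum span_scale span_base) auto
  have expand: "x = (\<Sum>j\<in>I. scl (\<phi> j x) (e j))" if "x \<in> span (e ` I)" for x
    using that
  proof (induction rule: span_induct_alt)
    case base
    then show ?case by (simp add: zero)
  next
    case (step a x y)
    then obtain i where i: "i \<in> I" "x = e i" by blast
    have "(\<Sum>j\<in>I. scl (\<phi> j (scl a x + y)) (e j)) =
        (\<Sum>j\<in>I. (if j = i then scl a x else 0) + scl (\<phi> j y) (e j))"
      by (intro sum.cong refl) (auto simp: add scale dual i scale_left_distrib)
    also have "\<dots> = scl a x + (\<Sum>j\<in>I. scl (\<phi> j y) (e j))"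
      using i(1) I(1) by (simp add: sum.distrib)
    finally show ?case using step(2) by simp
  qed
  have "span (e ` I) \<inter> B = {0}"
  proof
    show "span (e ` I) \<inter> B \<subseteq> {0}"
    proof
      fix x assume "x \<in> span (e ` I) \<inter> B"
      then have "x = (\<Sum>j\<in>I. scl (\<phi> j x) (e j))" "\<forall>i\<in>I. \<phi> i x = 0"
        using expand B_iff[of x] B by auto
      then have "x = (\<Sum>j\<in>I. scl 0 (e j))" by (metis (mono_tags, lifting) sum.cong)
      then show "x \<in> {0}" by simp
    qed
    show "{0} \<subseteq> span (e ` I) \<inter> B"
      using B_iff[of 0] subspace_0[OF A] zero by (auto simp: span_zero)
  qed
  moreover have "A = {x + y | x y. x \<in> span (e ` I) \<and> y \<in> B}"
  proof (intro equalityI subsetI)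
    fix x assume x: "x \<in> A"
    define s where "s = (\<Sum>j\<in>I. scl (\<phi> j x) (e j))"
    have s: "s \<in> span (e ` I)" unfolding s_def by (rule span_comb)
    have "x - s \<in> B"
      using B_iff[of "x - s"] subspace_diff[OF A x] s spanA comb[of _ "\<lambda>j. \<phi> j x"]
      by (auto simp: diff s_def[symmetric])
    then show "x \<in> {x + y | x y. x \<in> span (e ` I) \<and> y \<in> B}"
      using s by (intro CollectI exI[of _ s] exI[of _ "x - s"]) simp
  qed (use spanA B subspace_add[OF A] in auto)
  moreover have "card (e ` I) = k" using card_image[OF inj] I(2) by simp
  ultimately show ?thesis
    unfolding quotient_dim_def using indep I(1) e by (intro exI[of _ "e ` I"]) auto
qed

lemma (in complex_space) frame_of_quotient_dim_0:
  assumes "quotient_dim scl A {0} k"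
  obtains u where "is_frame k u" "span (u ` {1..k}) = A" "\<forall>i\<in>{1..k}. u i \<in> A"
proof -
  obtain S where S: "S \<subseteq> A" "finite S" "card S = k" "independent S"
    "A = {x + y | x y. x \<in> span S \<and> y \<in> {0}}"
    using assms unfolding quotient_dim_def by blast
  obtain u where u: "bij_betw u {1..k} S"
    using finite_same_card_bij[of "{1..k}" S] S by auto
  then have "u ` {1..k} = S" "inj_on u {1..k}" by (auto simp: bij_betw_def)
  then show thesis using that[of u] S by (auto simp: is_frame_def)
qed

text \<open>
  Vectors are added one at a time, each from the smallest member of the flag that is not yet
  exhausted; comparing dimensions, the first \<open>j\<close> vectors then span the \<open>j\<close>-dimensional member.
\<close>

lemma flag_has_adapted_basis:
  fixes A :: "nat \<Rightarrow> (complex^'n) set"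
  assumes D: "finite D" "r \<in> D" "D \<subseteq> {..r}"
    and nested: "\<And>i j. i \<in> D \<Longrightarrow> j \<in> D \<Longrightarrow> i \<le> j \<Longrightarrow> A i \<subseteq> A j"
    and dim: "\<And>j. j \<in> D \<Longrightarrow> \<exists>w. vec_frame j w \<and> A j = vec.span (w ` {1..j})"
  obtains u where "vec_frame r u" "\<And>j. j \<in> D \<Longrightarrow> vec.span (u ` {1..j}) = A j"
proof -
  interpret V: complex_space "(*s) :: complex \<Rightarrow> complex^'n \<Rightarrow> complex^'n" by (rule complex_space_vec)
  have "\<exists>u. vec_frame m u \<and> (\<forall>j\<in>D. \<forall>i\<in>{1..m}. i \<le> j \<longrightarrow> u i \<in> A j)" if "m \<le> r" for m
    using that
  proof (induction m)
    case (Suc m)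
    then obtain u where u: "vec_frame m u" "\<forall>j\<in>D. \<forall>i\<in>{1..m}. i \<le> j \<longrightarrow> u i \<in> A j" by auto
    define j where "j = (LEAST j. j \<in> D \<and> Suc m \<le> j)"
    have j: "j \<in> D" "Suc m \<le> j"
      using LeastI[of "\<lambda>j. j \<in> D \<and> Suc m \<le> j" r] D(2) Suc.prems by (auto simp: j_def)
    have j_least: "j \<le> i" if "i \<in> D" "Suc m \<le> i" for i
      unfolding j_def using that by (intro Least_le) auto
    obtain w where w: "vec_frame j w" "A j = vec.span (w ` {1..j})" using dim j(1) by blast
    have "\<not> A j \<subseteq> vec.span (u ` {1..m})"
    proof
      assume "A j \<subseteq> vec.span (u ` {1..m})"
      then have "w ` {1..j} \<subseteq> vec.span (u ` {1..m})" using w(2) vec.span_superset by blast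
      then have "card (w ` {1..j}) \<le> card (u ` {1..m})"
        using vec.independent_span_bound[of "u ` {1..m}"] w(1) by (auto simp: frame_for_def)
      then show False
        using j(2) u(1) w(1) by (simp add: frame_for_def card_image)
    qed
    then obtain x where x: "x \<in> A j" "x \<notin> vec.span (u ` {1..m})" by blast
    define v where "v = u(Suc m := x)"
    have uv: "v i = u i" if "i \<in> {1..m}" for i using that by (simp add: v_def)
    have "vec_frame m v" using V.is_frame_cong[of m v u] uv u(1) by simp
    moreover have "v ` {1..m} = u ` {1..m}" using uv by (rule image_cong[OF refl])
    ultimately have "vec_frame (Suc m) v" using x(2) by (simp add: V.is_frame_Suc v_def)
    moreover have "v i \<in> A l" if "l \<in> D" "i \<in> {1..Suc m}" "i \<le> l" for l i
    proof (cases "i = Suc m")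
      case True
      then have "j \<le> l" using j_least that by auto
      then show ?thesis using nested[OF j(1) that(1)] x(1) True by (auto simp: v_def)
    next
      case False
      then show ?thesis using u(2) uv that by auto
    qed
    ultimately show ?case by blast
  qed simp
  from this[OF order_refl]
  obtain u where u: "vec_frame r u" "\<forall>j\<in>D. \<forall>i\<in>{1..r}. i \<le> j \<longrightarrow> u i \<in> A j" by blast
  show thesis
  proof (rule that[OF u(1)])
    fix j assume j: "j \<in> D"
    then obtain w where w: "vec_frame j w" "A j = vec.span (w ` {1..j})" using dim by blast
    have "j \<le> r" using j D(3) by auto
    then show "vec.span (u ` {1..j}) = A j"
      unfolding w(2) using V.is_frame_mono[OF u(1)] u(2) j w(2)
      by (intro V.span_frame_eq[OF w(1)]) auto
  qed
qed


section \<open>Laurent polynomial vectors and graded modules\<close>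

\<comment> \<open>Monomials \<open>zpow k *s const_vec x\<close> are kept nested, so that the coefficients of a shift apply.\<close>
declare vector_smult_assoc [simp del]

lemma lookup_single_mult:
  fixes g :: laurent
  shows "Poly_Mapping.lookup (Poly_Mapping.single a c * g) k = c * Poly_Mapping.lookup g (k - a)"
proof -
  have "k = l + q \<longleftrightarrow> q = k - l" for l q by auto
  then show ?thesis by (simp add: lookup_mult lookup_single when_mult)
qed

lemma lookup_mult_single0 [simp]:
  fixes g :: laurent
  shows "Poly_Mapping.lookup (g * Poly_Mapping.single 0 c) k = Poly_Mapping.lookup g k * c"
  using lookup_single_mult[of 0 c g k] by (simp add: mult.commute)

lemma coeff_vec_0 [simp]: "coeff_vec 0 k = 0"
  and coeff_vec_add [simp]: "coeff_vec (f + g) k = coeff_vec f k + coeff_vec g k"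
  and coeff_vec_diff [simp]: "coeff_vec (f - g) k = coeff_vec f k - coeff_vec g k"
  and coeff_vec_lscale [simp]: "coeff_vec (lscale c f) k = c *s coeff_vec f k"
  and coeff_vec_zpow [simp]: "coeff_vec (zpow a *s f) k = coeff_vec f (k - a)"
  and coeff_vec_const_vec: "coeff_vec (const_vec x) k = (if k = 0 then x else 0)"
  and coeff_vec_scale_const [simp]: "coeff_vec (p *s const_vec x) k = Poly_Mapping.lookup p k *s x"
  by (auto simp: coeff_vec_def vec_eq_iff lookup_add lookup_minus lscale_def lookup_single_mult
      zpow_def const_vec_def lookup_single when_def)

lemma coeff_vec_sum [simp]: "coeff_vec (sum f I) k = (\<Sum>i\<in>I. coeff_vec (f i) k)"
  by (induction I rule: infinite_finite_induct) simp_all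

lemma coeff_vec_monomial: "coeff_vec (zpow a *s const_vec x) k = (if k = a then x else 0)"
  by (simp add: coeff_vec_const_vec del: coeff_vec_scale_const)

lemma coeff_vec_eqI: "(\<And>k. coeff_vec f k = coeff_vec g k) \<Longrightarrow> f = g"
  by (simp add: coeff_vec_def vec_eq_iff poly_mapping_eq_iff fun_eq_iff)

lemma finite_coeff_vec: "finite {k. coeff_vec f k \<noteq> (0 :: complex^'n::finite)}"
proof -
  have "{k. coeff_vec f k \<noteq> 0} = (\<Union>i. {k. Poly_Mapping.lookup (f $ i) k \<noteq> 0})"
    by (auto simp: coeff_vec_def vec_eq_iff)
  then show ?thesis by (simp add: finite_UN)
qed

lemma coeff_vec_surj:
  assumes "finite {k. a k \<noteq> (0 :: complex^'n)}"
  obtains f where "\<And>k. coeff_vec f k = a k"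
proof
  fix k
  have "coeff_vec (\<Sum>l | a l \<noteq> 0. zpow l *s const_vec (a l)) k = (\<Sum>l | a l \<noteq> 0. if l = k then a k else 0)"
    by (simp only: coeff_vec_sum coeff_vec_monomial) (intro sum.cong, auto)
  also have "\<dots> = a k" using assms by simp
  finally show "coeff_vec (\<Sum>l | a l \<noteq> 0. zpow l *s const_vec (a l)) k = a k" .
qed

lemma coeff_vec_map:
  fixes f :: "laurent^'n::finite"
  assumes "\<And>k. T k 0 = (0 :: complex^'n)"
  obtains g where "\<And>k. coeff_vec g k = T k (coeff_vec f k)"
proof -
  have "{k. T k (coeff_vec f k) \<noteq> 0} \<subseteq> {k. coeff_vec f k \<noteq> 0}" using assms by auto
  then have "finite {k. T k (coeff_vec f k) \<noteq> 0}" using finite_coeff_vec finite_subset by blast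
  from coeff_vec_surj[OF this] show thesis using that by blast
qed

lemma bounded_coeff_vec:
  fixes f :: "laurent^'n::finite"
  obtains K :: nat where "\<And>k. coeff_vec f k \<noteq> 0 \<Longrightarrow> \<bar>k\<bar> \<le> int K"
proof -
  have "finite ((\<lambda>k. nat \<bar>k\<bar>) ` {k. coeff_vec f k \<noteq> 0})" using finite_coeff_vec by blast
  then obtain K where "\<forall>m\<in>(\<lambda>k. nat \<bar>k\<bar>) ` {k. coeff_vec f k \<noteq> 0}. m \<le> K"
    using finite_nat_set_iff_bounded_le by blast
  then show thesis by (intro that[of K]) force
qed

lemma mem_zshift: "f \<in> zshift a M \<longleftrightarrow> zpow (- a) *s f \<in> M"
proof
  assume "f \<in> zshift a M"
  then obtain g where g: "g \<in> M" "f = zpow a *s g" by (auto simp: zshift_def)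
  have "zpow (- a) *s f = g" unfolding g(2) by (rule coeff_vec_eqI) simp
  with g(1) show "zpow (- a) *s f \<in> M" by simp
next
  assume *: "zpow (- a) *s f \<in> M"
  have "f = zpow a *s (zpow (- a) *s f)" by (rule coeff_vec_eqI) simp
  with * show "f \<in> zshift a M" unfolding zshift_def by (rule image_eqI[rotated])
qed

lemma zshift_coeff_vec:
  fixes P :: "int \<Rightarrow> complex^'n \<Rightarrow> bool"
  shows "zshift a {f. \<forall>k. P k (coeff_vec f k)} = {f. \<forall>k. P (k - a) (coeff_vec f k)}"
proof (intro set_eqI)
  fix f :: "laurent^'n"
  have "(\<forall>k. P k (coeff_vec f (k + a))) \<longleftrightarrow> (\<forall>k. P (k - a) (coeff_vec f k))"
    by (metis add_diff_cancel diff_add_cancel)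
  then show "f \<in> zshift a {f. \<forall>k. P k (coeff_vec f k)} \<longleftrightarrow> f \<in> {f. \<forall>k. P (k - a) (coeff_vec f k)}"
    by (simp add: mem_zshift)
qed

lemma triv_coeff_vec:
  "fst triv = {f :: laurent^'n::finite. \<forall>k. k < 0 \<longrightarrow> coeff_vec f k = 0}"
  "snd triv = {f :: laurent^'n. \<forall>k. k > 0 \<longrightarrow> coeff_vec f k = 0}"
proof -
  have "Poly_Mapping.keys p \<subseteq> {0..} \<longleftrightarrow> (\<forall>k<0. Poly_Mapping.lookup p k = 0)" for p :: laurent
    by (metis atLeast_iff in_keys_iff not_le subset_iff)
  moreover have "Poly_Mapping.keys p \<subseteq> {..0} \<longleftrightarrow> (\<forall>k>0. Poly_Mapping.lookup p k = 0)" for p :: laurent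
    by (metis atMost_iff in_keys_iff not_le subset_iff)
  ultimately show "fst triv = {f :: laurent^'n::finite. \<forall>k. k < 0 \<longrightarrow> coeff_vec f k = 0}"
    "snd triv = {f :: laurent^'n. \<forall>k. k > 0 \<longrightarrow> coeff_vec f k = 0}"
    by (auto simp: triv_def ring0_def ring_inf_def coeff_vec_def vec_eq_iff)
qed

text \<open>
  A module generated over a monomial ring by \<open>z\<^bsup>e i\<^esup> u i\<close> is described coefficientwise: the
  coefficient of \<open>z\<^sup>k\<close> ranges over the span of those \<open>u i\<close> for which \<open>z\<^bsup>k - e i\<^esup>\<close> belongs to the ring.
  Taking \<open>K = {0..}\<close> and \<open>K = {..0}\<close> covers both charts.
\<close>

lemma graded_coeff_vec:
  fixes u :: "nat \<Rightarrow> complex^'n::finite"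
  assumes "vec_frame r u"
  shows "{\<Sum>i=1..r. p i *s (zpow (e i) *s const_vec (u i)) | p. \<forall>i\<in>{1..r}. Poly_Mapping.keys (p i) \<subseteq> K}
    = {f. \<forall>k. coeff_vec f k \<in> vec.span (u ` {i \<in> {1..r}. k - e i \<in> K})}"
    (is "?L = ?R")
proof (intro equalityI subsetI)
  have coeff_term: "coeff_vec (p *s (zpow a *s const_vec x)) k = Poly_Mapping.lookup p (k - a) *s x"
    for p a k and x :: "complex^'n"
  proof -
    have "p *s (zpow a *s const_vec x) = zpow a *s (p *s const_vec x)"
      by (simp add: vector_smult_assoc mult.commute)
    then show ?thesis by simp
  qed
  {
    fix f assume "f \<in> ?L"
    then obtain p where p: "\<forall>i\<in>{1..r}. Poly_Mapping.keys (p i) \<subseteq> K"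
      and f: "f = (\<Sum>i=1..r. p i *s (zpow (e i) *s const_vec (u i)))" by auto
    have "coeff_vec f k \<in> vec.span (u ` {i \<in> {1..r}. k - e i \<in> K})" for k
      unfolding f coeff_vec_sum coeff_term
    proof (rule vec.span_sum)
      fix i assume i: "i \<in> {1..r}"
      show "Poly_Mapping.lookup (p i) (k - e i) *s u i \<in> vec.span (u ` {i \<in> {1..r}. k - e i \<in> K})"
      proof (cases "k - e i \<in> K")
        case True
        with i show ?thesis by (intro vec.span_scale vec.span_base) auto
      next
        case False
        then have "k - e i \<notin> Poly_Mapping.keys (p i)" using p i by blast
        then have "Poly_Mapping.lookup (p i) (k - e i) = 0" by (simp add: in_keys_iff)
        then show ?thesis by (simp add: vec.span_zero)
      qed
    qed
    then show "f \<in> ?R" by simp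
  }
  {
    fix f assume f: "f \<in> ?R"
    obtain v c where c: "dual_coords v c" and vu: "\<And>i. i \<in> {1..r} \<Longrightarrow> v i = u i" and r: "r \<le> CARD('n)"
      using dual_coords_exists[OF assms] by metis
    define p where "p i = Abs_poly_mapping (\<lambda>k. c i (coeff_vec f (k + e i)))" for i
    have fin: "finite {k. c i (coeff_vec f (k + e i)) \<noteq> 0}" for i
    proof -
      have "{k. c i (coeff_vec f (k + e i)) \<noteq> 0} \<subseteq> (\<lambda>k. k - e i) ` {k. coeff_vec f k \<noteq> 0}"
      proof
        fix k assume "k \<in> {k. c i (coeff_vec f (k + e i)) \<noteq> 0}"
        then have "coeff_vec f (k + e i) \<noteq> 0" using dual_coordsD(3)[OF c, of i] by auto
        then show "k \<in> (\<lambda>k. k - e i) ` {k. coeff_vec f k \<noteq> 0}"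
          by (intro image_eqI[of _ _ "k + e i"]) auto
      qed
      then show ?thesis using finite_coeff_vec finite_subset by blast
    qed
    have p: "Poly_Mapping.lookup (p i) k = c i (coeff_vec f (k + e i))" for i k
      unfolding p_def using lookup_Abs_poly_mapping[OF fin] by simp
    have mem: "coeff_vec f k \<in> vec.span (v ` {i \<in> {1..r}. k - e i \<in> K})" for k
    proof -
      have "v ` {i \<in> {1..r}. k - e i \<in> K} = u ` {i \<in> {1..r}. k - e i \<in> K}"
        using vu by (intro image_cong) auto
      then show ?thesis using f by simp
    qed
    have zero: "c i (coeff_vec f k) = 0" if "i \<in> {1..CARD('n)}" "i \<le> r \<Longrightarrow> k - e i \<notin> K" for i k
    proof -
      have "{i \<in> {1..r}. k - e i \<in> K} \<subseteq> {1..CARD('n)}" using r by auto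
      from span_dual_coords[OF c this] mem[of k]
      have "\<forall>i\<in>{1..CARD('n)} - {i \<in> {1..r}. k - e i \<in> K}. c i (coeff_vec f k) = 0" by blast
      moreover have "i \<in> {1..CARD('n)} - {i \<in> {1..r}. k - e i \<in> K}" using that by simp
      ultimately show ?thesis by (rule bspec)
    qed
    have "f = (\<Sum>i=1..r. p i *s (zpow (e i) *s const_vec (u i)))"
    proof (rule coeff_vec_eqI)
      fix k
      have "coeff_vec f k = (\<Sum>i=1..CARD('n). c i (coeff_vec f k) *s v i)"
        using dual_coordsD(7)[OF c, of "coeff_vec f k"] by simp
      also have "\<dots> = (\<Sum>i=1..r. c i (coeff_vec f k) *s v i)"
      proof (rule sum.mono_neutral_right)
        have "c i (coeff_vec f k) = 0" if "i \<in> {1..CARD('n)} - {1..r}" for i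
          using that by (intro zero) auto
        then show "\<forall>i\<in>{1..CARD('n)} - {1..r}. c i (coeff_vec f k) *s v i = 0" by simp
      qed (use r in auto)
      also have "\<dots> = (\<Sum>i=1..r. c i (coeff_vec f k) *s u i)"
        using vu by (intro sum.cong) auto
      finally show "coeff_vec f k = coeff_vec (\<Sum>i=1..r. p i *s (zpow (e i) *s const_vec (u i))) k"
        unfolding coeff_vec_sum coeff_term p by simp
    qed
    moreover have "\<forall>i\<in>{1..r}. Poly_Mapping.keys (p i) \<subseteq> K"
    proof (intro ballI subsetI)
      fix i k assume i: "i \<in> {1..r}" "k \<in> Poly_Mapping.keys (p i)"
      then have "c i (coeff_vec f (k + e i)) \<noteq> 0" by (simp add: in_keys_iff p)
      then show "k \<in> K" using zero[of i "k + e i"] i(1) r by auto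
    qed
    ultimately show "f \<in> ?L" by blast
  }
qed

text \<open>
  The increasing filtration of \<open>W\<close> in which \<open>u i\<close> appears at level \<open>a i\<close>. An invariant sheaf is the same
  as a pair of such filtrations of \<open>W\<close>, one for each fixed point of the circle action on the line.
\<close>

definition filt :: "nat \<Rightarrow> (nat \<Rightarrow> nat) \<Rightarrow> (nat \<Rightarrow> complex^'n) \<Rightarrow> int \<Rightarrow> (complex^'n) set" where
  "filt r a u k = vec.span (u ` {i \<in> {1..r}. int (a i) \<le> k})"

lemma subspace_filt [simp]: "vec.subspace (filt r a u k)"
  by (simp add: filt_def)

lemma zero_in_filt [simp]: "0 \<in> filt r a u k"
  by (simp add: filt_def vec.span_zero)

lemma filt_neg: "k < 0 \<Longrightarrow> filt r a u k = {0}"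
proof -
  assume "k < 0"
  then have "{i \<in> {1..r}. int (a i) \<le> k} = {}" by auto
  then show ?thesis unfolding filt_def by (metis image_empty vec.span_empty)
qed

lemma filt_subset: "filt r a u k \<subseteq> vec.span (u ` {1..r})"
  unfolding filt_def by (intro vec.span_mono) auto

lemma filt_full:
  assumes "\<And>i. i \<in> {1..r} \<Longrightarrow> int (a i) \<le> k"
  shows "filt r a u k = vec.span (u ` {1..r})"
proof -
  have "{i \<in> {1..r}. int (a i) \<le> k} = {1..r}" using assms by auto
  then show ?thesis by (simp add: filt_def)
qed

lemma graded0_eq:
  assumes "vec_frame r u"
  shows "graded0 r \<alpha> u = {f. \<forall>k. coeff_vec f k \<in> filt r \<alpha> u k}"
  using graded_coeff_vec[OF assms, of "\<lambda>i. int (\<alpha> i)" "{0..}"]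
  by (simp add: graded0_def ring0_def filt_def)

lemma graded_inf_eq:
  assumes "vec_frame r u"
  shows "graded_inf r \<beta> u = {f. \<forall>k. coeff_vec f k \<in> filt r \<beta> u (- k)}"
proof -
  have "{i \<in> {1..r}. k - - int (\<beta> i) \<in> {..0}} = {i \<in> {1..r}. int (\<beta> i) \<le> - k}" for k by auto
  then show ?thesis
    using graded_coeff_vec[OF assms, of "\<lambda>i. - int (\<beta> i)" "{..0}"]
    by (simp add: graded_inf_def ring_inf_def filt_def)
qed

lemma submodule_graded:
  assumes "R = {p. Poly_Mapping.keys p \<subseteq> K}" "\<And>k l. k \<in> K \<Longrightarrow> l \<in> K \<Longrightarrow> k + l \<in> K"
  shows "submodule_over R {\<Sum>i\<in>I. p i *s b i | p. \<forall>i\<in>I. p i \<in> R}"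
  unfolding submodule_over_def
proof (intro conjI ballI)
  have add: "p + q \<in> R" if "p \<in> R" "q \<in> R" for p q
    using that keys_add[of p q] unfolding assms(1) by blast
  have mult: "p * q \<in> R" if "p \<in> R" "q \<in> R" for p q
    using that keys_mult[of p q] assms(2) unfolding assms(1) by blast
  have "0 \<in> R" by (simp add: assms(1))
  then show "0 \<in> {\<Sum>i\<in>I. p i *s b i | p. \<forall>i\<in>I. p i \<in> R}"
    by (auto intro!: exI[of _ "\<lambda>_. 0"])
  {
    fix f g
    assume "f \<in> {\<Sum>i\<in>I. p i *s b i | p. \<forall>i\<in>I. p i \<in> R}" "g \<in> {\<Sum>i\<in>I. p i *s b i | p. \<forall>i\<in>I. p i \<in> R}"
    then obtain p q where "\<forall>i\<in>I. p i \<in> R" "\<forall>i\<in>I. q i \<in> R"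
      "f = (\<Sum>i\<in>I. p i *s b i)" "g = (\<Sum>i\<in>I. q i *s b i)" by blast
    then show "f + g \<in> {\<Sum>i\<in>I. p i *s b i | p. \<forall>i\<in>I. p i \<in> R}"
      using add by (intro CollectI exI[of _ "\<lambda>i. p i + q i"])
        (auto simp: vector_sadd_rdistrib sum.distrib)
  }
  {
    fix p f
    assume p: "p \<in> R" and "f \<in> {\<Sum>i\<in>I. p i *s b i | p. \<forall>i\<in>I. p i \<in> R}"
    then obtain q where "\<forall>i\<in>I. q i \<in> R" "f = (\<Sum>i\<in>I. q i *s b i)" by blast
    moreover have "p *s (\<Sum>i\<in>I. q i *s b i) = (\<Sum>i\<in>I. (p * q i) *s b i)"
      by (simp add: vec_eq_iff sum_distrib_left mult.assoc)
    ultimately show "p *s f \<in> {\<Sum>i\<in>I. p i *s b i | p. \<forall>i\<in>I. p i \<in> R}"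
      using mult p by (intro CollectI exI[of _ "\<lambda>i. p * q i"]) auto
  }
qed

text \<open>
  After multiplication by a high power of \<open>z\<close> all coefficients sit at levels where the filtration has
  reached \<open>W\<close>, so the localisation only remembers \<open>W\<close>.
\<close>

lemma localize0_graded:
  assumes "vec_frame r (u :: nat \<Rightarrow> complex^'n::finite)"
  shows "localize0 (graded0 r \<alpha> u) = {f. \<forall>k. coeff_vec f k \<in> vec.span (u ` {1..r})}"
proof (intro equalityI subsetI)
  fix f assume "f \<in> localize0 (graded0 r \<alpha> u)"
  then show "f \<in> {f. \<forall>k. coeff_vec f k \<in> vec.span (u ` {1..r})}"
    unfolding localize0_def graded0_eq[OF assms]
      zshift_coeff_vec[of _ "\<lambda>k x. x \<in> filt r \<alpha> u k"]
    using filt_subset[of r \<alpha> u] by blast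
next
  fix f assume f: "f \<in> {f. \<forall>k. coeff_vec f k \<in> vec.span (u ` {1..r})}"
  obtain K where K: "\<And>k. coeff_vec f k \<noteq> 0 \<Longrightarrow> \<bar>k\<bar> \<le> int K"
    using bounded_coeff_vec[of f] by blast
  define m where "m = K + (\<Sum>i=1..r. \<alpha> i)"
  have "coeff_vec f k \<in> filt r \<alpha> u (k + int m)" for k
  proof (cases "coeff_vec f k = 0")
    case False
    have "int (\<alpha> i) \<le> k + int m" if "i \<in> {1..r}" for i
    proof -
      have "\<alpha> i \<le> (\<Sum>i=1..r. \<alpha> i)" using that by (intro member_le_sum) auto
      then show ?thesis using K[OF False] unfolding m_def by linarith
    qed
    then have "filt r \<alpha> u (k + int m) = vec.span (u ` {1..r})" by (intro filt_full) blast
    then show ?thesis using f by auto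
  qed simp
  then have "f \<in> zshift (- int m) (graded0 r \<alpha> u)"
    unfolding graded0_eq[OF assms] zshift_coeff_vec[of _ "\<lambda>k x. x \<in> filt r \<alpha> u k"] by simp
  then show "f \<in> localize0 (graded0 r \<alpha> u)"
    unfolding localize0_def by blast
qed

lemma localize_inf_graded:
  assumes "vec_frame r (u :: nat \<Rightarrow> complex^'n::finite)"
  shows "localize_inf (graded_inf r \<beta> u) = {f. \<forall>k. coeff_vec f k \<in> vec.span (u ` {1..r})}"
proof (intro equalityI subsetI)
  fix f assume "f \<in> localize_inf (graded_inf r \<beta> u)"
  then show "f \<in> {f. \<forall>k. coeff_vec f k \<in> vec.span (u ` {1..r})}"
    unfolding localize_inf_def graded_inf_eq[OF assms]
      zshift_coeff_vec[of _ "\<lambda>k x. x \<in> filt r \<beta> u (- k)"]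
    using filt_subset[of r \<beta> u] by blast
next
  fix f assume f: "f \<in> {f. \<forall>k. coeff_vec f k \<in> vec.span (u ` {1..r})}"
  obtain K where K: "\<And>k. coeff_vec f k \<noteq> 0 \<Longrightarrow> \<bar>k\<bar> \<le> int K"
    using bounded_coeff_vec[of f] by blast
  define m where "m = K + (\<Sum>i=1..r. \<beta> i)"
  have "coeff_vec f k \<in> filt r \<beta> u (- (k - int m))" for k
  proof (cases "coeff_vec f k = 0")
    case False
    have "int (\<beta> i) \<le> - (k - int m)" if "i \<in> {1..r}" for i
    proof -
      have "\<beta> i \<le> (\<Sum>i=1..r. \<beta> i)" using that by (intro member_le_sum) auto
      then show ?thesis using K[OF False] unfolding m_def by linarith
    qed
    then have "filt r \<beta> u (- (k - int m)) = vec.span (u ` {1..r})" by (intro filt_full) blast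
    then show ?thesis using f by auto
  qed simp
  then show "f \<in> localize_inf (graded_inf r \<beta> u)"
    unfolding localize_inf_def graded_inf_eq[OF assms]
      zshift_coeff_vec[of _ "\<lambda>k x. x \<in> filt r \<beta> u (- k)"] by blast
qed

lemma subsheaf_graded:
  assumes "vec_frame r (u :: nat \<Rightarrow> complex^'n::finite)" "vec_frame r u'"
    and "vec.span (u ` {1..r}) = vec.span (u' ` {1..r})"
  shows "subsheaf (graded0 r \<alpha> u, graded_inf r \<beta> u')"
  unfolding subsheaf_def fst_conv snd_conv
proof (intro conjI)
  show "submodule_over ring0 (graded0 r \<alpha> u)"
    unfolding graded0_def by (rule submodule_graded[where K = "{0..}"]) (auto simp: ring0_def)
  show "submodule_over ring_inf (graded_inf r \<beta> u')"
    unfolding graded_inf_def by (rule submodule_graded[where K = "{..0}"]) (auto simp: ring_inf_def)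
  show "graded0 r \<alpha> u \<subseteq> fst triv"
    unfolding graded0_eq[OF assms(1)] triv_coeff_vec using filt_neg by blast
  show "graded_inf r \<beta> u' \<subseteq> snd triv"
  proof
    fix f assume f: "f \<in> graded_inf r \<beta> u'"
    have "coeff_vec f k = 0" if "k > 0" for k
      using f filt_neg[of "- k" r \<beta> u'] that unfolding graded_inf_eq[OF assms(2)] by auto
    then show "f \<in> snd triv" by (simp add: triv_coeff_vec)
  qed
  show "localize0 (graded0 r \<alpha> u) = localize_inf (graded_inf r \<beta> u')"
    unfolding localize0_graded[OF assms(1)] localize_inf_graded[OF assms(2)] assms(3) ..
qed

lemma coeff_vec_rotate_section:
  "coeff_vec (rotate_section t f) k = (inverse t powi k) *s coeff_vec f k"
  by (simp add: coeff_vec_def rotate_section_def rotate_poly_def vec_eq_iff lookup_mapp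
      when_def in_keys_iff mult.commute)

text \<open>
  A rotation multiplies each coefficient by a scalar, so every linear condition on the coefficients
  one by one is invariant.
\<close>

lemma rotate_section_filtered:
  assumes t: "t \<noteq> 0" and F: "\<And>k. vec.subspace (F k)"
  shows "rotate_section t ` {f. \<forall>k. coeff_vec f k \<in> F k} = {f. \<forall>k. coeff_vec f k \<in> F k}"
proof -
  have sub: "rotate_section s f \<in> {f. \<forall>k. coeff_vec f k \<in> F k}" if "\<forall>k. coeff_vec f k \<in> F k" for f s
    using that vec.subspace_scale[OF F] by (simp add: coeff_vec_rotate_section)
  moreover have inv: "rotate_section t (rotate_section (inverse t) f) = f" for f :: "laurent^'b"
    using t by (intro coeff_vec_eqI)
      (simp add: coeff_vec_rotate_section vec.scale_scale power_int_inverse)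
  ultimately show ?thesis
  proof (intro equalityI subsetI)
    fix f assume "f \<in> {f. \<forall>k. coeff_vec f k \<in> F k}"
    then have "rotate_section (inverse t) f \<in> {f. \<forall>k. coeff_vec f k \<in> F k}" using sub by simp
    then have "rotate_section t (rotate_section (inverse t) f) \<in> rotate_section t ` {f. \<forall>k. coeff_vec f k \<in> F k}"
      by (rule imageI)
    then show "f \<in> rotate_section t ` {f. \<forall>k. coeff_vec f k \<in> F k}" by (simp only: inv)
  qed (use sub in auto)
qed

lemma rotate_graded:
  assumes "vec_frame r (u :: nat \<Rightarrow> complex^'n::finite)" "vec_frame r u'" "t \<noteq> 0"
  shows "rotate_sheaf t (graded0 r \<alpha> u, graded_inf r \<beta> u') = (graded0 r \<alpha> u, graded_inf r \<beta> u')"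
  unfolding rotate_sheaf_def fst_conv snd_conv graded0_eq[OF assms(1)] graded_inf_eq[OF assms(2)]
  using rotate_section_filtered[OF assms(3), of "filt r \<alpha> u"]
    rotate_section_filtered[OF assms(3), of "\<lambda>k. filt r \<beta> u' (- k)"]
  by simp


section \<open>The Hilbert polynomial of a graded subsheaf\<close>

lemma complex_space_lscale: "complex_space lscale"
  unfolding complex_space_def by (rule vector_space_lscale)

lemma complex_space_lscale2: "complex_space lscale2"
  unfolding complex_space_def by (rule vector_space_lscale2)

lemma filt_coords:
  fixes v :: "nat \<Rightarrow> complex^'n"
  assumes c: "dual_coords v c" and r: "r \<le> CARD('n)" and u: "\<And>i. i \<in> {1..r} \<Longrightarrow> v i = u i"
  shows "x \<in> filt r a u k \<longleftrightarrow> (\<forall>i\<in>{1..CARD('n)}. (i \<le> r \<longrightarrow> k < int (a i)) \<longrightarrow> c i x = 0)"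
proof -
  let ?J = "{i \<in> {1..r}. int (a i) \<le> k}"
  have "v ` ?J = u ` ?J" using u by (intro image_cong) auto
  then have "filt r a u k = vec.span (v ` ?J)" by (simp only: filt_def)
  also have "\<dots> = {x. \<forall>i\<in>{1..CARD('n)} - ?J. c i x = 0}"
    using r by (intro span_dual_coords[OF c]) auto
  finally show ?thesis by auto
qed

lemma span_frame_coords:
  fixes v :: "nat \<Rightarrow> complex^'n"
  assumes c: "dual_coords v c" and r: "r \<le> CARD('n)" and u: "\<And>i. i \<in> {1..r} \<Longrightarrow> v i = u i"
  shows "x \<in> vec.span (u ` {1..r}) \<longleftrightarrow> (\<forall>i\<in>{r+1..CARD('n)}. c i x = 0)"
proof -
  have "v ` {1..r} = u ` {1..r}" using u by (intro image_cong) auto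
  then have "vec.span (u ` {1..r}) = {x. \<forall>i\<in>{1..CARD('n)} - {1..r}. c i x = 0}"
    using span_dual_coords[OF c, of "{1..r}"] r by auto
  moreover have "{1..CARD('n)} - {1..r} = {r+1..CARD('n)}" by auto
  ultimately show ?thesis by simp
qed

lemma dual_coords_eq_0:
  fixes v :: "nat \<Rightarrow> complex^'n"
  assumes "dual_coords v c" "\<And>i. i \<in> {1..CARD('n)} \<Longrightarrow> c i x = 0"
  shows "x = 0"
proof -
  have "(\<Sum>i=1..CARD('n). c i x *s v i) = 0" using assms(2) by (intro sum.neutral) simp
  then show ?thesis using dual_coordsD(7)[OF assms(1), of x] by simp
qed

lemma dual_coords_monomial:
  fixes v :: "nat \<Rightarrow> complex^'n"
  assumes c: "dual_coords v c" and "i \<in> {1..CARD('n)}" "j \<in> {1..CARD('n)}"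
  shows "c i (coeff_vec (zpow l *s const_vec (v j)) k) = (if i = j \<and> k = l then 1 else 0)"
  unfolding coeff_vec_monomial
  by (cases "k = l") (simp_all only: dual_coordsD(6)[OF assms] dual_coordsD(3)[OF c] if_True if_False simp_thms)

text \<open>
  Two bases of the same subspace \<open>W\<close>; together with the exponents they determine the subsheaf \<open>V\<close>.
\<close>

locale adapted_frames =
  fixes r :: nat and \<alpha> \<beta> :: "nat \<Rightarrow> nat" and u u' :: "nat \<Rightarrow> complex^'n::finite"
  assumes frame: "vec_frame r u" and frame': "vec_frame r u'"
    and span_eq: "vec.span (u' ` {1..r}) = vec.span (u ` {1..r})"
begin

definition V :: "'n sheaf" where "V = (graded0 r \<alpha> u, graded_inf r \<beta> u')"

lemma fst_V: "fst V = {f. \<forall>k. coeff_vec f k \<in> filt r \<alpha> u k}"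
  by (simp add: V_def graded0_eq[OF frame])

lemma snd_V: "snd V = {f. \<forall>k. coeff_vec f k \<in> filt r \<beta> u' (- k)}"
  by (simp add: V_def graded_inf_eq[OF frame'])

lemma snd_twist_V: "snd (twist V t) = {f. \<forall>k. coeff_vec f k \<in> filt r \<beta> u' (t - k)}"
  using zshift_coeff_vec[of t "\<lambda>k x. x \<in> filt r \<beta> u' (- k)"]
  by (simp add: twist_def snd_V)

lemma localize_V: "localize0 (fst V) = {f. \<forall>k. coeff_vec f k \<in> vec.span (u ` {1..r})}"
  using localize0_graded[OF frame] by (simp add: V_def)

lemma subsheaf_V: "subsheaf V"
  unfolding V_def using subsheaf_graded[OF frame frame'] span_eq by simp

lemma rotate_V: "t \<noteq> 0 \<Longrightarrow> rotate_sheaf t V = V"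
  unfolding V_def by (rule rotate_graded[OF frame frame'])

lemma compatible_coords:
  obtains v c v' c' where "dual_coords v c" "dual_coords v' c'" "r \<le> CARD('n)"
    "\<forall>i\<in>{1..r}. v i = u i" "\<forall>i\<in>{1..r}. v' i = u' i"
    "\<forall>i\<in>{r+1..CARD('n)}. v' i = v i" "\<forall>i\<in>{r+1..CARD('n)}. c' i = c i"
proof -
  obtain v c where c: "dual_coords v c" and v: "\<And>i. i \<in> {1..r} \<Longrightarrow> v i = u i" and r: "r \<le> CARD('n)"
    using dual_coords_exists[OF frame] by metis
  have "v ` {1..r} = u ` {1..r}" using v by (intro image_cong) auto
  then have "vec.span (u' ` {1..r}) = vec.span (v ` {1..r})" using span_eq by simp
  from dual_coords_exchange[OF c r frame' this] obtain v' c' where "dual_coords v' c'"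
    "\<And>i. i \<in> {1..r} \<Longrightarrow> v' i = u' i" "\<And>i. i \<in> {r+1..CARD('n)} \<Longrightarrow> v' i = v i"
    "\<And>i. i \<in> {r+1..CARD('n)} \<Longrightarrow> c' i = c i" by metis
  with c v r show thesis by (intro that[of v c v' c'] ballI) blast+
qed

end

lemma twist_triv_coeff_vec:
  "fst (twist triv t) = {f :: laurent^'n::finite. \<forall>k<0. coeff_vec f k = 0}"
  "snd (twist triv t) = {f :: laurent^'n. \<forall>k>t. coeff_vec f k = 0}"
  using zshift_coeff_vec[of t "\<lambda>k x. k > 0 \<longrightarrow> x = 0"]
  by (simp_all add: twist_def triv_coeff_vec)

context adapted_frames begin

text \<open>
  In compatible coordinates a section of \<open>(\<E>\<^sup>n/\<V>)(t)\<close> has three independent kinds of data: the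
  coefficients of degree \<open>0, \<dots>, t\<close> of the \<open>n - r\<close> coordinates complementary to \<open>W\<close>, which agree on both
  charts, the first \<open>\<alpha> i\<close> coefficients of the \<open>i\<close>-th coordinate along \<open>W\<close> at \<open>0\<close>, and likewise the
  first \<open>\<beta> i\<close> coefficients at \<open>\<infinity>\<close>. The index set \<open>I1\<close> collects the first two kinds, \<open>I2\<close> the third.
\<close>

lemma quot_h0_V:
  "quot_h0 V t ((\<Sum>i=1..r. \<alpha> i) + (CARD('n) - r) * nat (t + 1) + (\<Sum>i=1..r. \<beta> i))"
proof -
  let ?n = "CARD('n)"
  obtain v c v' c' where c: "dual_coords v c" and c': "dual_coords v' c'" and r: "r \<le> ?n"
    and "\<forall>i\<in>{1..r}. v i = u i" "\<forall>i\<in>{1..r}. v' i = u' i"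
    and "\<forall>i\<in>{r+1..?n}. v' i = v i" "\<forall>i\<in>{r+1..?n}. c' i = c i"
    by (rule compatible_coords)
  note v = this(4)[THEN bspec] and v' = this(5)[THEN bspec]
    and v_eq = this(6)[THEN bspec] and c_eq = this(7)[THEN bspec]
  interpret L: complex_space lscale2 by (rule complex_space_lscale2)
  define A where "A = {(a, b). (\<forall>k<0. coeff_vec a k = 0) \<and> (\<forall>k>t. coeff_vec b k = 0) \<and>
    (\<forall>k. \<forall>i\<in>{r+1..?n}. c i (coeff_vec a k - coeff_vec b k) = 0)}"
  define B where "B = {(a, b). (\<forall>k. coeff_vec a k \<in> filt r \<alpha> u k) \<and>
    (\<forall>k. coeff_vec b k \<in> filt r \<beta> u' (t - k))}"
  have F: "x \<in> filt r \<alpha> u k \<longleftrightarrow> (\<forall>i\<in>{1..?n}. (i \<le> r \<longrightarrow> k < int (\<alpha> i)) \<longrightarrow> c i x = 0)" for x k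
    by (rule filt_coords[OF c r]) (rule v)
  have F': "x \<in> filt r \<beta> u' k \<longleftrightarrow> (\<forall>i\<in>{1..?n}. (i \<le> r \<longrightarrow> k < int (\<beta> i)) \<longrightarrow> c' i x = 0)" for x k
    by (rule filt_coords[OF c' r]) (rule v')
  have W: "x \<in> vec.span (u ` {1..r}) \<longleftrightarrow> (\<forall>i\<in>{r+1..?n}. c i x = 0)" for x
    by (rule span_frame_coords[OF c r]) (rule v)
  define I1 where "I1 = (SIGMA i:{1..?n}. {0..<(if i \<le> r then int (\<alpha> i) else t + 1)})"
  define I2 where "I2 = (SIGMA i:{1..r}. {t - int (\<beta> i)<..t})"
  define e where "e = (\<lambda>p. case p of
      Inl (i, k) \<Rightarrow> (zpow k *s const_vec (v i), if i \<le> r then 0 else zpow k *s const_vec (v i))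
    | Inr (i, k) \<Rightarrow> (0 :: laurent^'n, zpow k *s const_vec (v' i)))"
  define \<phi> where "\<phi> = (\<lambda>p (a, b). case p of
      Inl (i, k) \<Rightarrow> c i (coeff_vec a k) | Inr (i, k) \<Rightarrow> c' i (coeff_vec (b :: laurent^'n) k))"
  note lin = dual_coordsD(1-4)[OF c] dual_coordsD(1-4)[OF c']
  have card1: "card I1 = (\<Sum>i=1..r. \<alpha> i) + (?n - r) * nat (t + 1)"
  proof -
    have "card I1 = (\<Sum>i=1..?n. if i \<le> r then \<alpha> i else nat (t + 1))"
      unfolding I1_def by (subst card_SigmaI) (auto intro!: sum.cong)
    also have "\<dots> = (\<Sum>i\<in>{1..r}. if i \<le> r then \<alpha> i else nat (t + 1))
        + (\<Sum>i\<in>{r+1..?n}. if i \<le> r then \<alpha> i else nat (t + 1))"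
      using r by (subst sum.union_disjoint[symmetric]) (auto intro!: sum.cong)
    also have "\<dots> = (\<Sum>i=1..r. \<alpha> i) + (?n - r) * nat (t + 1)"
      by simp
    finally show ?thesis .
  qed
  have card2: "card I2 = (\<Sum>i=1..r. \<beta> i)"
    unfolding I2_def by (subst card_SigmaI) auto
  have fin: "finite I1" "finite I2" by (auto simp: I1_def I2_def)
  have "quotient_dim lscale2 A B (card I1 + card I2)"
  proof (rule L.quotient_dim_dual[where I = "I1 <+> I2" and e = e and \<phi> = \<phi>])
    show "finite (I1 <+> I2)" "card (I1 <+> I2) = card I1 + card I2"
      using fin by (auto simp: card_Plus)
    show "L.subspace A"
      by (auto simp: L.subspace_def A_def lscale2_def lin zero_prod_def)
    show "B \<subseteq> A"
    proof (intro subsetI)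
      fix x assume "x \<in> B"
      then obtain a b where x: "x = (a, b)" "\<forall>k. coeff_vec a k \<in> filt r \<alpha> u k"
        "\<forall>k. coeff_vec b k \<in> filt r \<beta> u' (t - k)" by (auto simp: B_def)
      have "coeff_vec a k = 0" if "k < 0" for k using x(2)[THEN spec, of k] filt_neg[OF that, of r \<alpha> u] by simp
      moreover have "coeff_vec b k = 0" if "k > t" for k
        using x(3)[THEN spec, of k] filt_neg[of "t - k" r \<beta> u'] that by simp
      moreover have "c i (coeff_vec a k) = 0" "c i (coeff_vec b k) = 0" if "i \<in> {r+1..?n}" for i k
      proof -
        show "c i (coeff_vec a k) = 0" using x(2)[THEN spec, of k] that unfolding F by simp
        have "c' i (coeff_vec b k) = 0" using x(3)[THEN spec, of k] that unfolding F' by simp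
        then show "c i (coeff_vec b k) = 0" using c_eq[OF that] by simp
      qed
      ultimately show "x \<in> A" by (simp add: A_def x(1) lin)
    qed
    fix p assume p: "p \<in> I1 <+> I2"
    show "e p \<in> A"
      using p
    proof
      fix q assume "q \<in> I1" "p = Inl q"
      then obtain i k where ik: "p = Inl (i, k)" "i \<in> {1..?n}" "0 \<le> k"
        "k < (if i \<le> r then int (\<alpha> i) else t + 1)" by (auto simp: I1_def)
      then show ?thesis
        by (auto simp: A_def e_def coeff_vec_monomial lin dual_coordsD(6)[OF c]
            simp del: coeff_vec_zpow coeff_vec_scale_const)
    next
      fix q assume "q \<in> I2" "p = Inr q"
      then obtain i k where ik: "p = Inr (i, k)" "i \<in> {1..r}" "k \<le> t"
        by (auto simp: I2_def)
      have "c j (v' i) = 0" if "j \<in> {r+1..?n}" for j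
        using dual_coordsD(6)[OF c', of j i] c_eq[OF that] ik(2) that r by auto
      then show ?thesis
        using ik by (auto simp: A_def e_def coeff_vec_monomial lin simp del: coeff_vec_zpow coeff_vec_scale_const)
    qed
    show "\<phi> p (x + y) = \<phi> p x + \<phi> p y" for x y
      by (auto simp: \<phi>_def lin split: sum.splits prod.splits)
    show "\<phi> p (lscale2 a x) = a * \<phi> p x" for a x
      by (auto simp: \<phi>_def lscale2_def lin split: sum.splits prod.splits)
    fix q assume q: "q \<in> I1 <+> I2"
    note cc = dual_coords_monomial[OF c] and cc' = dual_coords_monomial[OF c']
    have mixed: "c' i (coeff_vec (zpow l *s const_vec (v j)) k) = 0"
      if "i \<in> {1..r}" "j \<in> {r+1..?n}" for i j k l
    proof -
      have "i \<in> {1..?n}" "j \<in> {1..?n}" "i \<noteq> j" using that r by auto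
      then show ?thesis using cc'[of i j l k] v_eq[OF that(2)] by simp
    qed
    show "\<phi> p (e q) = (if p = q then 1 else 0)"
    proof (cases p)
      case (Inl pk)
      then obtain i k where p': "p = Inl (i, k)" "i \<in> {1..?n}" using p by (auto simp: I1_def)
      show ?thesis
      proof (cases q)
        case (Inl ql)
        then obtain j l where q': "q = Inl (j, l)" "j \<in> {1..?n}" using q by (auto simp: I1_def)
        show ?thesis using cc[OF p'(2) q'(2), of l k] by (simp add: \<phi>_def e_def p' q')
      next
        case (Inr ql)
        then show ?thesis by (simp add: \<phi>_def e_def p' lin split: prod.splits)
      qed
    next
      case (Inr pk)
      then obtain i k where p': "p = Inr (i, k)" "i \<in> {1..r}" using p by (auto simp: I2_def)
      then have i: "i \<in> {1..?n}" using r by simp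
      show ?thesis
      proof (cases q)
        case (Inl ql)
        then obtain j l where q': "q = Inl (j, l)" "j \<in> {1..?n}" using q by (auto simp: I1_def)
        show ?thesis
        proof (cases "j \<le> r")
          case False
          then have "j \<in> {r+1..?n}" using q'(2) by simp
          from mixed[OF p'(2) this, of l k] False show ?thesis by (simp add: \<phi>_def e_def p' q')
        qed (simp add: \<phi>_def e_def p' q' lin)
      next
        case (Inr ql)
        then obtain j l where q': "q = Inr (j, l)" "j \<in> {1..r}" using q by (auto simp: I2_def)
        then have j: "j \<in> {1..?n}" using r by simp
        show ?thesis using cc'[OF i j, of l k] by (simp add: \<phi>_def e_def p' q')
      qed
    qed
  next
    fix x assume "x \<in> A"
    then obtain a b where x: "x = (a, b)" and a: "\<And>k. k < 0 \<Longrightarrow> coeff_vec a k = 0"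
      and b: "\<And>k. k > t \<Longrightarrow> coeff_vec b k = 0"
      and ab: "\<And>i k. i \<in> {r+1..?n} \<Longrightarrow> c i (coeff_vec a k) = c i (coeff_vec b k)"
      by (auto simp: A_def lin)
    have all_iff: "(\<forall>p\<in>I1 <+> I2. \<phi> p x = 0) \<longleftrightarrow>
      (\<forall>i k. (i, k) \<in> I1 \<longrightarrow> c i (coeff_vec a k) = 0) \<and> (\<forall>i k. (i, k) \<in> I2 \<longrightarrow> c' i (coeff_vec b k) = 0)"
      by (auto simp: \<phi>_def x Ball_def)
    show "x \<in> B \<longleftrightarrow> (\<forall>p\<in>I1 <+> I2. \<phi> p x = 0)"
      unfolding all_iff
    proof
      assume "x \<in> B"
      then show "(\<forall>i k. (i, k) \<in> I1 \<longrightarrow> c i (coeff_vec a k) = 0) \<and>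
          (\<forall>i k. (i, k) \<in> I2 \<longrightarrow> c' i (coeff_vec b k) = 0)"
        using r by (auto simp: B_def x F F' I1_def I2_def split: if_splits)
    next
      assume *: "(\<forall>i k. (i, k) \<in> I1 \<longrightarrow> c i (coeff_vec a k) = 0) \<and>
          (\<forall>i k. (i, k) \<in> I2 \<longrightarrow> c' i (coeff_vec b k) = 0)"
      have A0: "c i (coeff_vec a k) = 0" if "i \<in> {1..?n}" "i \<le> r \<longrightarrow> k < int (\<alpha> i)" for i k
      proof -
        consider "k < 0" | "0 \<le> k" "i \<le> r \<or> k \<le> t" | "k > t" "r < i" by linarith
        then show ?thesis
        proof cases
          case 1
          then show ?thesis using a lin by simp
        next
          case 2
          then have "(i, k) \<in> I1" using that by (auto simp: I1_def)
          then show ?thesis using * by blast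
        next
          case 3
          then show ?thesis using ab[of i k] b[of k] that lin by simp
        qed
      qed
      have "c' i (coeff_vec b k) = 0" if "i \<in> {1..?n}" "i \<le> r \<longrightarrow> t - k < int (\<beta> i)" for i k
      proof -
        consider "k > t" | "k \<le> t" "i \<le> r" | "r < i" by linarith
        then show ?thesis
        proof cases
          case 1
          then show ?thesis using b lin by simp
        next
          case 2
          then have "(i, k) \<in> I2" using that by (auto simp: I2_def)
          then show ?thesis using * by blast
        next
          case 3
          then show ?thesis using ab[of i k] A0[of i k] that c_eq[of i] by simp
        qed
      qed
      with A0 show "x \<in> B" by (simp add: B_def x F F')
    qed
  qed
  moreover have "A = {(a, b). a \<in> fst (twist triv t) \<and> b \<in> snd (twist triv t) \<and> a - b \<in> localize0 (fst V)}"
    unfolding A_def localize_V twist_triv_coeff_vec W by simp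
  moreover have "B = fst (twist V t) \<times> snd (twist V t)"
    unfolding B_def snd_twist_V by (auto simp: twist_def fst_V)
  ultimately show ?thesis
    unfolding quot_h0_def card1 card2 by (simp add: add.assoc)
qed

text \<open>
  Torsion has no \<open>H\<^sup>1\<close>, so only the complementary coordinates contribute; each gives \<open>H\<^sup>1(\<O>(t))\<close>, with
  basis the monomials \<open>z\<^sup>k\<close> for \<open>t < k < 0\<close>.
\<close>

lemma quot_h1_V: "quot_h1 V t ((CARD('n) - r) * nat (- t - 1))"
proof -
  let ?n = "CARD('n)"
  obtain v c where c: "dual_coords v c" and v: "\<And>i. i \<in> {1..r} \<Longrightarrow> v i = u i" and r: "r \<le> ?n"
    using dual_coords_exists[OF frame] by metis
  interpret L: complex_space lscale by (rule complex_space_lscale)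
  have W: "x \<in> vec.span (u ` {1..r}) \<longleftrightarrow> (\<forall>i\<in>{r+1..?n}. c i x = 0)" for x
    by (rule span_frame_coords[OF c r]) (rule v)
  let ?W = "{f :: laurent^'n. \<forall>k. \<forall>i\<in>{r+1..?n}. c i (coeff_vec f k) = 0}"
  define B where "B = {a - b + w | a b w :: laurent^'n.
    (\<forall>k<0. coeff_vec a k = 0) \<and> (\<forall>k>t. coeff_vec b k = 0) \<and> w \<in> ?W}"
  define I where "I = {r+1..?n} \<times> {t<..<0}"
  have "quotient_dim lscale UNIV B (card I)"
  proof (rule L.quotient_dim_dual[where I = I and e = "\<lambda>(i, k). zpow k *s const_vec (v i)"
        and \<phi> = "\<lambda>(i, k) f. c i (coeff_vec f k)"])
    fix x :: "laurent^'n"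
    show "x \<in> B \<longleftrightarrow> (\<forall>p\<in>I. (case p of (i, k) \<Rightarrow> \<lambda>f. c i (coeff_vec f k)) x = 0)"
    proof
      assume "x \<in> B"
      then show "\<forall>p\<in>I. (case p of (i, k) \<Rightarrow> \<lambda>f. c i (coeff_vec f k)) x = 0"
        by (auto simp: B_def I_def dual_coordsD(1,4)[OF c] dual_coordsD(3)[OF c])
    next
      assume "\<forall>p\<in>I. (case p of (i, k) \<Rightarrow> \<lambda>f. c i (coeff_vec f k)) x = 0"
      then have x: "c i (coeff_vec x k) = 0" if "i \<in> {r+1..?n}" "t < k" "k < 0" for i k
        using that by (force simp: I_def)
      obtain a where a: "\<And>k. coeff_vec a k = (if 0 \<le> k then coeff_vec x k else 0)"
        by (rule coeff_vec_map[of "\<lambda>k y. if 0 \<le> k then y else 0" x]) auto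
      obtain b where b: "\<And>k. coeff_vec b k = (if k < 0 \<and> k \<le> t then - coeff_vec x k else 0)"
        by (rule coeff_vec_map[of "\<lambda>k y. if k < 0 \<and> k \<le> t then - y else 0" x]) auto
      obtain w where w: "\<And>k. coeff_vec w k = (if k < 0 \<and> t < k then coeff_vec x k else 0)"
        by (rule coeff_vec_map[of "\<lambda>k y. if k < 0 \<and> t < k then y else 0" x]) auto
      have "\<forall>k<0. coeff_vec a k = 0" "\<forall>k>t. coeff_vec b k = 0" by (simp_all add: a b)
      moreover have "x = a - b + w" by (rule coeff_vec_eqI) (simp add: a b w)
      moreover have "w \<in> ?W" using x by (auto simp: w dual_coordsD(3)[OF c])
      ultimately show "x \<in> B"
        unfolding B_def by blast
    qed
  qed (auto simp: I_def dual_coordsD(1,2)[OF c] dual_coords_monomial[OF c] split: if_splits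
      simp del: coeff_vec_zpow coeff_vec_scale_const)
  moreover have "B = {a - b + w | a b w.
      a \<in> fst (twist triv t) \<and> b \<in> snd (twist triv t) \<and> w \<in> localize0 (fst V)}"
    unfolding B_def localize_V twist_triv_coeff_vec W by simp
  moreover have "card I = (?n - r) * nat (- t - 1)"
    by (simp add: I_def card_cartesian_product)
  ultimately show ?thesis unfolding quot_h1_def by simp
qed

lemma r_le: "r \<le> CARD('n)"
  by (rule compatible_coords)

text \<open>
  The two contributions \<open>nat (t + 1)\<close> and \<open>nat (- t - 1)\<close> of each complementary coordinate combine to
  \<open>t + 1\<close> for every integer \<open>t\<close>.
\<close>

lemma has_hilbert_poly_V:
  assumes "(\<Sum>i=1..r. \<alpha> i) + (\<Sum>i=1..r. \<beta> i) = d"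
  shows "has_hilbert_poly V (quot_poly CARD('n) r d)"
  unfolding has_hilbert_poly_def
proof (intro allI exI conjI)
  fix t
  show "quot_h0 V t ((\<Sum>i=1..r. \<alpha> i) + (CARD('n) - r) * nat (t + 1) + (\<Sum>i=1..r. \<beta> i))"
    by (rule quot_h0_V)
  show "quot_h1 V t ((CARD('n) - r) * nat (- t - 1))" by (rule quot_h1_V)
  have "int (nat (t + 1)) - int (nat (- t - 1)) = t + 1" by simp
  then have eq: "(int CARD('n) - int r) * int (nat (t + 1)) - (int CARD('n) - int r) * int (nat (- t - 1))
      = (int CARD('n) - int r) * (t + 1)"
    by (metis right_diff_distrib)
  have "int ((\<Sum>i=1..r. \<alpha> i) + (CARD('n) - r) * nat (t + 1) + (\<Sum>i=1..r. \<beta> i))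
      = int d + (int CARD('n) - int r) * int (nat (t + 1))"
    using assms r_le by (simp add: of_nat_diff flip: assms)
  moreover have "int ((CARD('n) - r) * nat (- t - 1)) = (int CARD('n) - int r) * int (nat (- t - 1))"
    using r_le by (simp add: of_nat_diff)
  ultimately show "int ((\<Sum>i=1..r. \<alpha> i) + (CARD('n) - r) * nat (t + 1) + (\<Sum>i=1..r. \<beta> i))
      - int ((CARD('n) - r) * nat (- t - 1)) = poly (quot_poly CARD('n) r d) t"
    using eq by (simp add: quot_poly_def algebra_simps)
qed

lemma V_in_fixed_component:
  assumes "(\<Sum>i=1..r. \<alpha> i) + (\<Sum>i=1..r. \<beta> i) = d"
  shows "V \<in> fixed_component r d \<alpha> \<beta>"
proof -
  have "adapted_bases r \<alpha> \<beta> V u u'"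
    unfolding adapted_bases_def V_def basis_of_iff using frame frame' span_eq[symmetric] by blast
  moreover have "rotate_sheaf t V = V" if "cmod t = 1" for t
    by (rule rotate_V) (use that in auto)
  ultimately show ?thesis
    using has_hilbert_poly_V[OF assms] subsheaf_V
    by (auto simp: fixed_component_def fixed_points_def Quot_def)
qed

end


section \<open>Orthogonal projections of vectors and of sections\<close>

definition hip :: "complex^'n::finite \<Rightarrow> complex^'n \<Rightarrow> complex" where
  "hip x y = (\<Sum>i\<in>UNIV. x $ i * cnj (y $ i))"

lemma hip_add: "hip (x + y) z = hip x z + hip y z"
  by (simp add: hip_def distrib_right sum.distrib)

lemma hip_scale: "hip (a *s x) z = a * hip x z"
  by (simp add: hip_def sum_distrib_left mult.assoc)

lemma hip_commute: "hip y x = cnj (hip x y)"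
  by (simp add: hip_def mult.commute)

lemma hip_self: "hip x x = complex_of_real (\<Sum>i\<in>UNIV. (cmod (x $ i))\<^sup>2)"
  by (simp add: hip_def complex_norm_square[symmetric])

lemma hip_definite: "hip x x = 0 \<longleftrightarrow> x = 0"
proof
  assume "hip x x = 0"
  then have "(\<Sum>i\<in>UNIV. (cmod (x $ i))\<^sup>2) = 0" unfolding hip_self by (simp only: of_real_eq_0_iff)
  then have "\<forall>i. (cmod (x $ i))\<^sup>2 = 0" by (subst (asm) sum_nonneg_eq_0_iff) auto
  then show "x = 0" by (simp add: vec_eq_iff)
qed (simp add: hip_def)

lemma continuous_map_vec_nth:
  fixes f :: "'a \<Rightarrow> complex^'n::finite"
  assumes "continuous_map Z euclidean f"
  shows "continuous_map Z euclidean (\<lambda>z. f z $ i)"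
proof -
  have "continuous_map euclidean euclidean (\<lambda>x :: complex^'n. x $ i)"
    by (simp add: continuous_on_component)
  from continuous_map_compose[OF assms this] show ?thesis by (simp add: o_def)
qed

lemma continuous_map_vecI:
  fixes f :: "'a \<Rightarrow> complex^'n::finite"
  assumes "\<And>i. continuous_map Z euclidean (\<lambda>z. f z $ i)"
  shows "continuous_map Z euclidean f"
  using assms unfolding continuous_map_atin limitin_canonical_iff
  by (auto intro: vec_tendstoI)

lemma continuous_map_complex_mult:
  fixes f g :: "'a \<Rightarrow> complex"
  assumes "continuous_map Z euclidean f" "continuous_map Z euclidean g"
  shows "continuous_map Z euclidean (\<lambda>x. f x * g x)"
  using assms unfolding continuous_map_atin limitin_canonical_iff
  by (auto intro: tendsto_mult)

lemma continuous_map_cnj: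
  assumes "continuous_map Z euclidean f"
  shows "continuous_map Z euclidean (\<lambda>x. cnj (f x))"
  using assms unfolding continuous_map_atin limitin_canonical_iff
  by (auto intro: tendsto_cnj)

lemma continuous_map_hip:
  assumes "continuous_map Z euclidean f" "continuous_map Z euclidean g"
  shows "continuous_map Z euclidean (\<lambda>z. hip (f z) (g z))"
  unfolding hip_def
  by (intro continuous_map_sum continuous_map_complex_mult continuous_map_cnj continuous_map_vec_nth
      assms finite)

lemma continuous_map_vec_add:
  fixes f g :: "'a \<Rightarrow> complex^'n::finite"
  assumes "continuous_map Z euclidean f" "continuous_map Z euclidean g"
  shows "continuous_map Z euclidean (\<lambda>x. f x + g x)"
  using assms unfolding continuous_map_atin limitin_canonical_iff
  by (auto intro: tendsto_add)

lemma continuous_map_vec_scale: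
  fixes g :: "'a \<Rightarrow> complex^'n::finite"
  assumes "continuous_map Z euclidean f" "continuous_map Z euclidean g"
  shows "continuous_map Z euclidean (\<lambda>x. f x *s g x)"
  by (rule continuous_map_vecI)
    (simp add: continuous_map_complex_mult continuous_map_vec_nth assms)

lemma hermitian_space_vec:
  "hermitian_space ((*s) :: complex \<Rightarrow> complex^'n::finite \<Rightarrow> complex^'n) euclidean hip"
proof -
  have P: "continuous_map (prod_topology X Y) X (\<lambda>p. fst p)" "continuous_map (prod_topology X Y) Y (\<lambda>p. snd p)"
    for X :: "'a topology" and Y :: "'b topology"
    using continuous_map_fst[of X Y] continuous_map_snd[of X Y] by simp_all
  interpret V: complex_space "(*s) :: complex \<Rightarrow> complex^'n \<Rightarrow> complex^'n" by (rule complex_space_vec)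
  show ?thesis
  proof unfold_locales
    show "vec.subspace (topspace (euclidean :: (complex^'n) topology))" by simp
    show "continuous_map (prod_topology euclidean euclidean) euclidean (\<lambda>(x :: complex^'n, y). x + y)"
      unfolding case_prod_beta by (intro continuous_map_vec_add P)
    show "continuous_map (prod_topology euclidean euclidean) euclidean (\<lambda>(c, x :: complex^'n). c *s x)"
      unfolding case_prod_beta by (intro continuous_map_vec_scale P)
    show "continuous_map (prod_topology euclidean euclidean) euclidean (\<lambda>(x :: complex^'n, y). hip x y)"
      unfolding case_prod_beta by (intro continuous_map_hip P)
    show "hip y x = cnj (hip x y)" for x y :: "complex^'n" by (rule hip_commute)
  qed (simp_all add: hip_add hip_scale hip_definite)
qed

lemma global_sections_triv:
  "global_sections (twist triv (int m)) = {f :: laurent^'n::finite. \<forall>k. k < 0 \<or> k > int m \<longrightarrow> coeff_vec f k = 0}"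
  unfolding global_sections_def twist_triv_coeff_vec by auto

lemma topspace_sections_topology:
  "topspace (sections_topology m) = {f :: laurent^'n::finite. \<forall>k. k < 0 \<or> k > int m \<longrightarrow> coeff_vec f k = 0}"
  unfolding sections_topology_def topspace_pullback_topology global_sections_triv by simp

lemma continuous_map_into_sections_iff:
  fixes g :: "'a \<Rightarrow> laurent^'n::finite"
  shows "continuous_map Z (sections_topology m) g \<longleftrightarrow>
    (\<forall>z\<in>topspace Z. g z \<in> topspace (sections_topology m)) \<and>
    (\<forall>k. continuous_map Z euclidean (\<lambda>z. coeff_vec (g z) k))"
    (is "?l \<longleftrightarrow> ?r")
proof
  assume l: ?l
  have "continuous_map (sections_topology m) euclidean (id \<circ> (coeff_vec :: laurent^'n \<Rightarrow> _))"
    unfolding sections_topology_def by (rule continuous_map_pullback) simp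
  then have "continuous_map Z euclidean (\<lambda>z. coeff_vec (g z))"
    using continuous_map_compose[OF l] by (simp add: o_def)
  then have "continuous_map Z euclidean (\<lambda>z. coeff_vec (g z) k)" for k
    unfolding euclidean_product_topology[symmetric] continuous_map_componentwise_UNIV by blast
  moreover have "g z \<in> topspace (sections_topology m)" if "z \<in> topspace Z" for z
    using l that unfolding continuous_map_def by blast
  ultimately show ?r by blast
next
  assume r: ?r
  then have "continuous_map Z euclidean (\<lambda>z. coeff_vec (g z))"
    unfolding euclidean_product_topology[symmetric] continuous_map_componentwise_UNIV by blast
  moreover have "topspace Z \<subseteq> g -` (global_sections (twist triv (int m)))"
    using r unfolding topspace_sections_topology global_sections_triv by blast
  ultimately show ?l
    unfolding sections_topology_def by (intro continuous_map_pullback') (simp_all add: o_def)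
qed

definition section_ip :: "nat \<Rightarrow> laurent^'n::finite \<Rightarrow> laurent^'n \<Rightarrow> complex" where
  "section_ip m f g = (\<Sum>k=0..int m. hip (coeff_vec f k) (coeff_vec g k))"

lemma hermitian_space_sections:
  "hermitian_space lscale (sections_topology m :: (laurent^'n::finite) topology) (section_ip m)"
proof -
  have P: "continuous_map (prod_topology X Y) X (\<lambda>p. fst p)" "continuous_map (prod_topology X Y) Y (\<lambda>p. snd p)"
    for X :: "'a topology" and Y :: "'b topology"
    using continuous_map_fst[of X Y] continuous_map_snd[of X Y] by simp_all
  interpret L: complex_space "lscale :: complex \<Rightarrow> laurent^'n \<Rightarrow> laurent^'n" by (rule complex_space_lscale)
  let ?S = "sections_topology m :: (laurent^'n) topology"
  have coeff: "continuous_map Z euclidean (\<lambda>z. coeff_vec (g z) k)"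
    if "continuous_map Z ?S g" for Z :: "'z topology" and g k
    using that unfolding continuous_map_into_sections_iff by simp
  show ?thesis
  proof unfold_locales
    show "L.subspace (topspace ?S)"
      by (simp add: L.subspace_def topspace_sections_topology)
    show "continuous_map (prod_topology ?S ?S) ?S (\<lambda>(x, y). x + y)"
      unfolding case_prod_beta continuous_map_into_sections_iff coeff_vec_add
      by (intro conjI allI continuous_map_vec_add coeff P) (auto simp: topspace_sections_topology)
    show "continuous_map (prod_topology euclidean ?S) ?S (\<lambda>(c, x). lscale c x)"
      unfolding case_prod_beta continuous_map_into_sections_iff coeff_vec_lscale
      by (intro conjI allI continuous_map_vec_scale coeff P) (auto simp: topspace_sections_topology)
    show "continuous_map (prod_topology ?S ?S) euclidean (\<lambda>(x, y). section_ip m x y)"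
      unfolding case_prod_beta section_ip_def
      by (intro continuous_map_sum continuous_map_hip coeff P) simp
    show "section_ip m (x + y) z = section_ip m x z + section_ip m y z" for x y z :: "laurent^'n"
      by (simp add: section_ip_def hip_add sum.distrib)
    show "section_ip m (lscale c x) z = c * section_ip m x z" for c and x z :: "laurent^'n"
      by (simp add: section_ip_def hip_scale sum_distrib_left)
    show "section_ip m y x = cnj (section_ip m x y)" for x y :: "laurent^'n"
      unfolding section_ip_def cnj_sum by (intro sum.cong refl) (rule hip_commute)
    fix x :: "laurent^'n" assume x: "x \<in> topspace ?S" "section_ip m x x = 0"
    have "section_ip m x x = complex_of_real (\<Sum>k=0..int m. \<Sum>i\<in>UNIV. (cmod (coeff_vec x k $ i))\<^sup>2)"
      unfolding section_ip_def hip_self by simp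
    from trans[OF sym[OF this] x(2)]
    have "(\<Sum>k=0..int m. \<Sum>i\<in>UNIV. (cmod (coeff_vec x k $ i))\<^sup>2) = 0"
      by (simp only: of_real_eq_0_iff)
    then have "\<forall>k\<in>{0..int m}. (\<Sum>i\<in>UNIV. (cmod (coeff_vec x k $ i))\<^sup>2) = 0"
      using sum_nonneg_eq_0_iff[of "{0..int m}" "\<lambda>k. \<Sum>i\<in>UNIV. (cmod (coeff_vec x k $ i))\<^sup>2"]
      by (simp add: sum_nonneg)
    then have "\<forall>k\<in>{0..int m}. hip (coeff_vec x k) (coeff_vec x k) = 0"
      unfolding hip_self by simp
    then have "coeff_vec x k = 0" for k
      using x(1) by (cases "k \<in> {0..int m}") (auto simp: hip_definite topspace_sections_topology)
    then show "x = 0" by (intro coeff_vec_eqI) simp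
  qed
qed

lemma hip_orth_proj:
  fixes L :: "(complex^'n::finite) set"
  assumes "vec.subspace L"
  shows "orth_proj hip L x \<in> L" "y \<in> L \<Longrightarrow> hip (x - orth_proj hip L x) y = 0"
proof -
  interpret H: hermitian_space "(*s)" euclidean "hip :: complex^'n \<Rightarrow> _" by (rule hermitian_space_vec)
  obtain B where B: "B \<subseteq> L" "vec.independent B" "L \<subseteq> vec.span B"
    using vec.maximal_independent_subset[of L] by metis
  have "finite B" using B(2) by (rule vec.finiteI_independent)
  then obtain u where u: "bij_betw u {1..card B} B"
    using finite_same_card_bij[of "{1..card B}" B] by auto
  then have uB: "u ` {1..card B} = B" "inj_on u {1..card B}" by (auto simp: bij_betw_def)
  have fr: "vec_frame (card B) u" using uB B(2) by (simp add: frame_for_def)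
  have L: "L = vec.span (u ` {1..card B})"
    unfolding uB using B assms by (metis vec.span_eq_iff vec.span_mono subset_antisym)
  have o: "gs \<in> vec.span (u ` {1..card B}) \<and> (\<forall>y\<in>vec.span (u ` {1..card B}). hip (x - gs) y = 0)"
    if "gs = H.gs_proj (card B) u x" for gs
    using H.gs_proj_orthogonal[OF fr] that by simp
  have "orth_proj hip L x = H.gs_proj (card B) u x"
    unfolding L by (rule H.orth_proj_span[OF fr]) simp
  from o[OF this] show "orth_proj hip L x \<in> L" "y \<in> L \<Longrightarrow> hip (x - orth_proj hip L x) y = 0"
    unfolding L[symmetric] by auto
qed

text \<open>
  Monomials of different degrees are orthogonal, so the projection onto a graded subspace is the
  projection in each degree.
\<close>

lemma orth_proj_graded:
  fixes L :: "int \<Rightarrow> (complex^'n::finite) set"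
  assumes L: "\<And>k. vec.subspace (L k)" and out: "\<And>k. k < 0 \<or> k > int m \<Longrightarrow> L k = {0}"
    and f: "f \<in> topspace (sections_topology m)"
  shows "coeff_vec (orth_proj (section_ip m) {f. \<forall>k. coeff_vec f k \<in> L k} f) k
    = orth_proj hip (L k) (coeff_vec f k)"
proof -
  interpret S: hermitian_space lscale "sections_topology m :: (laurent^'n) topology" "section_ip m"
    by (rule hermitian_space_sections)
  interpret H: hermitian_space "(*s)" euclidean "hip :: complex^'n \<Rightarrow> _" by (rule hermitian_space_vec)
  have zero: "orth_proj hip (L k) 0 = 0" for k
    by (rule H.orth_proj_eqI) (auto simp: L vec.subspace_0)
  obtain p where p: "\<And>k. coeff_vec p k = orth_proj hip (L k) (coeff_vec f k)"
    by (rule coeff_vec_map[of "\<lambda>k. orth_proj hip (L k)" f]) (auto simp: zero)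
  have "orth_proj (section_ip m) {f. \<forall>k. coeff_vec f k \<in> L k} f = p"
  proof (rule S.orth_proj_eqI)
    show "S.subspace {f. \<forall>k. coeff_vec f k \<in> L k}"
      using L by (auto simp: S.subspace_def vec.subspace_0 vec.subspace_add vec.subspace_scale)
    show "{f. \<forall>k. coeff_vec f k \<in> L k} \<subseteq> topspace (sections_topology m)"
      unfolding topspace_sections_topology using out by blast
    show "p \<in> {f. \<forall>k. coeff_vec f k \<in> L k}" using hip_orth_proj(1)[OF L] by (simp add: p)
    show "section_ip m (f - p) y = 0" if "y \<in> {f. \<forall>k. coeff_vec f k \<in> L k}" for y
      unfolding section_ip_def using hip_orth_proj(2)[OF L] that
      by (intro sum.neutral) (simp add: p)
  qed
  then show ?thesis by (simp add: p)
qed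

section \<open>Graded pieces of the global sections\<close>

definition slice :: "nat \<Rightarrow> ('n::finite) sheaf \<Rightarrow> int \<Rightarrow> (complex^'n) set" where
  "slice d V k = {x. zpow k *s const_vec x \<in> global_sections (twist V (int d))}"

lemma flag_dims_bounds: "1 \<le> r \<Longrightarrow> j \<in> flag_dims r a \<Longrightarrow> 1 \<le> j \<and> j \<le> r"
  by (auto simp: flag_dims_def)

lemma filt_flag_dim:
  assumes "mono_on {1..r} a" "1 \<le> r" "j \<in> flag_dims r a"
  shows "filt r a u (int (a j)) = vec.span (u ` {1..j})"
proof -
  have j: "1 \<le> j" "j \<le> r" using flag_dims_bounds[OF assms(2,3)] by simp_all
  have "a i \<le> a j \<longleftrightarrow> i \<le> j" if "i \<in> {1..r}" for i
  proof
    assume "i \<le> j"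
    then show "a i \<le> a j" using mono_onD[OF assms(1), of i j] that j by simp
  next
    assume le: "a i \<le> a j"
    show "i \<le> j"
    proof (rule ccontr)
      assume "\<not> i \<le> j"
      then have "j < r" "j + 1 \<le> i" using that by auto
      then have "a j < a (j + 1)" using assms(3) by (auto simp: flag_dims_def)
      also have "\<dots> \<le> a i" using mono_onD[OF assms(1), of "j + 1" i] that j \<open>j + 1 \<le> i\<close> by simp
      finally show False using le by simp
    qed
  qed
  then have "{i \<in> {1..r}. int (a i) \<le> int (a j)} = {1..j}" using j by auto
  then show ?thesis by (simp add: filt_def)
qed

text \<open>
  The filtration jumps only at the exponents, so its non-zero steps are the members of the flag. Which
  member occurs at a given level depends on the exponents alone, not on the basis; hence the
  quantification over \<open>u\<close> inside the two cases.
\<close>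

lemma filt_cases:
  assumes "mono_on {1..r} a" "1 \<le> r"
  obtains "\<And>u :: nat \<Rightarrow> complex^'n. filt r a u k = {0}"
  | j where "j \<in> flag_dims r a" "\<And>u :: nat \<Rightarrow> complex^'n. filt r a u k = vec.span (u ` {1..j})"
proof (cases "{i \<in> {1..r}. int (a i) \<le> k} = {}")
  case True
  then have "filt r a u k = {0}" for u :: "nat \<Rightarrow> complex^'n"
    unfolding filt_def by (simp only: image_empty vec.span_empty)
  then show thesis using that(1) by blast
next
  case False
  let ?J = "{i \<in> {1..r}. int (a i) \<le> k}"
  define j where "j = Max ?J"
  have j: "j \<in> ?J" unfolding j_def using False by (intro Max_in) auto
  have max: "i \<le> j" if "i \<in> ?J" for i unfolding j_def using that by (intro Max_ge) auto
  have "j \<in> flag_dims r a"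
  proof (cases "j = r")
    case False
    then have "\<not> int (a (j + 1)) \<le> k" using max[of "j + 1"] j by auto
    then show ?thesis using j False by (auto simp: flag_dims_def)
  qed (simp add: flag_dims_def)
  moreover have "?J = {1..j}"
  proof (intro equalityI subsetI)
    fix i assume i: "i \<in> {1..j}"
    then have "a i \<le> a j" using mono_onD[OF assms(1), of i j] j by simp
    then show "i \<in> ?J" using i j by auto
  qed (use max in auto)
  ultimately show thesis by (intro that(2)[of j]) (auto simp: filt_def)
qed

locale admissible_frames = adapted_frames r \<alpha> \<beta> u u'
  for r :: nat and \<alpha> \<beta> :: "nat \<Rightarrow> nat" and u u' :: "nat \<Rightarrow> complex^'n::finite" +
  fixes d :: nat
  assumes r1: "1 \<le> r" and admissible: "admissible r d \<alpha> \<beta>"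
begin

lemma mono_\<alpha>: "mono_on {1..r} \<alpha>" and mono_\<beta>: "mono_on {1..r} \<beta>"
  and sum_d: "(\<Sum>i=1..r. \<alpha> i) + (\<Sum>i=1..r. \<beta> i) = d"
  using admissible unfolding admissible_def by blast+

lemma le_last: "i \<in> {1..r} \<Longrightarrow> \<alpha> i \<le> \<alpha> r" "i \<in> {1..r} \<Longrightarrow> \<beta> i \<le> \<beta> r"
  using mono_onD[OF mono_\<alpha>, of i r] mono_onD[OF mono_\<beta>, of i r] by simp_all

text \<open>
  This is what makes every graded piece of \<open>H\<^sup>0(\<V>(d))\<close> zero or a member of a flag: in each
  degree \<open>k\<close> at least one of the two filtrations, at level \<open>k\<close> and at level \<open>d - k\<close>, is already all of
  \<open>W\<close>.
\<close>

lemma last_le: "\<alpha> r + \<beta> r \<le> d"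
proof -
  have "\<alpha> r \<le> (\<Sum>i=1..r. \<alpha> i)" "\<beta> r \<le> (\<Sum>i=1..r. \<beta> i)"
    using r1 by (auto intro!: member_le_sum)
  then show ?thesis using sum_d by simp
qed

lemma global_sections_V:
  "global_sections (twist V (int d)) = {f. \<forall>k. coeff_vec f k \<in> slice d V k}"
  and slice_eq: "slice d V k = filt r \<alpha> u k \<inter> filt r \<beta> u' (int d - k)"
proof -
  have eq: "global_sections (twist V (int d))
      = {f. \<forall>k. coeff_vec f k \<in> filt r \<alpha> u k \<inter> filt r \<beta> u' (int d - k)}"
    unfolding global_sections_def snd_twist_V by (auto simp: twist_def fst_V)
  show slice: "slice d V k = filt r \<alpha> u k \<inter> filt r \<beta> u' (int d - k)" for k
    unfolding slice_def eq by (auto simp: coeff_vec_monomial simp del: coeff_vec_zpow coeff_vec_scale_const)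
  show "global_sections (twist V (int d)) = {f. \<forall>k. coeff_vec f k \<in> slice d V k}"
    unfolding eq slice ..
qed

lemma filt_\<alpha>_full: "int (\<alpha> r) \<le> k \<Longrightarrow> filt r \<alpha> u k = vec.span (u ` {1..r})"
proof (rule filt_full)
  show "int (\<alpha> i) \<le> k" if "int (\<alpha> r) \<le> k" "i \<in> {1..r}" for i
    using le_last(1)[OF that(2)] that(1) by linarith
qed

lemma filt_\<beta>_full: "int (\<beta> r) \<le> k \<Longrightarrow> filt r \<beta> u' k = vec.span (u ` {1..r})"
  unfolding span_eq[symmetric]
proof (rule filt_full)
  show "int (\<beta> i) \<le> k" if "int (\<beta> r) \<le> k" "i \<in> {1..r}" for i
    using le_last(2)[OF that(2)] that(1) by linarith
qed

lemma slice_low: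
  assumes "k \<le> int d - int (\<beta> r)"
  shows "slice d V k = filt r \<alpha> u k"
proof -
  have "filt r \<beta> u' (int d - k) = vec.span (u ` {1..r})"
    by (rule filt_\<beta>_full) (use assms in linarith)
  then show ?thesis unfolding slice_eq using filt_subset[of r \<alpha> u k] by (simp add: inf.absorb1)
qed

lemma slice_high:
  assumes "int (\<alpha> r) \<le> k"
  shows "slice d V k = filt r \<beta> u' (int d - k)"
proof -
  have "filt r \<alpha> u k = vec.span (u' ` {1..r})"
    unfolding span_eq by (rule filt_\<alpha>_full[OF assms])
  then show ?thesis unfolding slice_eq using filt_subset[of r \<beta> u' "int d - k"] by (simp add: inf.absorb2)
qed

lemma slice_subspace: "vec.subspace (slice d V k)"
  unfolding slice_eq by (intro vec.subspace_inter) auto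

lemma slice_outside: "k < 0 \<or> k > int d \<Longrightarrow> slice d V k = {0}"
proof -
  assume k: "k < 0 \<or> k > int d"
  from k have "filt r \<alpha> u k = {0} \<or> filt r \<beta> u' (int d - k) = {0}"
    using filt_neg[of k r \<alpha> u] filt_neg[of "int d - k" r \<beta> u'] by linarith
  moreover have "0 \<in> filt r \<alpha> u k" "0 \<in> filt r \<beta> u' (int d - k)" by simp_all
  ultimately show ?thesis unfolding slice_eq by blast
qed

lemma orth_proj_global_sections:
  assumes "f \<in> topspace (sections_topology d)"
  shows "coeff_vec (orth_proj (section_ip d) (global_sections (twist V (int d))) f) k
    = orth_proj hip (slice d V k) (coeff_vec f k)"
  unfolding global_sections_V
  by (rule orth_proj_graded[OF slice_subspace slice_outside assms])

lemma slice_flag_\<alpha>: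
  assumes "j \<in> flag_dims r \<alpha>"
  shows "slice d V (int (\<alpha> j)) = vec.span (u ` {1..j})"
proof -
  have "\<alpha> j \<le> \<alpha> r" using flag_dims_bounds[OF r1 assms] by (intro le_last(1)) simp
  then have "int (\<alpha> j) \<le> int d - int (\<beta> r)" using last_le by linarith
  from slice_low[OF this] filt_flag_dim[OF mono_\<alpha> r1 assms] show ?thesis by simp
qed

lemma slice_flag_\<beta>:
  assumes "j \<in> flag_dims r \<beta>"
  shows "slice d V (int d - int (\<beta> j)) = vec.span (u' ` {1..j})"
proof -
  have "\<beta> j \<le> \<beta> r" using flag_dims_bounds[OF r1 assms] by (intro le_last(2)) simp
  then have "int (\<alpha> r) \<le> int d - int (\<beta> j)" using last_le by linarith
  from slice_high[OF this] filt_flag_dim[OF mono_\<beta> r1 assms] show ?thesis by simp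
qed

text \<open>
  The functionals are the coordinates with respect to \<open>u\<close> in the degrees up to \<open>s = d - \<beta> r\<close>, where
  the piece comes from the first filtration, and with respect to \<open>u'\<close> in the higher degrees. In
  either case the \<open>i\<close>-th one occurs in the degrees from \<open>\<alpha> i\<close> to \<open>d - \<beta> i\<close>, which gives
  \<open>\<Sum>\<^sub>i (d + 1 - \<alpha> i - \<beta> i) = r (d + 1) - d\<close> in total.
\<close>

lemma dim_global_sections:
  "quotient_dim lscale (global_sections (twist V (int d))) {0}
    (nat (int (CARD('n) * (d + 1)) - poly (quot_poly CARD('n) r d) (int d)))"
proof -
  let ?n = "CARD('n)"
  obtain v c v' c' where c: "dual_coords v c" and c': "dual_coords v' c'" and r: "r \<le> ?n"
    and "\<forall>i\<in>{1..r}. v i = u i" "\<forall>i\<in>{1..r}. v' i = u' i"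
    by (rule compatible_coords)
  note v = this(4)[THEN bspec] and v' = this(5)[THEN bspec]
  interpret L: complex_space lscale by (rule complex_space_lscale)
  have F: "x \<in> filt r \<alpha> u k \<longleftrightarrow> (\<forall>i\<in>{1..?n}. (i \<le> r \<longrightarrow> k < int (\<alpha> i)) \<longrightarrow> c i x = 0)" for x k
    by (rule filt_coords[OF c r]) (rule v)
  have F': "x \<in> filt r \<beta> u' k \<longleftrightarrow> (\<forall>i\<in>{1..?n}. (i \<le> r \<longrightarrow> k < int (\<beta> i)) \<longrightarrow> c' i x = 0)" for x k
    by (rule filt_coords[OF c' r]) (rule v')
  \<comment> \<open>Up to degree \<open>s\<close> the filtration at \<open>\<infinity>\<close> imposes only membership in \<open>W\<close>, from \<open>\<alpha> r \<le> s\<close> on the one at \<open>0\<close>.\<close>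
  define s where "s = int d - int (\<beta> r)"
  have s: "int (\<alpha> r) \<le> s" using last_le by (simp add: s_def)
  have high: "slice d V k = filt r \<beta> u' (int d - k)" if "\<not> k \<le> s" for k
    using that s by (intro slice_high) linarith
  have low: "slice d V k = filt r \<alpha> u k" if "k \<le> s" for k
    using that by (intro slice_low) (simp add: s_def)
  define I where "I = (SIGMA i:{1..r}. {int (\<alpha> i)..int d - int (\<beta> i)})"
  define e where "e = (\<lambda>(i, k). zpow k *s const_vec (if k \<le> s then v i else v' i))"
  define \<phi> where "\<phi> = (\<lambda>(i, k) f. (if k \<le> s then c i else c' i) (coeff_vec (f :: laurent^'n) k))"
  let ?H = "global_sections (twist V (int d))"
  have "quotient_dim lscale ?H {0} (card I)"
  proof (rule L.quotient_dim_dual[where I = I and e = e and \<phi> = \<phi>])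
    show "finite I" by (simp add: I_def)
    show "L.subspace ?H"
      unfolding global_sections_V using slice_subspace
      by (auto simp: L.subspace_def vec.subspace_0 vec.subspace_add vec.subspace_scale)
    then show "{0} \<subseteq> ?H" using L.subspace_0 by simp
    fix p assume "p \<in> I"
    then obtain i k where p: "p = (i, k)" "i \<in> {1..r}" "int (\<alpha> i) \<le> k" "k \<le> int d - int (\<beta> i)"
      by (auto simp: I_def)
    have "u i \<in> filt r \<alpha> u k" "u' i \<in> filt r \<beta> u' (int d - k)"
      unfolding filt_def using p by (auto intro!: vec.span_base)
    then have "(if k \<le> s then v i else v' i) \<in> slice d V k"
      using v[OF p(2)] v'[OF p(2)] low high by auto
    then show "e p \<in> ?H"
      unfolding global_sections_V e_def p(1) using vec.subspace_0[OF slice_subspace]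
      by (auto simp: coeff_vec_monomial simp del: coeff_vec_zpow coeff_vec_scale_const)
    show "\<phi> p (x + y) = \<phi> p x + \<phi> p y" "\<phi> p (lscale a x) = a * \<phi> p x" for x y a
      by (auto simp: \<phi>_def p(1) dual_coordsD(1,2)[OF c] dual_coordsD(1,2)[OF c'])
    fix q assume "q \<in> I"
    then obtain j l where q: "q = (j, l)" "j \<in> {1..r}" by (auto simp: I_def)
    have ij: "i \<in> {1..?n}" "j \<in> {1..?n}" using p(2) q(2) r by auto
    show "\<phi> p (e q) = (if p = q then 1 else 0)"
    proof (cases "k = l")
      case True
      then show ?thesis
        using dual_coords_monomial[OF c ij, of l k] dual_coords_monomial[OF c' ij, of l k]
        by (cases "k \<le> s") (simp_all only: \<phi>_def e_def p(1) q(1) prod.case if_True if_False prod.inject simp_thms)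
    next
      case False
      then show ?thesis
        by (simp add: \<phi>_def e_def p(1) q(1) coeff_vec_monomial dual_coordsD(3)[OF c] dual_coordsD(3)[OF c']
            del: coeff_vec_zpow coeff_vec_scale_const)
    qed
  next
    fix f assume f: "f \<in> ?H"
    have "f = 0" if *: "\<forall>p\<in>I. \<phi> p f = 0"
    proof (rule coeff_vec_eqI)
      fix k
      have fk: "coeff_vec f k \<in> slice d V k" using f unfolding global_sections_V by blast
      show "coeff_vec f k = coeff_vec 0 k"
        unfolding coeff_vec_0
      proof (cases "k \<le> s")
        case True
        show "coeff_vec f k = 0"
        proof (rule dual_coords_eq_0[OF c])
          fix i assume i: "i \<in> {1..?n}"
          show "c i (coeff_vec f k) = 0"
          proof (cases "i \<le> r \<and> int (\<alpha> i) \<le> k")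
            case True
            then have "i \<in> {1..r}" using i by simp
            then have "int (\<beta> i) \<le> int (\<beta> r)" using le_last(2)[of i] by simp
            then have "(i, k) \<in> I" using True \<open>i \<in> {1..r}\<close> \<open>k \<le> s\<close> by (auto simp: I_def s_def)
            then show ?thesis using * \<open>k \<le> s\<close> by (auto simp: \<phi>_def)
          next
            case False
            then show ?thesis using fk i unfolding low[OF \<open>k \<le> s\<close>] F by auto
          qed
        qed
      next
        case False
        show "coeff_vec f k = 0"
        proof (rule dual_coords_eq_0[OF c'])
          fix i assume i: "i \<in> {1..?n}"
          show "c' i (coeff_vec f k) = 0"
          proof (cases "i \<le> r \<and> int (\<beta> i) \<le> int d - k")
            case True
            then have "i \<in> {1..r}" using i by simp
            then have "int (\<alpha> i) \<le> int (\<alpha> r)" using le_last(1)[of i] by simp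
            then have "(i, k) \<in> I" using True \<open>i \<in> {1..r}\<close> \<open>\<not> k \<le> s\<close> s by (auto simp: I_def)
            then show ?thesis using * \<open>\<not> k \<le> s\<close> by (auto simp: \<phi>_def)
          next
            case no: False
            then show ?thesis using fk i unfolding high[OF False] F' by auto
          qed
        qed
      qed
    qed
    moreover have "\<phi> p 0 = 0" for p
      by (cases p) (simp add: \<phi>_def dual_coordsD(3)[OF c] dual_coordsD(3)[OF c'])
    ultimately show "f \<in> {0} \<longleftrightarrow> (\<forall>p\<in>I. \<phi> p f = 0)" by auto
  qed simp
  moreover have "int (card I) = int (?n * (d + 1)) - poly (quot_poly ?n r d) (int d)"
  proof -
    have "int (card I) = (\<Sum>i=1..r. int (nat (int d - int (\<beta> i) - int (\<alpha> i) + 1)))"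
      unfolding I_def by (subst card_SigmaI) (auto simp: add.commute)
    also have "\<dots> = (\<Sum>i=1..r. int d + 1 - (int (\<alpha> i) + int (\<beta> i)))"
    proof (rule sum.cong[OF refl])
      fix i assume "i \<in> {1..r}"
      then have "\<alpha> i + \<beta> i \<le> d" using le_last(1)[of i] le_last(2)[of i] last_le by linarith
      then show "int (nat (int d - int (\<beta> i) - int (\<alpha> i) + 1)) = int d + 1 - (int (\<alpha> i) + int (\<beta> i))"
        by simp
    qed
    also have "\<dots> = int r * (int d + 1) - int ((\<Sum>i=1..r. \<alpha> i) + (\<Sum>i=1..r. \<beta> i))"
      by (simp add: sum_subtractf sum.distrib)
    also have "\<dots> = int (?n * (d + 1)) - poly (quot_poly ?n r d) (int d)"
      unfolding sum_d by (simp add: quot_poly_def algebra_simps)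
    finally show ?thesis .
  qed
  ultimately show ?thesis by (metis nat_int)
qed

lemma global_sections_in_Gr:
  "global_sections (twist V (int d)) \<in> topspace (Gr lscale (sections_topology d)
    (nat (int (CARD('n) * (d + 1)) - poly (quot_poly CARD('n) r d) (int d))))"
    (is "?H \<in> topspace (Gr lscale ?X ?N)")
proof -
  interpret S: hermitian_space lscale "sections_topology d :: (laurent^'n) topology" "section_ip d"
    by (rule hermitian_space_sections)
  have sub: "?H \<subseteq> topspace ?X"
    unfolding global_sections_V topspace_sections_topology using slice_outside by blast
  obtain w where w: "S.is_frame ?N w" "S.span (w ` {1..?N}) = ?H" "\<forall>i\<in>{1..?N}. w i \<in> ?H"
    by (rule S.frame_of_quotient_dim_0[OF dim_global_sections])
  show ?thesis
    unfolding S.topspace_Gr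
  proof (intro exI[of _ w] conjI)
    show "\<forall>i\<in>{1..?N}. w i \<in> topspace ?X" using w(3) sub by blast
  qed (simp_all only: w(1,2))
qed

end


section \<open>The pair of flags\<close>

text \<open>
  The flags are read off from the global sections rather than from a choice of bases, so that they
  are a function of the sheaf and their continuity can be deduced from the embedding by global
  sections: the member of dimension \<open>j\<close> is the piece in degree \<open>\<alpha> j\<close>, respectively \<open>d - \<beta> j\<close>.
\<close>

definition flags_of ::
    "nat \<Rightarrow> nat \<Rightarrow> (nat \<Rightarrow> nat) \<Rightarrow> (nat \<Rightarrow> nat) \<Rightarrow> ('n::finite) sheaf \<Rightarrow>
     (nat \<Rightarrow> (complex^'n) set) \<times> (nat \<Rightarrow> (complex^'n) set)" where
  "flags_of r d \<alpha> \<beta> V =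
     (\<lambda>j\<in>flag_dims r \<alpha>. slice d V (int (\<alpha> j)), \<lambda>j\<in>flag_dims r \<beta>. slice d V (int d - int (\<beta> j)))"

lemma (in admissible_frames) flags_of_V:
  "flags_of r d \<alpha> \<beta> V = (flag_of (flag_dims r \<alpha>) u, flag_of (flag_dims r \<beta>) u')"
proof -
  have "(\<lambda>j\<in>flag_dims r \<alpha>. slice d V (int (\<alpha> j))) = (\<lambda>j\<in>flag_dims r \<alpha>. vec.span (u ` {1..j}))"
    by (rule restrict_ext) (rule slice_flag_\<alpha>)
  moreover have "(\<lambda>j\<in>flag_dims r \<beta>. slice d V (int d - int (\<beta> j))) = (\<lambda>j\<in>flag_dims r \<beta>. vec.span (u' ` {1..j}))"
    by (rule restrict_ext) (rule slice_flag_\<beta>)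
  ultimately show ?thesis unfolding flags_of_def flag_of_def by simp
qed

lemma topspace_Gr_vec:
  "L \<in> topspace (Gr (*s) euclidean k) \<longleftrightarrow>
    (\<exists>w :: nat \<Rightarrow> complex^'n::finite. vec_frame k w \<and> L = vec.span (w ` {1..k}))"
  unfolding hermitian_space.topspace_Gr[OF hermitian_space_vec] topspace_euclidean by simp

lemma topspace_Fl:
  "A \<in> topspace (Fl D) \<longleftrightarrow> A \<in> extensional D \<and>
    (\<forall>j\<in>D. \<exists>w :: nat \<Rightarrow> complex^'n::finite. vec_frame j w \<and> A j = vec.span (w ` {1..j})) \<and>
    (\<forall>i\<in>D. \<forall>j\<in>D. i \<le> j \<longrightarrow> A i \<subseteq> A j)"
proof -
  have "A \<in> topspace (Fl D) \<longleftrightarrow> A \<in> extensional D \<and>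
      (\<forall>j\<in>D. A j \<in> topspace (Gr (*s) euclidean j)) \<and> (\<forall>i\<in>D. \<forall>j\<in>D. i \<le> j \<longrightarrow> A i \<subseteq> A j)"
    by (auto simp: Fl_def PiE_iff)
  then show ?thesis unfolding topspace_Gr_vec .
qed

lemma continuous_map_into_Fl:
  assumes "\<And>z. z \<in> topspace Z \<Longrightarrow> f z \<in> topspace (Fl D)"
    and "\<And>j. j \<in> D \<Longrightarrow> continuous_map Z (Gr (*s) euclidean j) (\<lambda>z. f z j)"
  shows "continuous_map Z (Fl D :: (nat \<Rightarrow> (complex^'n::finite) set) topology) f"
proof -
  have "f ` topspace Z \<subseteq> extensional D" using assms(1) unfolding topspace_Fl by blast
  moreover have "f \<in> topspace Z \<rightarrow> {A. \<forall>i\<in>D. \<forall>j\<in>D. i \<le> j \<longrightarrow> A i \<subseteq> A j}"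
    using assms(1) unfolding topspace_Fl by blast
  ultimately show ?thesis
    unfolding Fl_def continuous_map_in_subtopology continuous_map_componentwise using assms(2) by simp
qed

lemma continuous_map_Fl_member:
  assumes "j \<in> D"
  shows "continuous_map (Fl D) (Gr (*s) euclidean j) (\<lambda>A. A j)"
proof -
  have "continuous_map (product_topology (\<lambda>j. Gr (*s) euclidean j) D) (Gr (*s) euclidean j) (\<lambda>A. A j)"
    using continuous_map_product_projection[OF assms, of "\<lambda>j. Gr (*s) euclidean j"] .
  then show ?thesis unfolding Fl_def by (rule continuous_map_from_subtopology)
qed

lemma flag_of_in_Fl:
  assumes "vec_frame r u" "D \<subseteq> {..r}"
  shows "flag_of D u \<in> topspace (Fl D)"
  unfolding topspace_Fl
proof (intro conjI ballI impI)
  interpret V: complex_space "(*s) :: complex \<Rightarrow> complex^'a \<Rightarrow> complex^'a" by (rule complex_space_vec)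
  show "flag_of D u \<in> extensional D" by (simp add: flag_of_def)
  fix j assume j: "j \<in> D"
  then have "vec_frame j u" using V.is_frame_mono[OF assms(1)] assms(2) by auto
  then show "\<exists>w. vec_frame j w \<and> flag_of D u j = vec.span (w ` {1..j})"
    using j by (intro exI[of _ u]) (simp add: flag_of_def)
next
  fix i j assume "i \<in> D" "j \<in> D" "i \<le> j"
  then show "flag_of D u i \<subseteq> flag_of D u j"
    by (simp add: flag_of_def) (intro vec.span_mono image_mono, simp)
qed

lemma flag_dims_props: "finite (flag_dims r a)" "r \<in> flag_dims r a" "flag_dims r a \<subseteq> {..r}"
proof -
  show sub: "flag_dims r a \<subseteq> {..r}" by (auto simp: flag_dims_def)
  then show "finite (flag_dims r a)" using finite_subset by blast
  show "r \<in> flag_dims r a" by (simp add: flag_dims_def)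
qed

lemma topspace_fibre_product:
  "(A, B) \<in> topspace (fibre_product X Y f g) \<longleftrightarrow> A \<in> topspace X \<and> B \<in> topspace Y \<and> f A = g B"
  by (auto simp: fibre_product_def)

lemma frames_of_flags:
  fixes A B :: "nat \<Rightarrow> (complex^'n::finite) set"
  assumes "(A, B) \<in> topspace (fibre_product (Fl (flag_dims r \<alpha>)) (Fl (flag_dims r \<beta>)) (\<lambda>A. A r) (\<lambda>B. B r))"
  obtains u u' where "adapted_frames r u u'"
    "A = flag_of (flag_dims r \<alpha>) u" "B = flag_of (flag_dims r \<beta>) u'"
proof -
  have A: "A \<in> topspace (Fl (flag_dims r \<alpha>))" and B: "B \<in> topspace (Fl (flag_dims r \<beta>))"
    and AB: "A r = B r"
    using assms unfolding topspace_fibre_product by auto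
  have basis: "\<exists>u. vec_frame r u \<and> C = flag_of (flag_dims r a) u"
    if C: "C \<in> topspace (Fl (flag_dims r a))" for C :: "nat \<Rightarrow> (complex^'n) set" and a
  proof -
    have C': "C \<in> extensional (flag_dims r a)"
      "\<And>j. j \<in> flag_dims r a \<Longrightarrow> \<exists>w. vec_frame j w \<and> C j = vec.span (w ` {1..j})"
      "\<And>i j. i \<in> flag_dims r a \<Longrightarrow> j \<in> flag_dims r a \<Longrightarrow> i \<le> j \<Longrightarrow> C i \<subseteq> C j"
      using C unfolding topspace_Fl by blast+
    have "\<exists>u. vec_frame r u \<and> (\<forall>j\<in>flag_dims r a. vec.span (u ` {1..j}) = C j)"
    proof (rule flag_has_adapted_basis[of "flag_dims r a" r C])
      show "\<exists>w. vec_frame j w \<and> C j = vec.span (w ` {1..j})" if "j \<in> flag_dims r a" for j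
        by (rule C'(2)[OF that])
      show "C i \<subseteq> C j" if "i \<in> flag_dims r a" "j \<in> flag_dims r a" "i \<le> j" for i j
        by (rule C'(3)[OF that])
    qed (use flag_dims_props in blast)+
    then obtain u where u: "vec_frame r u" "\<And>j. j \<in> flag_dims r a \<Longrightarrow> vec.span (u ` {1..j}) = C j"
      by blast
    have "C = flag_of (flag_dims r a) u"
      unfolding flag_of_def using C'(1) u(2)
      by (intro extensionalityI[of _ "flag_dims r a"]) auto
    with u(1) show ?thesis by blast
  qed
  from basis[OF A] obtain u where u: "vec_frame r u" "A = flag_of (flag_dims r \<alpha>) u" by blast
  from basis[OF B] obtain u' where u': "vec_frame r u'" "B = flag_of (flag_dims r \<beta>) u'" by blast
  have "vec.span (u' ` {1..r}) = vec.span (u ` {1..r})"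
    using AB flag_dims_props(2) by (simp add: u(2) u'(2) flag_of_def)
  then have "adapted_frames r u u'" using u(1) u'(1) by (simp add: adapted_frames_def)
  then show thesis using that u(2) u'(2) by blast
qed

lemma (in adapted_frames) flags_in_fibre_product:
  "(flag_of (flag_dims r \<alpha>) u, flag_of (flag_dims r \<beta>) u') \<in>
    topspace (fibre_product (Fl (flag_dims r \<alpha>)) (Fl (flag_dims r \<beta>)) (\<lambda>A. A r) (\<lambda>B. B r))"
  unfolding topspace_fibre_product
  using flag_of_in_Fl[OF frame flag_dims_props(3)] flag_of_in_Fl[OF frame' flag_dims_props(3)]
    span_eq flag_dims_props(2)
  by (simp add: flag_of_def)

lemma adapted_bases_frames:
  assumes "1 \<le> r" "admissible r d \<alpha> \<beta>" "adapted_bases r \<alpha> \<beta> V u u'"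
  shows "admissible_frames r \<alpha> \<beta> u u' d" "V = adapted_frames.V r \<alpha> \<beta> u u'"
proof -
  have fr: "adapted_frames r u u'"
    using assms(3) unfolding adapted_bases_def basis_of_iff adapted_frames_def by auto
  then show "admissible_frames r \<alpha> \<beta> u u' d"
    using assms(1,2) by (simp add: admissible_frames_def admissible_frames_axioms_def)
  show "V = adapted_frames.V r \<alpha> \<beta> u u'"
    using assms(3) unfolding adapted_bases_def adapted_frames.V_def[OF fr] by blast
qed

section \<open>The homeomorphism\<close>

abbreviation sections_Gr :: "nat \<Rightarrow> nat \<Rightarrow> (laurent^'n::finite) set topology" where
  "sections_Gr r d \<equiv> Gr lscale (sections_topology d)
     (nat (int (CARD('n) * (d + 1)) - poly (quot_poly CARD('n) r d) (int d)))"

locale admissible_pair =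
  fixes r d :: nat and \<alpha> \<beta> :: "nat \<Rightarrow> nat"
  assumes r1: "1 \<le> r" and adm: "admissible r d \<alpha> \<beta>"
begin

definition F :: "('n::finite) sheaf set" where "F = fixed_component r d \<alpha> \<beta>"
definition X :: "('n::finite) sheaf topology" where "X = subtopology (quot_space r d) F"
definition Y :: "((nat \<Rightarrow> (complex^'n::finite) set) \<times> (nat \<Rightarrow> (complex^'n) set)) topology" where
  "Y = fibre_product (Fl (flag_dims r \<alpha>)) (Fl (flag_dims r \<beta>)) (\<lambda>A. A r) (\<lambda>B. B r)"
abbreviation h :: "('n::finite) sheaf \<Rightarrow> (nat \<Rightarrow> (complex^'n) set) \<times> (nat \<Rightarrow> (complex^'n) set)" where
  "h \<equiv> flags_of r d \<alpha> \<beta>"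
abbreviation sec :: "('n::finite) sheaf \<Rightarrow> (laurent^'n) set" where
  "sec V \<equiv> global_sections (twist V (int d))"
lemma F_cases:
  fixes V :: "('n::finite) sheaf"
  assumes "V \<in> F"
  obtains u u' where "admissible_frames r \<alpha> \<beta> u u' d" "V = adapted_frames.V r \<alpha> \<beta> u u'"
proof -
  obtain u u' where "adapted_bases r \<alpha> \<beta> V u u'"
    using assms unfolding F_def fixed_component_def by blast
  from adapted_bases_frames[OF r1 adm this] show thesis by (rule that)
qed

lemma admissible_framesI: "adapted_frames r u u' \<Longrightarrow> admissible_frames r \<alpha> \<beta> u u' d"
  using r1 adm by (simp add: admissible_frames_def admissible_frames_axioms_def)

lemma V_in_F: "adapted_frames r u u' \<Longrightarrow> adapted_frames.V r \<alpha> \<beta> u u' \<in> F"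
  unfolding F_def
  by (rule adapted_frames.V_in_fixed_component) (use adm in \<open>simp_all add: admissible_def\<close>)

lemma quot_space_eq:
  "(quot_space r d :: ('n::finite) sheaf topology) = pullback_topology (Quot (quot_poly CARD('n) r d)) sec (sections_Gr r d)"
  unfolding quot_space_def quot_topology_def ..

lemma F_subset_topspace: "(F :: ('n::finite) sheaf set) \<subseteq> topspace (quot_space r d)"
proof
  fix V :: "'n sheaf" assume V: "V \<in> F"
  obtain u u' where A: "admissible_frames r \<alpha> \<beta> u u' d" "V = adapted_frames.V r \<alpha> \<beta> u u'"
    using V by (rule F_cases)
  have "V \<in> Quot (quot_poly CARD('n) r d)"
    using V unfolding F_def fixed_component_def fixed_points_def by blast
  then show "V \<in> topspace (quot_space r d)"
    unfolding quot_space_eq topspace_pullback_topology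
    using admissible_frames.global_sections_in_Gr[OF A(1)] A(2) by simp
qed

lemma topspace_X: "topspace X = F"
  unfolding X_def topspace_subtopology using F_subset_topspace by (rule Int_absorb1)

lemma continuous_map_sec: "continuous_map X (sections_Gr r d) (sec :: ('n::finite) sheaf \<Rightarrow> _)"
proof -
  have "continuous_map (quot_space r d) (sections_Gr r d) (id \<circ> (sec :: 'n sheaf \<Rightarrow> _))"
    unfolding quot_space_eq by (rule continuous_map_pullback) simp
  then show ?thesis unfolding X_def by (intro continuous_map_from_subtopology) simp
qed

lemma continuous_map_into_X:
  fixes g :: "'z \<Rightarrow> ('n::finite) sheaf"
  assumes "\<And>z. z \<in> topspace Z \<Longrightarrow> g z \<in> F"
    and "continuous_map Z (sections_Gr r d) (\<lambda>z. sec (g z))"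
  shows "continuous_map Z X g"
  unfolding X_def
proof (rule continuous_map_into_subtopology)
  show "g \<in> topspace Z \<rightarrow> F" using assms(1) by blast
  have "topspace Z \<subseteq> g -` Quot (quot_poly CARD('n) r d)"
    using assms(1) unfolding F_def fixed_component_def fixed_points_def by blast
  then show "continuous_map Z (quot_space r d) g"
    unfolding quot_space_eq using assms(2) by (intro continuous_map_pullback') (simp_all add: o_def)
qed

lemma h_in_Y:
  assumes "V \<in> F"
  shows "h V \<in> topspace Y"
proof -
  obtain u u' where A: "admissible_frames r \<alpha> \<beta> u u' d" "V = adapted_frames.V r \<alpha> \<beta> u u'"
    using assms by (rule F_cases)
  show ?thesis
    unfolding A(2) admissible_frames.flags_of_V[OF A(1)] Y_def
    by (rule adapted_frames.flags_in_fibre_product[OF admissible_frames.axioms(1)[OF A(1)]])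
qed

lemma h_surj:
  fixes y :: "(nat \<Rightarrow> (complex^'n::finite) set) \<times> _"
  assumes "y \<in> topspace Y"
  shows "\<exists>V\<in>F. h V = y"
proof -
  obtain A B where y: "y = (A, B)" by (cases y)
  obtain u u' where u: "adapted_frames r u u'"
    "A = flag_of (flag_dims r \<alpha>) u" "B = flag_of (flag_dims r \<beta>) u'"
    using assms unfolding y Y_def by (rule frames_of_flags)
  then have "h (adapted_frames.V r \<alpha> \<beta> u u') = y"
    using admissible_frames.flags_of_V[OF admissible_framesI[OF u(1)]] y by simp
  then show ?thesis using V_in_F[OF u(1)] by blast
qed

lemma mono: "mono_on {1..r} \<alpha>" "mono_on {1..r} \<beta>"
  using adm unfolding admissible_def by blast+

lemma flag_of_eqD:
  assumes "flag_of D u = flag_of D w" "j \<in> D"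
  shows "vec.span (u ` {1..j}) = vec.span (w ` {1..j})"
  using fun_cong[OF assms(1), of j] assms(2) by (simp add: flag_of_def)

text \<open>
  Every step of a filtration is zero or a member of the flag, and the sheaf is built from these steps.
\<close>

lemma h_inj: "inj_on h (F :: ('n::finite) sheaf set)"
proof (rule inj_onI)
  fix V1 V2 :: "'n sheaf" assume V: "V1 \<in> F" "V2 \<in> F" and eq: "h V1 = h V2"
  obtain u1 u1' where 1: "admissible_frames r \<alpha> \<beta> u1 u1' d" "V1 = adapted_frames.V r \<alpha> \<beta> u1 u1'"
    using V(1) by (rule F_cases)
  obtain u2 u2' where 2: "admissible_frames r \<alpha> \<beta> u2 u2' d" "V2 = adapted_frames.V r \<alpha> \<beta> u2 u2'"
    using V(2) by (rule F_cases)
  have fl: "flag_of (flag_dims r \<alpha>) u1 = flag_of (flag_dims r \<alpha>) u2"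
    "flag_of (flag_dims r \<beta>) u1' = flag_of (flag_dims r \<beta>) u2'"
    using eq admissible_frames.flags_of_V[OF 1(1)] admissible_frames.flags_of_V[OF 2(1)] 1(2) 2(2)
    by simp_all
  have filt: "filt r a u k = filt r a w k"
    if "mono_on {1..r} a" "flag_of (flag_dims r a) u = flag_of (flag_dims r a) w"
    for a k and u w :: "nat \<Rightarrow> complex^'n"
  proof (rule filt_cases[OF that(1) r1, of k, where 'n = 'n])
    fix j assume "j \<in> flag_dims r a" "\<And>u :: nat \<Rightarrow> complex^'n. filt r a u k = vec.span (u ` {1..j})"
    then show ?thesis using flag_of_eqD[OF that(2)] by metis
  qed simp
  note A1 = admissible_frames.axioms(1)[OF 1(1)] and A2 = admissible_frames.axioms(1)[OF 2(1)]
  show "V1 = V2"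
  proof (rule prod_eqI)
    show "fst V1 = fst V2"
      unfolding 1(2) 2(2) adapted_frames.fst_V[OF A1] adapted_frames.fst_V[OF A2]
        filt[OF mono(1) fl(1)] ..
    show "snd V1 = snd V2"
      unfolding 1(2) 2(2) adapted_frames.snd_V[OF A1] adapted_frames.snd_V[OF A2]
        filt[OF mono(2) fl(2)] ..
  qed
qed

lemma orth_proj_sec:
  fixes V :: "('n::finite) sheaf"
  assumes "V \<in> F" "f \<in> topspace (sections_topology d)"
  shows "coeff_vec (orth_proj (section_ip d) (sec V) f) k = orth_proj hip (slice d V k) (coeff_vec f k)"
proof -
  obtain u u' where A: "admissible_frames r \<alpha> \<beta> u u' d" "V = adapted_frames.V r \<alpha> \<beta> u u'"
    using assms(1) by (rule F_cases)
  show ?thesis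
    unfolding A(2) by (rule admissible_frames.orth_proj_global_sections[OF A(1) assms(2)])
qed

text \<open>
  The projection to a graded piece is a coefficient of the projection to the space of global sections,
  applied to a monomial. This gives the continuity of the flags of a sheaf.
\<close>

lemma continuous_map_slice:
  assumes k: "0 \<le> k" "k \<le> int d"
    and dim: "\<And>V :: ('n::finite) sheaf. V \<in> F \<Longrightarrow> slice d V k \<in> topspace (Gr (*s) euclidean j)"
  shows "continuous_map X (Gr (*s) euclidean j) (\<lambda>V :: 'n sheaf. slice d V k)"
proof -
  interpret S: hermitian_space lscale "sections_topology d :: (laurent^'n) topology" "section_ip d"
    by (rule hermitian_space_sections)
  interpret H: hermitian_space "(*s)" euclidean "hip :: complex^'n \<Rightarrow> _" by (rule hermitian_space_vec)
  have "continuous_map X euclidean (\<lambda>V. orth_proj hip (slice d V k) x)" for x :: "complex^'n"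
  proof -
    define f where "f = zpow k *s const_vec x"
    have fk: "coeff_vec f k = x" by (simp add: f_def coeff_vec_monomial del: coeff_vec_zpow coeff_vec_scale_const)
    have f: "f \<in> topspace (sections_topology d)"
      using k unfolding topspace_sections_topology f_def
      by (simp add: coeff_vec_monomial del: coeff_vec_zpow coeff_vec_scale_const)
    have "continuous_map X (sections_topology d) (\<lambda>V. orth_proj (section_ip d) (sec V) f)"
      using continuous_map_compose[OF continuous_map_sec S.continuous_map_orth_proj[OF f]]
      by (simp add: o_def)
    then have "continuous_map X euclidean (\<lambda>V. coeff_vec (orth_proj (section_ip d) (sec V) f) k)"
      unfolding continuous_map_into_sections_iff by blast
    then show ?thesis
      by (rule continuous_map_eq) (simp add: topspace_X orth_proj_sec f fk)
  qed
  then show ?thesis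
    unfolding H.continuous_map_into_Gr_iff topspace_X using dim by blast
qed

lemma continuous_map_h: "continuous_map (X :: ('n::finite) sheaf topology) Y h"
proof -
  have fst_h: "fst (h V) \<in> topspace (Fl (flag_dims r \<alpha>))" and snd_h: "snd (h V) \<in> topspace (Fl (flag_dims r \<beta>))"
    and eq_h: "fst (h V) r = snd (h V) r" if "V \<in> F" for V :: "'n sheaf"
  proof -
    have "(fst (h V), snd (h V)) \<in> topspace Y" using h_in_Y[OF that] by simp
    then show "fst (h V) \<in> topspace (Fl (flag_dims r \<alpha>))" "snd (h V) \<in> topspace (Fl (flag_dims r \<beta>))"
      "fst (h V) r = snd (h V) r"
      unfolding Y_def topspace_fibre_product by blast+
  qed
  have bound: "\<alpha> j \<le> d" if "j \<in> flag_dims r \<alpha>" for j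
  proof -
    have "\<alpha> j \<le> (\<Sum>i=1..r. \<alpha> i)" using flag_dims_bounds[OF r1 that] by (intro member_le_sum) auto
    then show ?thesis using adm by (auto simp: admissible_def)
  qed
  have bound': "\<beta> j \<le> d" if "j \<in> flag_dims r \<beta>" for j
  proof -
    have "\<beta> j \<le> (\<Sum>i=1..r. \<beta> i)" using flag_dims_bounds[OF r1 that] by (intro member_le_sum) auto
    then show ?thesis using adm by (auto simp: admissible_def)
  qed
  have "continuous_map X (Fl (flag_dims r \<alpha>)) (\<lambda>V :: 'n sheaf. fst (h V))"
  proof (rule continuous_map_into_Fl)
    show "fst (h V) \<in> topspace (Fl (flag_dims r \<alpha>))" if "V \<in> topspace X" for V :: "'n sheaf"
      using fst_h that topspace_X by blast
    fix j assume j: "j \<in> flag_dims r \<alpha>"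
    have eq: "fst (h V) j = slice d V (int (\<alpha> j))" for V :: "'n sheaf" using j by (simp add: flags_of_def)
    show "continuous_map X (Gr (*s) euclidean j) (\<lambda>V :: 'n sheaf. fst (h V) j)"
      unfolding eq
    proof (rule continuous_map_slice)
      fix V :: "'n sheaf" assume "V \<in> F"
      then show "slice d V (int (\<alpha> j)) \<in> topspace (Gr (*s) euclidean j)"
        using fst_h[of V] j unfolding topspace_Fl topspace_Gr_vec eq[symmetric] by blast
    qed (use bound[OF j] in simp_all)
  qed
  moreover have "continuous_map X (Fl (flag_dims r \<beta>)) (\<lambda>V :: 'n sheaf. snd (h V))"
  proof (rule continuous_map_into_Fl)
    show "snd (h V) \<in> topspace (Fl (flag_dims r \<beta>))" if "V \<in> topspace X" for V :: "'n sheaf"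
      using snd_h that topspace_X by blast
    fix j assume j: "j \<in> flag_dims r \<beta>"
    have eq: "snd (h V) j = slice d V (int d - int (\<beta> j))" for V :: "'n sheaf" using j by (simp add: flags_of_def)
    show "continuous_map X (Gr (*s) euclidean j) (\<lambda>V :: 'n sheaf. snd (h V) j)"
      unfolding eq
    proof (rule continuous_map_slice)
      fix V :: "'n sheaf" assume "V \<in> F"
      then show "slice d V (int d - int (\<beta> j)) \<in> topspace (Gr (*s) euclidean j)"
        using snd_h[of V] j unfolding topspace_Fl topspace_Gr_vec eq[symmetric] by blast
    qed (use bound'[OF j] in simp_all)
  qed
  ultimately have "continuous_map X (prod_topology (Fl (flag_dims r \<alpha>)) (Fl (flag_dims r \<beta>)))
      (\<lambda>V :: 'n sheaf. (fst (h V), snd (h V)))"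
    by (rule continuous_map_pairedI)
  moreover have "h V \<in> {(A, B). A r = B r}" if "V \<in> topspace X" for V :: "'n sheaf"
    using eq_h[of V] that unfolding topspace_X by (simp add: case_prod_beta)
  ultimately show ?thesis
    unfolding Y_def fibre_product_def by (intro continuous_map_into_subtopology) simp_all
qed

lemma continuous_map_orth_proj_flag:
  assumes "continuous_map Z (Gr (*s) euclidean j) \<phi>"
  shows "continuous_map Z euclidean (\<lambda>z. orth_proj hip (\<phi> z) (x :: complex^'n::finite))"
  using hermitian_space.continuous_map_into_Gr_iff[OF hermitian_space_vec, of Z j \<phi>] assms by simp

text \<open>
  Conversely each graded piece is zero or a member of one of the flags, and which of these holds is
  the same for all sheaves of the component. This gives the continuity of the inverse.
\<close>

lemma continuous_map_orth_proj_slice: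
  fixes g :: "_ \<Rightarrow> ('n::finite) sheaf"
  assumes g: "\<And>y. y \<in> topspace Y \<Longrightarrow> g y \<in> F \<and> h (g y) = y"
  shows "continuous_map Y euclidean (\<lambda>y. orth_proj hip (slice d (g y) k) x)"
proof -
  have cfst: "continuous_map Y (Fl (flag_dims r \<alpha>)) fst"
    and csnd: "continuous_map Y (Fl (flag_dims r \<beta>)) snd"
    unfolding Y_def fibre_product_def
    by (intro continuous_map_from_subtopology continuous_map_fst continuous_map_snd)+
  have frames: "\<exists>u u'. admissible_frames r \<alpha> \<beta> u u' d \<and> g y = adapted_frames.V r \<alpha> \<beta> u u'
      \<and> fst y = flag_of (flag_dims r \<alpha>) u \<and> snd y = flag_of (flag_dims r \<beta>) u'"
    if y: "y \<in> topspace Y" for y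
  proof -
    obtain u u' where A: "admissible_frames r \<alpha> \<beta> u u' d" "g y = adapted_frames.V r \<alpha> \<beta> u u'"
      using g[OF y] by (blast elim: F_cases)
    moreover have "y = (flag_of (flag_dims r \<alpha>) u, flag_of (flag_dims r \<beta>) u')"
      using g[OF y] admissible_frames.flags_of_V[OF A(1)] A(2) by simp
    ultimately show ?thesis by (intro exI[of _ u] exI[of _ u']) simp
  qed
  show ?thesis
  proof (cases "k \<le> int d - int (\<beta> r)")
    case True
    show ?thesis
    proof (rule filt_cases[OF mono(1) r1, of k, where 'n = 'n])
      assume z: "\<And>u :: nat \<Rightarrow> complex^'n. filt r \<alpha> u k = {0}"
      have eq: "slice d (g y) k = {0}" if y: "y \<in> topspace Y" for y
      proof -
        obtain u u' where A: "admissible_frames r \<alpha> \<beta> u u' d" "g y = adapted_frames.V r \<alpha> \<beta> u u'"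
          using frames[OF y] by blast
        show ?thesis using admissible_frames.slice_low[OF A(1) True] A(2) z by simp
      qed
      have "continuous_map Y euclidean (\<lambda>y. orth_proj hip {0} x)" by simp
      then show ?thesis by (rule continuous_map_eq) (simp add: eq)
    next
      fix j assume j: "j \<in> flag_dims r \<alpha>" "\<And>u :: nat \<Rightarrow> complex^'n. filt r \<alpha> u k = vec.span (u ` {1..j})"
      have eq: "slice d (g y) k = fst y j" if y: "y \<in> topspace Y" for y
      proof -
        obtain u u' where A: "admissible_frames r \<alpha> \<beta> u u' d" "g y = adapted_frames.V r \<alpha> \<beta> u u'"
          "fst y = flag_of (flag_dims r \<alpha>) u" using frames[OF y] by blast
        then show ?thesis
          using admissible_frames.slice_low[OF A(1) True] j by (simp add: flag_of_def)
      qed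
      have "continuous_map Y euclidean (\<lambda>y. orth_proj hip (fst y j) x)"
        using continuous_map_compose[OF cfst continuous_map_Fl_member[OF j(1)]]
        by (intro continuous_map_orth_proj_flag) (simp add: o_def)
      then show ?thesis by (rule continuous_map_eq) (simp add: eq)
    qed
  next
    case False
    have "\<alpha> r + \<beta> r \<le> d"
    proof -
      have "\<alpha> r \<le> (\<Sum>i=1..r. \<alpha> i)" "\<beta> r \<le> (\<Sum>i=1..r. \<beta> i)"
        using r1 by (auto intro!: member_le_sum)
      then show ?thesis using adm unfolding admissible_def by linarith
    qed
    then have high: "int (\<alpha> r) \<le> k" using False by linarith
    show ?thesis
    proof (rule filt_cases[OF mono(2) r1, of "int d - k", where 'n = 'n])
      assume z: "\<And>u :: nat \<Rightarrow> complex^'n. filt r \<beta> u (int d - k) = {0}"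
      have eq: "slice d (g y) k = {0}" if y: "y \<in> topspace Y" for y
      proof -
        obtain u u' where A: "admissible_frames r \<alpha> \<beta> u u' d" "g y = adapted_frames.V r \<alpha> \<beta> u u'"
          using frames[OF y] by blast
        show ?thesis using admissible_frames.slice_high[OF A(1) high] A(2) z by simp
      qed
      have "continuous_map Y euclidean (\<lambda>y. orth_proj hip {0} x)" by simp
      then show ?thesis by (rule continuous_map_eq) (simp add: eq)
    next
      fix j assume j: "j \<in> flag_dims r \<beta>"
        "\<And>u :: nat \<Rightarrow> complex^'n. filt r \<beta> u (int d - k) = vec.span (u ` {1..j})"
      have eq: "slice d (g y) k = snd y j" if y: "y \<in> topspace Y" for y
      proof -
        obtain u u' where A: "admissible_frames r \<alpha> \<beta> u u' d" "g y = adapted_frames.V r \<alpha> \<beta> u u'"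
          "snd y = flag_of (flag_dims r \<beta>) u'" using frames[OF y] by blast
        then show ?thesis
          using admissible_frames.slice_high[OF A(1) high] j by (simp add: flag_of_def)
      qed
      have "continuous_map Y euclidean (\<lambda>y. orth_proj hip (snd y j) x)"
        using continuous_map_compose[OF csnd continuous_map_Fl_member[OF j(1)]]
        by (intro continuous_map_orth_proj_flag) (simp add: o_def)
      then show ?thesis by (rule continuous_map_eq) (simp add: eq)
    qed
  qed
qed

lemma homeomorphic_map_h: "homeomorphic_map (X :: ('n::finite) sheaf topology) Y h"
proof -
  define g :: "(nat \<Rightarrow> (complex^'n) set) \<times> (nat \<Rightarrow> (complex^'n) set) \<Rightarrow> 'n sheaf" where "g y = inv_into F h y" for y
  have im: "h ` (F :: 'n sheaf set) = topspace Y" using h_in_Y h_surj by blast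
  have g: "(g y :: 'n sheaf) \<in> F \<and> h (g y) = y" if "y \<in> topspace Y" for y
    using that unfolding im[symmetric] g_def by (simp add: inv_into_into f_inv_into_f)
  interpret S: hermitian_space lscale "sections_topology d :: (laurent^'n) topology" "section_ip d"
    by (rule hermitian_space_sections)
  have "continuous_map Y X g"
  proof (rule continuous_map_into_X)
    show "(g y :: 'n sheaf) \<in> F" if "y \<in> topspace Y" for y using g[OF that] ..
    show "continuous_map Y (sections_Gr r d) (\<lambda>y. sec (g y))"
      unfolding S.continuous_map_into_Gr_iff
    proof (intro conjI ballI)
      fix y :: "(nat \<Rightarrow> (complex^'n) set) \<times> (nat \<Rightarrow> (complex^'n) set)" assume "y \<in> topspace Y"
      then have "g y \<in> topspace X" using g topspace_X by blast
      then show sec_g: "sec (g y) \<in> topspace (sections_Gr r d)"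
        using continuous_map_sec unfolding continuous_map_def by blast
    next
      fix f :: "laurent^'n" assume f: "f \<in> topspace (sections_topology d)"
      show "continuous_map Y (sections_topology d) (\<lambda>y. orth_proj (section_ip d) (sec (g y)) f)"
        unfolding continuous_map_into_sections_iff
      proof (intro conjI ballI allI)
        fix y :: "(nat \<Rightarrow> (complex^'n) set) \<times> (nat \<Rightarrow> (complex^'n) set)" assume "y \<in> topspace Y"
        then have "g y \<in> topspace X" using g topspace_X by blast
        moreover have "continuous_map X (sections_topology d) (\<lambda>V. orth_proj (section_ip d) (sec V) f)"
          using continuous_map_compose[OF continuous_map_sec S.continuous_map_orth_proj[OF f]]
          by (simp add: o_def)
        ultimately show "orth_proj (section_ip d) (sec (g y)) f \<in> topspace (sections_topology d)"
          unfolding continuous_map_def by blast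
      next
        fix k
        show "continuous_map Y euclidean (\<lambda>y. coeff_vec (orth_proj (section_ip d) (sec (g y)) f) k)"
        proof (rule continuous_map_eq)
          show "continuous_map Y euclidean (\<lambda>y. orth_proj hip (slice d (g y) k) (coeff_vec f k))"
            by (rule continuous_map_orth_proj_slice[OF g])
          fix y :: "(nat \<Rightarrow> (complex^'n) set) \<times> (nat \<Rightarrow> (complex^'n) set)" assume "y \<in> topspace Y"
          then have "g y \<in> F" using g by blast
          then show "orth_proj hip (slice d (g y) k) (coeff_vec f k)
              = coeff_vec (orth_proj (section_ip d) (sec (g y)) f) k"
            by (rule orth_proj_sec[OF _ f, symmetric])
        qed
      qed
    qed
  qed
  moreover have "g (h V) = V" if "V \<in> F" for V :: "'n sheaf"
    unfolding g_def using that by (rule inv_into_f_f[OF h_inj])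
  ultimately have "homeomorphic_maps X Y h g"
    unfolding homeomorphic_maps_def topspace_X using continuous_map_h g by simp
  then show ?thesis unfolding homeomorphic_map_maps by (rule exI[of "homeomorphic_maps X Y h" g])
qed

end


section \<open>Connectedness of the fibre product\<close>

lemma dual_coords_invertible:
  fixes v :: "nat \<Rightarrow> complex^'n" and \<tau> :: "'n \<Rightarrow> nat"
  assumes c: "dual_coords v c" and \<tau>: "bij_betw \<tau> UNIV {1..CARD('n)}"
  shows "det (\<chi> a b. v (\<tau> b) $ a) \<noteq> 0"
proof -
  let ?M = "\<chi> a b. v (\<tau> b) $ a" and ?C = "\<chi> a b. c (\<tau> a) (axis b 1)"
  have entry: "(\<Sum>e\<in>UNIV. c (\<tau> a) (axis e 1) * v (\<tau> b) $ e) = (if a = b then 1 else 0)" for a b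
  proof -
    have "(\<Sum>e\<in>UNIV. c (\<tau> a) (axis e 1) * v (\<tau> b) $ e)
        = c (\<tau> a) (\<Sum>e\<in>UNIV. (v (\<tau> b) $ e) *s axis e 1)"
      by (simp add: dual_coordsD(5)[OF c] dual_coordsD(2)[OF c] mult.commute)
    also have "\<dots> = c (\<tau> a) (v (\<tau> b))" by (simp only: basis_expansion)
    also have "\<dots> = (if \<tau> a = \<tau> b then 1 else 0)"
      by (rule dual_coordsD(6)[OF c]) (use bij_betwE[OF \<tau>] in auto)
    also have "\<tau> a = \<tau> b \<longleftrightarrow> a = b" using \<tau> by (auto simp: bij_betw_def inj_on_def)
    finally show ?thesis .
  qed
  have "?C ** ?M = mat 1" by (simp add: vec_eq_iff matrix_matrix_mult_def mat_def entry)
  then have "det ?C * det ?M = 1" by (metis det_I det_mul)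
  then show ?thesis by auto
qed

lemma frame_columns:
  fixes M :: "complex^'n^'n" and \<tau> :: "'n \<Rightarrow> nat"
  assumes M: "det M \<noteq> 0" and \<sigma>: "bij_betw \<sigma> {1..CARD('n)} UNIV" and k: "k \<le> CARD('n)"
  shows "vec_frame k (\<lambda>i. column (\<sigma> i) M)"
proof -
  obtain C where C: "C ** M = mat 1" "M ** C = mat 1"
    using M invertible_det_nz[of M] by (auto simp: invertible_def)
  define c where "c i x = (C *v x) $ \<sigma> i" for i x
  have col: "C *v column j M = column j (C ** M)" for j
    by (simp add: vec_eq_iff column_def matrix_vector_mult_def matrix_matrix_mult_def)
  have "dual_coords (\<lambda>i. column (\<sigma> i) M) c"
    unfolding dual_coords_def
  proof (intro conjI allI ballI)
    show "c i (x + y) = c i x + c i y" for i x y by (simp add: c_def matrix_vector_right_distrib)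
    show "c i (a *s x) = a * c i x" for i a x by (simp add: c_def vector_scalar_commute)
    show "c i (column (\<sigma> j) M) = (if i = j then 1 else 0)"
      if "i \<in> {1..CARD('n)}" "j \<in> {1..CARD('n)}" for i j
    proof -
      have "\<sigma> i = \<sigma> j \<longleftrightarrow> i = j" using inj_on_eq_iff[OF bij_betw_imp_inj_on[OF \<sigma>]] that by blast
      then show ?thesis unfolding c_def col C(1) by (simp add: column_def mat_def)
    qed
    fix x
    have "(\<Sum>i=1..CARD('n). c i x *s column (\<sigma> i) M) = (\<Sum>e\<in>UNIV. ((C *v x) $ e) *s column e M)"
      unfolding c_def by (rule sum.reindex_bij_betw[OF \<sigma>, of "\<lambda>e. ((C *v x) $ e) *s column e M"])
    also have "\<dots> = M *v (C *v x)" by (rule matrix_mult_sum[symmetric])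
    also have "\<dots> = x" by (simp add: matrix_vector_mul_assoc C(2))
    finally show "(\<Sum>i=1..CARD('n). c i x *s column (\<sigma> i) M) = x" .
  qed
  from dual_coords_frame[OF this k] show ?thesis .
qed

lemma det_line_poly:
  fixes A B :: "complex^'n^'n"
  obtains p :: "complex poly" where "\<And>t. poly p t = det (\<chi> i j. A$i$j + t * (B$i$j - A$i$j))"
proof
  fix t
  show "poly (det (\<chi> i j. [:A$i$j, B$i$j - A$i$j:])) t = det (\<chi> i j. A$i$j + t * (B$i$j - A$i$j))"
    by (simp add: det_def poly_sum poly_prod)
qed

text \<open>
  On the complex line through two invertible matrices the determinant vanishes only finitely often,
  and the complement of a finite set in the complex line is connected.
\<close>

lemma connected_invertible_pairs:
  fixes S :: "(complex^'n::finite^'n) set"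
  assumes S: "\<And>A B t. A \<in> S \<Longrightarrow> B \<in> S \<Longrightarrow> (\<chi> i j. A$i$j + t * (B$i$j - A$i$j)) \<in> S"
  shows "connected {(M :: complex^'n^'n, N). det M \<noteq> 0 \<and> det N \<noteq> 0 \<and> N \<in> S}" (is "connected ?T")
  unfolding connected_iff_connected_component
proof (intro ballI)
  fix x y assume xy: "x \<in> ?T" "y \<in> ?T"
  obtain M0 N0 M1 N1 where x: "x = (M0, N0)" and y: "y = (M1, N1)" by (cases x, cases y)
  obtain p where p: "\<And>t. poly p t = det (\<chi> i j. M0$i$j + t * (M1$i$j - M0$i$j))"
    using det_line_poly[of M0 M1] by blast
  obtain q where q: "\<And>t. poly q t = det (\<chi> i j. N0$i$j + t * (N1$i$j - N0$i$j))"
    using det_line_poly[of N0 N1] by blast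
  define \<gamma> where "\<gamma> t = (\<chi> i j. M0$i$j + t * (M1$i$j - M0$i$j), \<chi> i j. N0$i$j + t * (N1$i$j - N0$i$j))" for t
  define Z where "Z = {t. poly p t = 0} \<union> {t. poly q t = 0}"
  have \<gamma>0: "\<gamma> 0 = x" and \<gamma>1: "\<gamma> 1 = y" by (simp_all add: \<gamma>_def x y)
  have "poly p 0 \<noteq> 0" "poly q 0 \<noteq> 0" using xy x by (simp_all add: p q)
  then have "finite Z" unfolding Z_def by (auto intro: poly_roots_finite)
  then have "connected (- Z)"
    by (intro path_connected_imp_connected path_connected_complement_countable)
      (simp_all add: countable_finite)
  moreover have "continuous_on (- Z) \<gamma>" unfolding \<gamma>_def
    by (intro continuous_intros)
  ultimately have "connected (\<gamma> ` (- Z))" by (rule connected_continuous_image[rotated])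
  moreover have "\<gamma> ` (- Z) \<subseteq> ?T"
  proof (intro image_subsetI)
    fix t assume "t \<in> - Z"
    moreover have "N0 \<in> S" "N1 \<in> S" using xy x y by auto
    ultimately show "\<gamma> t \<in> ?T" using S by (simp add: \<gamma>_def Z_def p[symmetric] q[symmetric])
  qed
  moreover have "poly p 1 \<noteq> 0" "poly q 1 \<noteq> 0" using xy y by (simp_all add: p q)
  then have "x \<in> \<gamma> ` (- Z)" "y \<in> \<gamma> ` (- Z)"
    using \<open>poly p 0 \<noteq> 0\<close> \<open>poly q 0 \<noteq> 0\<close> \<gamma>0 \<gamma>1 by (auto simp: Z_def intro!: image_eqI)
  ultimately show "connected_component ?T x y" unfolding connected_component_def by blast
qed

lemma continuous_map_flag_of:
  assumes "D \<subseteq> {..r}" "\<And>z. z \<in> topspace Z \<Longrightarrow> vec_frame r (u z)"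
    and "\<And>i. continuous_map Z euclidean (\<lambda>z. u z i :: complex^'n::finite)"
  shows "continuous_map Z (Fl D) (\<lambda>z. flag_of D (u z))"
proof (rule continuous_map_into_Fl)
  interpret H: hermitian_space "(*s)" euclidean "hip :: complex^'n \<Rightarrow> _" by (rule hermitian_space_vec)
  show "flag_of D (u z) \<in> topspace (Fl D)" if "z \<in> topspace Z" for z
    by (rule flag_of_in_Fl[OF assms(2)[OF that] assms(1)])
  fix j assume j: "j \<in> D"
  then have "j \<le> r" using assms(1) by auto
  have "continuous_map Z (Gr (*s) euclidean j) (\<lambda>z. vec.span (u z ` {1..j}))"
    by (rule H.continuous_map_frame_span[OF assms(3) H.is_frame_mono[OF assms(2) \<open>j \<le> r\<close>]])
  then show "continuous_map Z (Gr (*s) euclidean j) (\<lambda>z. flag_of D (u z) j)"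
    using j by (simp add: flag_of_def)
qed

text \<open>
  A pair of bases of the same subspace consists of the first \<open>r\<close> columns of \<open>M\<close> and of \<open>M N\<close>, where
  \<open>M\<close> and \<open>N\<close> are invertible and \<open>N\<close> preserves the span of the first \<open>r\<close> coordinate vectors. The
  condition on \<open>N\<close> is linear, so these pairs of matrices form a connected space, and it maps
  continuously onto the fibre product. The bijections \<open>\<sigma>\<close> and \<open>\<tau>\<close> number the coordinates.
\<close>

lemma connected_fibre_product:
  assumes r: "r \<le> CARD('n::finite)"
  shows "connected_space (fibre_product (Fl (flag_dims r \<alpha>)) (Fl (flag_dims r \<beta>))
    (\<lambda>A :: nat \<Rightarrow> (complex^'n) set. A r) (\<lambda>B. B r))" (is "connected_space ?Y")
proof -
  let ?n = "CARD('n)"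
  obtain \<tau> :: "'n \<Rightarrow> nat" where \<tau>: "bij_betw \<tau> UNIV {1..?n}"
    using finite_same_card_bij[of "UNIV :: 'n set" "{1..?n}"] by auto
  define \<sigma> where "\<sigma> = inv_into UNIV \<tau>"
  have \<sigma>: "bij_betw \<sigma> {1..?n} UNIV" unfolding \<sigma>_def by (rule bij_betw_inv_into[OF \<tau>])
  have \<tau>\<sigma>: "\<tau> (\<sigma> i) = i" if "i \<in> {1..?n}" for i
    unfolding \<sigma>_def using bij_betw_inv_into_right[OF \<tau> that] .
  have \<sigma>\<tau>: "\<sigma> (\<tau> a) = a" for a
    unfolding \<sigma>_def using bij_betw_inv_into_left[OF \<tau>] by simp
  have \<tau>_mem: "\<tau> a \<in> {1..?n}" for a using bij_betwE[OF \<tau>] by blast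
  define S where "S = {N :: complex^'n^'n. \<forall>a b. \<tau> b \<le> r \<and> r < \<tau> a \<longrightarrow> N $ a $ b = 0}"
  define T where "T = {(M :: complex^'n^'n, N). det M \<noteq> 0 \<and> det N \<noteq> 0 \<and> N \<in> S}"
  define u where "u z i = column (\<sigma> i) (fst z)" for z :: "(complex^'n^'n) \<times> (complex^'n^'n)" and i
  define u' where "u' z i = column (\<sigma> i) (fst z ** snd z)" for z :: "(complex^'n^'n) \<times> (complex^'n^'n)" and i
  have "connected T" unfolding T_def by (rule connected_invertible_pairs) (auto simp: S_def)
  have frames: "adapted_frames r (u z) (u' z)" if "z \<in> T" for z
  proof -
    interpret V: complex_space "(*s) :: complex \<Rightarrow> complex^'n \<Rightarrow> complex^'n" by (rule complex_space_vec)
    obtain M N where z: "z = (M, N)" by (cases z)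
    have MN: "det M \<noteq> 0" "det N \<noteq> 0" "N \<in> S" using that by (auto simp: T_def z)
    have fr: "vec_frame r (u z)" unfolding u_def z fst_conv by (rule frame_columns[OF MN(1) \<sigma> r])
    have fr': "vec_frame r (u' z)" unfolding u'_def z fst_conv snd_conv
      by (rule frame_columns[OF _ \<sigma> r]) (simp add: det_mul MN)
    have "u' z ` {1..r} \<subseteq> vec.span (u z ` {1..r})"
    proof (intro image_subsetI)
      fix j assume j: "j \<in> {1..r}"
      have "u' z j = (\<Sum>e\<in>UNIV. N $ e $ \<sigma> j *s column e M)"
        by (simp add: u'_def z vec_eq_iff column_def matrix_matrix_mult_def mult.commute)
      also have "\<dots> \<in> vec.span (u z ` {1..r})"
      proof (rule vec.span_sum)
        fix e
        show "N $ e $ \<sigma> j *s column e M \<in> vec.span (u z ` {1..r})"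
        proof (cases "\<tau> e \<le> r")
          case True
          then have "\<tau> e \<in> {1..r}" using \<tau>_mem[of e] by simp
          moreover have "column e M = u z (\<tau> e)" by (simp add: u_def z \<sigma>\<tau>)
          ultimately show ?thesis by (intro vec.span_scale vec.span_base) blast
        next
          case False
          then have "N $ e $ \<sigma> j = 0" using MN(3) \<tau>\<sigma>[of j] j r by (simp add: S_def)
          then show ?thesis by (simp add: vec.span_zero)
        qed
      qed
      finally show "u' z j \<in> vec.span (u z ` {1..r})" .
    qed
    from V.span_frame_eq[OF fr fr' this] fr fr' show ?thesis by (simp add: adapted_frames_def)
  qed
  define g where "g z = (flag_of (flag_dims r \<alpha>) (u z), flag_of (flag_dims r \<beta>) (u' z))" for z
  have cu: "continuous_map (top_of_set T) euclidean (\<lambda>z. u z i)" for i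
    unfolding u_def column_def continuous_map_iff_continuous by (intro continuous_intros)
  have cu': "continuous_map (top_of_set T) euclidean (\<lambda>z. u' z i)" for i
    unfolding u'_def column_def matrix_matrix_mult_def continuous_map_iff_continuous vec_lambda_beta
    by (intro continuous_intros)
  have "continuous_map (top_of_set T) ?Y g"
    unfolding fibre_product_def
  proof (rule continuous_map_into_subtopology)
    show "continuous_map (top_of_set T) (prod_topology (Fl (flag_dims r \<alpha>)) (Fl (flag_dims r \<beta>))) g"
      unfolding g_def
      by (intro continuous_map_pairedI continuous_map_flag_of[OF flag_dims_props(3)] cu cu')
        (use frames in \<open>simp_all add: adapted_frames_def\<close>)
    show "g \<in> topspace (top_of_set T) \<rightarrow> {(A, B). A r = B r}"
      using frames flag_dims_props(2) by (auto simp: g_def flag_of_def adapted_frames_def)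
  qed
  moreover have "g ` T = topspace ?Y"
  proof (intro equalityI subsetI)
    fix y assume "y \<in> g ` T"
    then show "y \<in> topspace ?Y" using adapted_frames.flags_in_fibre_product[OF frames] by (auto simp: g_def)
  next
    fix y assume "y \<in> topspace ?Y"
    then have "(fst y, snd y) \<in> topspace ?Y" by simp
    then obtain w w' where w: "adapted_frames r w w'"
      "fst y = flag_of (flag_dims r \<alpha>) w" "snd y = flag_of (flag_dims r \<beta>) w'"
      by (rule frames_of_flags)
    obtain v c where c: "dual_coords v c" and v: "\<And>i. i \<in> {1..r} \<Longrightarrow> v i = w i"
      using dual_coords_exists[OF adapted_frames.frame[OF w(1)]] by metis
    obtain v' c' where c': "dual_coords v' c'" and v': "\<And>i. i \<in> {1..r} \<Longrightarrow> v' i = w' i"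
      using dual_coords_exists[OF adapted_frames.frame'[OF w(1)]] by metis
    define M where "M = (\<chi> a b. v (\<tau> b) $ a)"
    \<comment> \<open>The columns of \<open>N\<close> are the coordinates of the second basis with respect to the first.\<close>
    define N where "N = (\<chi> a b. c (\<tau> a) (v' (\<tau> b)))"
    have MN: "M ** N = (\<chi> a b. v' (\<tau> b) $ a)"
    proof (simp add: vec_eq_iff matrix_matrix_mult_def M_def N_def, intro allI)
      fix a b
      have "(\<Sum>e\<in>UNIV. v (\<tau> e) $ a * c (\<tau> e) (v' (\<tau> b))) = (\<Sum>i=1..?n. v i $ a * c i (v' (\<tau> b)))"
        by (rule sum.reindex_bij_betw[OF \<tau>, of "\<lambda>i. v i $ a * c i (v' (\<tau> b))"])
      also have "\<dots> = (\<Sum>i=1..?n. c i (v' (\<tau> b)) *s v i) $ a" by (simp add: mult.commute)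
      also have "\<dots> = v' (\<tau> b) $ a" by (simp only: dual_coordsD(7)[OF c])
      finally show "(\<Sum>e\<in>UNIV. v (\<tau> e) $ a * c (\<tau> e) (v' (\<tau> b))) = v' (\<tau> b) $ a" .
    qed
    have "det M \<noteq> 0" unfolding M_def by (rule dual_coords_invertible[OF c \<tau>])
    moreover have "det (M ** N) \<noteq> 0" unfolding MN by (rule dual_coords_invertible[OF c' \<tau>])
    moreover have "N \<in> S"
    proof -
      have "c i (w' j) = 0" if "i \<in> {r+1..?n}" "j \<in> {1..r}" for i j
      proof -
        have "w' j \<in> vec.span (w ` {1..r})"
          using adapted_frames.span_eq[OF w(1)] that(2) by (metis imageI vec.span_base)
        moreover have "(w' j \<in> vec.span (w ` {1..r})) = (\<forall>i\<in>{r+1..?n}. c i (w' j) = 0)"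
          by (rule span_frame_coords[OF c r]) (rule v)
        ultimately show ?thesis using that(1) by blast
      qed
      then show ?thesis unfolding S_def N_def using \<tau>_mem v' by auto
    qed
    ultimately have T: "(M, N) \<in> T" by (simp add: T_def det_mul)
    have "u (M, N) i = w i" if "i \<in> {1..r}" for i
    proof -
      have "\<tau> (\<sigma> i) = i" using \<tau>\<sigma>[of i] that r by simp
      then show ?thesis using v[OF that] by (simp add: u_def column_def M_def)
    qed
    moreover have "u' (M, N) i = w' i" if "i \<in> {1..r}" for i
    proof -
      have "\<tau> (\<sigma> i) = i" using \<tau>\<sigma>[of i] that r by simp
      then show ?thesis using v'[OF that] by (simp add: u'_def column_def MN)
    qed
    moreover have flag_cong: "flag_of D a = flag_of D b"
      if "D \<subseteq> {..r}" "\<And>i. i \<in> {1..r} \<Longrightarrow> a i = b i" for D and a b :: "nat \<Rightarrow> complex^'n"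
      unfolding flag_of_def
    proof (rule restrict_ext)
      fix j assume "j \<in> D"
      then have "a ` {1..j} = b ` {1..j}" using that by (intro image_cong) auto
      then show "vec.span (a ` {1..j}) = vec.span (b ` {1..j})" by simp
    qed
    ultimately have "g (M, N) = y"
      unfolding g_def using w(2,3) flag_dims_props(3) by (metis prod.collapse)
    with T show "y \<in> g ` T" by blast
  qed
  ultimately have "connectedin ?Y (topspace ?Y)"
    using connectedin_continuous_map_image[of "top_of_set T" ?Y g T] \<open>connected T\<close>
    by (simp add: connectedin_topspace)
  then show ?thesis by (simp add: connectedin_topspace)
qed

theorem theorem2p1p9:
  fixes r d :: nat and \<alpha> \<beta> :: "nat \<Rightarrow> nat"
  assumes "1 \<le> r" and "r \<le> CARD('n::finite)"
    and "admissible r d \<alpha> \<beta>"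
  shows "connectedin (quot_space r d) (fixed_component r d \<alpha> \<beta> :: 'n sheaf set) \<and>
    (\<exists>h. homeomorphic_map
           (subtopology (quot_space r d) (fixed_component r d \<alpha> \<beta> :: 'n sheaf set))
           (fibre_product (Fl (flag_dims r \<alpha>)) (Fl (flag_dims r \<beta>)) (\<lambda>A. A r) (\<lambda>B. B r)) h \<and>
         (\<forall>V u u'. V \<in> fixed_component r d \<alpha> \<beta> \<and> adapted_bases r \<alpha> \<beta> V u u' \<longrightarrow>
            h V = (flag_of (flag_dims r \<alpha>) u, flag_of (flag_dims r \<beta>) u')))"
proof -
  interpret P: admissible_pair r d \<alpha> \<beta> by unfold_locales (use assms in auto)
  have homeo: "homeomorphic_map (P.X :: 'n sheaf topology) P.Y (flags_of r d \<alpha> \<beta>)"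
    by (rule P.homeomorphic_map_h)
  have "connected_space (P.Y :: ((nat \<Rightarrow> (complex^'n) set) \<times> _) topology)"
    unfolding P.Y_def by (rule connected_fibre_product[OF assms(2)])
  then have "connected_space (P.X :: 'n sheaf topology)"
    using homeomorphic_connected_space[OF homeomorphic_map_imp_homeomorphic_space[OF homeo]] by blast
  then have "connectedin (quot_space r d) (P.F :: 'n sheaf set)"
    unfolding connectedin_def P.X_def using P.F_subset_topspace by blast
  moreover have "flags_of r d \<alpha> \<beta> V = (flag_of (flag_dims r \<alpha>) u, flag_of (flag_dims r \<beta>) u')"
    if "adapted_bases r \<alpha> \<beta> V u u'" for V :: "'n sheaf" and u u'
    using admissible_frames.flags_of_V[OF adapted_bases_frames(1)[OF assms(1,3) that]]
    unfolding adapted_bases_frames(2)[OF assms(1,3) that, symmetric] .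
  ultimately show ?thesis
    using homeo unfolding P.X_def P.Y_def P.F_def by (intro conjI exI[of _ "flags_of r d \<alpha> \<beta>"]) auto
qed

end
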